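(* Let $n\ge 1$ and let $f\in C_0^\infty(\mathbb{R}^n)$ (smooth, compactly supported, real valued). Below, $N$ ranges over positive integers and $N\to\infty$. (i) Let $W\subset\mathbb{R}^n$ be a regular integer $n$-wedge, with facets $\mathcal{H}_1,\dots,\mathcal{H}_n$ and dual basis $v_1,\dots,v_n$. Then $$\frac{1}{N^n}\sum_{k\in\mathbb{Z}^n\cap NW} f\Big(\frac{k}{N}\Big)\ \sim\ \sum_{q\ge 0}N^{-q}\sum_{\alpha\in\mathbb{N}^n,\ |\alpha|=q} C(W,\alpha)\int_{\bigcap_{1\le i\le n,\ \alpha_i>0}\mathcal{H}_i} \mathrm{D}^{q-\nu(\alpha)}f\cdot v_{\alpha-r(\alpha)},$$ where the integral is taken over $W$ if no $\alpha_i$ is positive, and the integral over a single point means evaluation at this point. (ii) Suppose $n\in\{1,2,3\}$ and let $\Delta\subset\mathbb{R}^n$ be an $n$-dimensional Delzant polytope with vertices in $\mathbb{Z}^n$. For every $q\ge 1$ and every face $F\in\mathcal{F}_m$ with $1\le m\le q$ (and $m\le n$), there exists a linear differential operator $R_q(F,\cdot)$ of degree $q-m$, depending only on $F$ and involving only derivatives of $f$ in directions normal to $F$, such that $$\frac{1}{N^n}\sum_{k\in\mathbb{Z}^n\cap N\Delta} f\Big(\frac{k}{N}\Big)\ \sim\ \int_\Delta f+\sum_{q\ge 1}N^{-q}\sum_{1\le m\le q,\ F\in\mathcal{F}_m}\ \int_F^\star R_q(F,f).$$ The operators $R_q(F,\cdot)$ do not depend on the function $f$.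
   Context: Asymptotics. $S_N\sim\sum_{q\ge0}N^{-q}a_q$ means equality modulo $\mathcal{O}(N^{-\infty})$: for every $Q\ge 0$, $S_N-\sum_{q=0}^{Q}N^{-q}a_q=\mathcal{O}(N^{-Q-1})$ as $N\to\infty$. For a set $X$, $NX=\{Nx : x\in X\}$. $\mathbb{N}=\{0,1,2,\dots\}$. Wedges. A regular integer $n$-wedge is a set $W=\{x\in\mathbb{R}^n : \langle u_i,x\rangle\le c_i,\ i=1,\dots,n\}$, where the $c_i$ are integers, the $u_i$ are primitive lattice vectors of $(\mathbb{Z}^n)^*\subset(\mathbb{R}^n)^*$, and $\{u_1,\dots,u_n\}$ is a lattice basis of $(\mathbb{Z}^n)^*$. Its facets are $\mathcal{H}_i=\{x\in W : \langle u_i,x\rangle=c_i\}$, and $(v_1,\dots,v_n)$ is the basis of $\mathbb{R}^n$ dual to $(u_1,\dots,u_n)$. Multi-indices. For $\alpha\in\mathbb{N}^n$: $|\alpha|=\sum\alpha_i$, $\alpha!=\alpha_1!\cdots\alpha_n!$; $r(\alpha)\in\mathbb{N}^n$ has $r(\alpha)_i=1$ if $\alpha_i>0$ and $0$ otherwise; $\nu(\alpha)$ is the number of $i$ with $\alpha_i>0$. For $\beta\in\mathbb{N}^n$, $v_\beta$ is the $|\beta|$-tuple in which $v_1$ appears $\beta_1$ times, ..., $v_n$ appears $\beta_n$ times, and $\mathrm{D}^{k}f\cdot(a_1,\dots,a_k)$ is the $k$-th differential of $f$ evaluated on $(a_1,\dots,a_k)$, i.e. the iterated directional derivative. Constants.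 $b_0=1$, $b_1=1/2$, $b_{2p+1}=0$ for $p\ge1$, and $b_{2p}=(-1)^{p-1}B_p$ with $B_p>0$ the $p$-th Bernoulli number in the convention $B_1=1/6$, $B_2=1/30,\dots$; equivalently $\frac{s}{1-e^{-s}}=\sum_{n\ge0}b_n\frac{s^n}{n!}$. Let $K_\alpha(W)$ be the (absolute) Jacobian of the restriction of the affine map $\varphi(x)=(\langle u_i,x\rangle-c_i)_{1\le i\le n}$ to the face $\bigcap_{i,\alpha_i>0}\mathcal{H}_i$, as a map onto its image in $\bigcap_{i,\alpha_i>0}\{y_i=0\}$; equivalently the inverse of the Euclidean volume of the parallelotope generated by the $v_i$ with $\alpha_i=0$ (and $K_\alpha(W)=1$ if the face is a point). Then $C(W,\alpha)=\big(\frac{1}{\alpha!}\prod_{i=1}^n b_{\alpha_i}\big)K_\alpha(W)$. Integrals $\int_F$ over faces are with respect to the Euclidean (Lebesgue) measure of the face. Polytopes. An $n$-dimensional (convex) polytope $\Delta\subset\mathbb{R}^n$ is Delzant if exactly $n$ edges meet at each vertex and, for each vertex $v$, the edges at $v$ lie on rays $v+t\alpha_i$, $0\le t<\infty$, with $(\alpha_1,\dots,\alpha_n)$ a lattice basis of $\mathbb{Z}^n$. It is written $\Delta=\{x:\langle u_i,x\rangle\le c_i,\ i=1,\dots,d\}$ with one inequality per facet and $u_i\in(\mathbb{Z}^n)^*$ primitive, pointing outwards. $\mathcal{F}_m$ is the set of faces of $\Delta$ of codimension $m$. For a face $F$, let $L(F)$ be the linear subspace spanned by the differences of points of $F$; $\int_F^\star=K_F\int_F$,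 where $K_F$ is the inverse of the Euclidean volume of a fundamental parallelotope of the lattice $L(F)\cap\mathbb{Z}^n$ (if $F$ is a vertex, $\int_F^\star$ is evaluation at $F$). Operators. A linear differential operator of degree $k$ involving only derivatives in directions normal to $F$ is a (possibly zero) linear combination, with constant coefficients, of terms $f\mapsto \mathrm{D}^kf\cdot(a_1,\dots,a_k)$ with $a_1,\dots,a_k$ in the Euclidean orthogonal complement of $L(F)$. "Depending only on $F$" means as a face of the polytope: the operator is determined by the facets of $\Delta$ containing $F$, i.e. if codimension-$m$ faces $F$, $F'$ of two such polytopes in $\mathbb{R}^n$ have the same collection of pairs $(u_i,c_i)$ for the facets containing them, then $R_q(F,\cdot)=R_q(F',\cdot)$. *)

theory Defs
  imports
    "HOL-Analysis.Analysis"
    "HOL-Library.Landau_Symbols"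
    "HOL-Computational_Algebra.Formal_Power_Series"
begin

section \<open>Asymptotic expansions\<close>

definition asymptotic_expansion :: "(nat \<Rightarrow> real) \<Rightarrow> (nat \<Rightarrow> real) \<Rightarrow> bool" where
  "asymptotic_expansion S a \<longleftrightarrow>
     (\<forall>Q. (\<lambda>N. S N - (\<Sum>q\<le>Q. a q / real N ^ q)) \<in> O(\<lambda>N. 1 / real N ^ (Q + 1)))"


section \<open>Smooth functions and differentials\<close>

primrec C_k :: "nat \<Rightarrow> ('a::real_normed_vector \<Rightarrow> real) \<Rightarrow> bool" where
  "C_k 0 f \<longleftrightarrow> continuous_on UNIV f"
| "C_k (Suc k) f \<longleftrightarrow>
     (\<forall>x. f differentiable (at x)) \<and> (\<forall>a. C_k k (\<lambda>x. frechet_derivative f (at x) a))"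

definition smooth_compact_support :: "('a::real_normed_vector \<Rightarrow> real) \<Rightarrow> bool" where
  "smooth_compact_support f \<longleftrightarrow> (\<forall>k. C_k k f) \<and> compact (closure {x. f x \<noteq> 0})"

text \<open>The \<open>k\<close>-th differential evaluated on a \<open>k\<close>-tuple of vectors, given as a list of length \<open>k\<close>.\<close>

primrec differential ::
  "('a::real_normed_vector \<Rightarrow> real) \<Rightarrow> 'a list \<Rightarrow> 'a \<Rightarrow> real" where
  "differential f [] = f"
| "differential f (a # as) = (\<lambda>x. frechet_derivative (differential f as) (at x) a)"


section \<open>Lattices\<close>

text \<open>The dual lattice is identified with \<open>\<int>\<^sup>n\<close> through the standard inner product.\<close>

definition int_vecs :: "(real ^ 'n) set" where
  "int_vecs = {x. \<forall>i. x $ i \<in> \<int>}"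

definition primitive_vec :: "real ^ 'n \<Rightarrow> bool" where
  "primitive_vec u \<longleftrightarrow> u \<in> int_vecs \<and>
     (\<forall>(k::int) w. w \<in> int_vecs \<and> u = of_int k *\<^sub>R w \<longrightarrow> \<bar>k\<bar> = 1)"

definition lattice_basis :: "'a::euclidean_space set \<Rightarrow> 'a set \<Rightarrow> bool" where
  "lattice_basis V \<Lambda> \<longleftrightarrow> independent V \<and>
     \<Lambda> = range (\<lambda>a :: 'a \<Rightarrow> int. \<Sum>v\<in>V. of_int (a v) *\<^sub>R v)"

text \<open>For compactly supported \<open>f\<close> only finitely many terms of this sum are nonzero.\<close>

definition riemann_sum :: "(real ^ 'n \<Rightarrow> real) \<Rightarrow> (real ^ 'n) set \<Rightarrow> nat \<Rightarrow> real" where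
  "riemann_sum f S N = 1 / real N ^ CARD('n) *
     (\<Sum>\<^sub>\<infinity>k \<in> int_vecs \<inter> (\<lambda>x. real N *\<^sub>R x) ` S. f (k /\<^sub>R real N))"


section \<open>Euclidean measure on affine subspaces\<close>

definition direction_space :: "'a::real_vector set \<Rightarrow> 'a set" where
  "direction_space F = span {x - y | x y. x \<in> F \<and> y \<in> F}"

definition orthonormal_basis :: "'a::euclidean_space set \<Rightarrow> 'a set \<Rightarrow> bool" where
  "orthonormal_basis B L \<longleftrightarrow> pairwise orthogonal B \<and> (\<forall>b\<in>B. norm b = 1) \<and> span B = L"

text \<open>
  The Lebesgue measure of the affine hull of a nonempty set \<open>S\<close>, carried over from the product
  measure by an orthonormal coordinate system whose choice does not matter (\<open>lborel\<close> itself is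
  defined in this way from \<open>Basis\<close>). If \<open>S\<close> is a point, the basis is empty and this is
  the unit mass at that point.
\<close>

definition affine_lborel :: "'a::euclidean_space set \<Rightarrow> 'a measure" where
  "affine_lborel S =
     (let B = (SOME B. orthonormal_basis B (direction_space S)); p = (SOME p. p \<in> S)
      in distr (\<Pi>\<^sub>M b\<in>B. lborel) borel (\<lambda>t. p + (\<Sum>b\<in>B. t b *\<^sub>R b)))"

definition face_integral :: "'a::euclidean_space set \<Rightarrow> ('a \<Rightarrow> real) \<Rightarrow> real" where
  "face_integral F g = (LINT x:F|affine_lborel F. g x)"

definition parallelotope :: "'a::euclidean_space set \<Rightarrow> 'a set" where
  "parallelotope V = {(\<Sum>v\<in>V. t v *\<^sub>R v) | t. \<forall>v\<in>V. 0 \<le> t v \<and> t v \<le> 1}"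

definition parallelotope_volume :: "'a::euclidean_space set \<Rightarrow> real" where
  "parallelotope_volume V = measure (affine_lborel (parallelotope V)) (parallelotope V)"


section \<open>Wedges\<close>

text \<open>A wedge is given by its normals \<open>u\<close> and constants \<open>c\<close>, indexed by \<open>'n\<close>.\<close>

definition regular_integer_wedge :: "('n::finite \<Rightarrow> real ^ 'n) \<Rightarrow> bool" where
  "regular_integer_wedge u \<longleftrightarrow> (\<forall>i. primitive_vec (u i)) \<and> lattice_basis (range u) int_vecs"

definition wedge :: "('n::finite \<Rightarrow> real ^ 'n) \<Rightarrow> ('n \<Rightarrow> int) \<Rightarrow> (real ^ 'n) set" where
  "wedge u c = {x. \<forall>i. u i \<bullet> x \<le> of_int (c i)}"

definition wedge_facet ::
  "('n::finite \<Rightarrow> real ^ 'n) \<Rightarrow> ('n \<Rightarrow> int) \<Rightarrow> 'n \<Rightarrow> (real ^ 'n) set" where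
  "wedge_facet u c i = {x \<in> wedge u c. u i \<bullet> x = of_int (c i)}"

definition wedge_face ::
  "('n::finite \<Rightarrow> real ^ 'n) \<Rightarrow> ('n \<Rightarrow> int) \<Rightarrow> ('n \<Rightarrow> nat) \<Rightarrow> (real ^ 'n) set" where
  "wedge_face u c \<alpha> = wedge u c \<inter> (\<Inter>i\<in>{i. \<alpha> i > 0}. wedge_facet u c i)"

definition dual_basis :: "('n::finite \<Rightarrow> real ^ 'n) \<Rightarrow> ('n \<Rightarrow> real ^ 'n) \<Rightarrow> bool" where
  "dual_basis u v \<longleftrightarrow> (\<forall>i j. u i \<bullet> v j = (if i = j then 1 else 0))"

text \<open>The coefficients of \<open>s / (1 - e\<^sup>-\<^sup>s) = \<Sum> b\<^sub>n s\<^sup>n / n!\<close>.\<close>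

definition bern :: "nat \<Rightarrow> real" where
  "bern n = fact n * fps_nth (fps_X / (1 - fps_exp (- 1))) n"

definition supp_index :: "('n \<Rightarrow> nat) \<Rightarrow> 'n \<Rightarrow> nat" where
  "supp_index \<alpha> i = (if \<alpha> i > 0 then 1 else 0)"

text \<open>
  The tuple \<open>v\<^sub>\<beta>\<close>, for a fixed enumeration of the index type. The enumeration does not matter:
  differentials of smooth functions are symmetric.
\<close>

definition index_list :: "'n::finite list" where
  "index_list = (SOME xs. distinct xs \<and> set xs = UNIV)"

definition multi_tuple :: "('n::finite \<Rightarrow> 'a) \<Rightarrow> ('n \<Rightarrow> nat) \<Rightarrow> 'a list" where
  "multi_tuple v \<beta> = concat (map (\<lambda>i. replicate (\<beta> i) (v i)) index_list)"

definition wedge_jacobian :: "('n::finite \<Rightarrow> real ^ 'n) \<Rightarrow> ('n \<Rightarrow> nat) \<Rightarrow> real" where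
  "wedge_jacobian v \<alpha> = 1 / parallelotope_volume (v ` {i. \<alpha> i = 0})"

definition wedge_const :: "('n::finite \<Rightarrow> real ^ 'n) \<Rightarrow> ('n \<Rightarrow> nat) \<Rightarrow> real" where
  "wedge_const v \<alpha> =
     1 / (\<Prod>i\<in>UNIV. fact (\<alpha> i)) * (\<Prod>i\<in>UNIV. bern (\<alpha> i)) * wedge_jacobian v \<alpha>"


section \<open>Delzant polytopes\<close>

definition delzant :: "(real ^ 'n) set \<Rightarrow> bool" where
  "delzant \<Delta> \<longleftrightarrow> polytope \<Delta> \<and> aff_dim \<Delta> = int CARD('n) \<and>
     (\<forall>v. v extreme_point_of \<Delta> \<longrightarrow>
        card {e. e edge_of \<Delta> \<and> v \<in> e} = CARD('n) \<and>
        (\<exists>A. lattice_basis A int_vecs \<and>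
           (\<forall>e. e edge_of \<Delta> \<and> v \<in> e \<longrightarrow> (\<exists>a\<in>A. e \<subseteq> {v + t *\<^sub>R a | t. 0 \<le> t}))))"

definition integral_delzant :: "(real ^ 'n) set \<Rightarrow> bool" where
  "integral_delzant \<Delta> \<longleftrightarrow> delzant \<Delta> \<and> (\<forall>v. v extreme_point_of \<Delta> \<longrightarrow> v \<in> int_vecs)"

text \<open>In the library the empty set is a face; it is excluded here.\<close>

definition codim_faces :: "nat \<Rightarrow> (real ^ 'n) set \<Rightarrow> (real ^ 'n) set set" where
  "codim_faces m \<Delta> =
     {F. F face_of \<Delta> \<and> F \<noteq> {} \<and> aff_dim F = int CARD('n) - int m}"

text \<open>The pairs \<open>(u\<^sub>i, c\<^sub>i)\<close> of the facets of \<open>\<Delta>\<close> that contain \<open>F\<close>.\<close>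

definition facet_pairs ::
  "(real ^ 'n) set \<Rightarrow> (real ^ 'n) set \<Rightarrow> ((real ^ 'n) \<times> real) set" where
  "facet_pairs \<Delta> F =
     {(u, c). primitive_vec u \<and> \<Delta> \<subseteq> {x. u \<bullet> x \<le> c} \<and>
              (\<exists>G. G facet_of \<Delta> \<and> F \<subseteq> G \<and> G = \<Delta> \<inter> {x. u \<bullet> x = c})}"

definition face_const :: "(real ^ 'n) set \<Rightarrow> real" where
  "face_const F =
     1 / parallelotope_volume (SOME V. lattice_basis V (direction_space F \<inter> int_vecs))"

definition face_integral_star :: "(real ^ 'n) set \<Rightarrow> (real ^ 'n \<Rightarrow> real) \<Rightarrow> real" where
  "face_integral_star F g = face_const F * face_integral F g"

definition normal_diff_operator ::
  "nat \<Rightarrow> (real ^ 'n) set \<Rightarrow> ((real ^ 'n \<Rightarrow> real) \<Rightarrow> real ^ 'n \<Rightarrow> real) \<Rightarrow> bool" where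
  "normal_diff_operator k F P \<longleftrightarrow>
     (\<exists>T coef. finite T \<and>
        (\<forall>as\<in>T. length as = k \<and> set as \<subseteq> orthogonal_comp (direction_space F)) \<and>
        P = (\<lambda>f x. \<Sum>as\<in>T. coef as * differential f as x))"

end

theory Submission
  imports Defs
begin

text \<open>
  On a wedge, the coordinates \<open>y\<^sub>i = \<langle>u\<^sub>i, x\<rangle>\<close> map \<open>\<int>\<^sup>n\<close> onto \<open>\<int>\<^sup>n\<close>, and the Riemann sum becomes the
  integral of \<open>f (\<Sum> y\<^sub>i v\<^sub>i)\<close> against a product of one-dimensional counting measures, one on each
  ray \<open>y\<^sub>i \<le> c\<^sub>i\<close> (\<open>riemann_sum_eq_integral\<close>). In one variable the Euler--Maclaurin formula
  (\<open>Euler_Maclaurin_integer_interval\<close>) trades the counting measure for Lebesgue measure on the ray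
  plus derivatives at its end point. It is applied to one coordinate after another
  (\<open>partial_expansion_step\<close>); since all measures involved have bounded mass on the support of
  \<open>f\<close>, the error of one coordinate keeps its order under integration over the others, and
  \<open>coordinate_expansion\<close> results. To express its terms by Euclidean face integrals one compares
  two translation-invariant measures on the direction space of a face: such measures are
  proportional (\<open>span_measure_proportional\<close>), and the parallelotope spanned by the \<open>v\<^sub>i\<close> shows
  that the factor is the Jacobian (\<open>face_integral_lattice_coordinates\<close>).

  For a Delzant polytope, a partition of unity (\<open>smooth_partition\<close>) reduces to a function that
  vanishes off a region where the polytope agrees with the wedge at one of its vertices. The
  wedge expansion differentiates in the directions \<open>v\<^sub>i\<close>, which are neither normal to the face nor
  determined by it: they change from vertex to vertex. So every direction is split into a part
  normal to the face and a tangential part \<open>\<Sum> t\<^sub>j v\<^sub>j\<close>, and a derivative along a tangential \<open>v\<^sub>j\<close>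
  integrates to an integral over the smaller face on which \<open>y\<^sub>j = c\<^sub>j\<close>
  (\<open>coord_integral_by_parts\<close>). Iterating this ends with normal derivatives on all faces
  (\<open>reduce\<close>, \<open>coord_integral_reduce\<close>). What arrives at a face depends on the directions only
  through their inner products with the normals of the facets containing that face
  (\<open>reduce_cong\<close>), hence can be computed from these normals alone (\<open>normal_operator\<close>). Each vertex
  of a face therefore produces the same operator on that face, and the pieces of the partition
  of unity add up (\<open>delzant_asymptotics\<close>). The face integrals are normalised consistently because
  the volume of a fundamental parallelotope does not depend on the lattice basis
  (\<open>span_measure_lattice_invariant\<close>).
\<close>

section \<open>Smooth functions and their differentials\<close>

definition smooth :: "('a::real_normed_vector \<Rightarrow> real) \<Rightarrow> bool" where
  "smooth f \<longleftrightarrow> (\<forall>k. C_k k f)"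

lemma frechet_derivative_eqI:
  "(f has_derivative f') (at x) \<Longrightarrow> frechet_derivative f (at x) = f'"
  using frechet_derivative_at by metis

lemma frechet_derivative_worksI:
  "f differentiable (at x) \<Longrightarrow> (f has_derivative frechet_derivative f (at x)) (at x)"
  using frechet_derivative_works by blast

lemma C_k_continuous: "C_k k f \<Longrightarrow> continuous_on UNIV f"
  by (cases k) (auto intro!: differentiable_imp_continuous_on simp: differentiable_on_def)

lemma C_k_Suc_D: "C_k (Suc k) f \<Longrightarrow> C_k k f"
proof (induction k arbitrary: f)
  case 0
  then show ?case using C_k_continuous by fastforce
next
  case (Suc k)
  then show ?case by (metis C_k.simps(2))
qed

lemma smooth_continuous: "smooth f \<Longrightarrow> continuous_on A f"
  unfolding smooth_def using C_k_continuous continuous_on_subset by blast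

lemma smooth_has_derivative:
  "smooth f \<Longrightarrow> (f has_derivative frechet_derivative f (at x)) (at x)"
  unfolding smooth_def by (metis C_k.simps(2) frechet_derivative_worksI)

lemma smooth_frechet: "smooth f \<Longrightarrow> smooth (\<lambda>x. frechet_derivative f (at x) a)"
  unfolding smooth_def using C_k.simps(2) by blast

lemma smooth_differential: "smooth f \<Longrightarrow> smooth (differential f as)"
  by (induction as) (auto simp: smooth_frechet)

lemma C_k_const: "C_k k (\<lambda>_. c)"
  by (induction k arbitrary: c) (auto simp: frechet_derivative_const)

lemma C_k_add: "C_k k f \<Longrightarrow> C_k k g \<Longrightarrow> C_k k (\<lambda>x. f x + g x)"
proof (induction k arbitrary: f g)
  case 0
  then show ?case by (auto intro: continuous_on_add)
next
  case (Suc k)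
  have "frechet_derivative (\<lambda>x. f x + g x) (at x) =
      (\<lambda>a. frechet_derivative f (at x) a + frechet_derivative g (at x) a)" for x
    using Suc.prems by (intro frechet_derivative_eqI has_derivative_add)
      (auto simp: frechet_derivative_worksI)
  then show ?case using Suc by auto
qed

lemma C_k_mult: "C_k k f \<Longrightarrow> C_k k g \<Longrightarrow> C_k k (\<lambda>x. f x * g x)"
proof (induction k arbitrary: f g)
  case 0
  then show ?case by (auto intro: continuous_on_mult)
next
  case (Suc k)
  have fr: "frechet_derivative (\<lambda>x. f x * g x) (at x) =
      (\<lambda>a. f x * frechet_derivative g (at x) a + frechet_derivative f (at x) a * g x)" for x
    using Suc.prems by (intro frechet_derivative_eqI has_derivative_mult)
      (auto simp: frechet_derivative_worksI)
  have "C_k k f" "C_k k g"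
    using Suc.prems C_k_Suc_D by blast+
  then show ?case using Suc by (auto simp: fr intro!: C_k_add)
qed

text \<open>
  In the chain rule the factor \<open>h' \<circ> g\<close> is again a composition, so the induction has to generalise
  over both functions.
\<close>

lemma C_k_compose:
  fixes h :: "real \<Rightarrow> real"
  shows "C_k k h \<Longrightarrow> C_k k g \<Longrightarrow> C_k k (\<lambda>x. h (g x))"
proof (induction k arbitrary: g h)
  case 0
  then show ?case by (auto intro: continuous_on_compose2)
next
  case (Suc k)
  have dh: "(h has_derivative frechet_derivative h (at y)) (at y)" for y
    using Suc.prems by (auto simp: frechet_derivative_worksI)
  have dg: "(g has_derivative frechet_derivative g (at y)) (at y)" for y
    using Suc.prems by (auto simp: frechet_derivative_worksI)
  have comp: "((\<lambda>x. h (g x)) has_derivative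
      (\<lambda>a. frechet_derivative h (at (g x)) (frechet_derivative g (at x) a))) (at x)" for x
    using diff_chain_at[OF dg dh] by (simp add: o_def)
  have lin: "frechet_derivative h (at y) r = r * frechet_derivative h (at y) 1" for y r
    using linear_scale[OF has_derivative_linear[OF dh[of y]], of r 1] by simp
  have fr: "frechet_derivative (\<lambda>x. h (g x)) (at x) =
      (\<lambda>a. frechet_derivative g (at x) a * frechet_derivative h (at (g x)) 1)" for x
    using frechet_derivative_eqI[OF comp] lin by metis
  have "C_k k g" using Suc.prems C_k_Suc_D by blast
  moreover have "C_k k (\<lambda>x. frechet_derivative h (at x) 1)" using Suc.prems by simp
  ultimately have "C_k k (\<lambda>x. frechet_derivative h (at (g x)) 1)"
    using Suc.IH[of "\<lambda>x. frechet_derivative h (at x) 1" g] by blast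
  then show ?case
    using Suc.prems comp differentiable_def by (auto simp: fr intro!: C_k_mult)
qed

lemma C_k_inverse:
  assumes "\<And>x. g x \<noteq> 0"
  shows "C_k k g \<Longrightarrow> C_k k (\<lambda>x. inverse (g x))"
proof (induction k)
  case 0
  then show ?case using assms by (auto intro!: continuous_on_inverse)
next
  case (Suc k)
  have dg: "(g has_derivative frechet_derivative g (at y)) (at y)" for y
    using Suc.prems by (auto simp: frechet_derivative_worksI)
  have der: "((\<lambda>x. inverse (g x)) has_derivative
      (\<lambda>a. - (inverse (g x) * frechet_derivative g (at x) a * inverse (g x)))) (at x)" for x
    by (rule has_derivative_compose[OF dg has_derivative_inverse'[OF assms]])
  have fr: "frechet_derivative (\<lambda>x. inverse (g x)) (at x) =
      (\<lambda>a. (- 1) * (inverse (g x) * frechet_derivative g (at x) a * inverse (g x)))" for x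
    using frechet_derivative_eqI[OF der] by simp
  have "C_k k g" using Suc.prems C_k_Suc_D by blast
  then have "C_k k (\<lambda>x. inverse (g x))" using Suc.IH by blast
  moreover have "(\<lambda>x. inverse (g x)) differentiable (at x)" for x
    using der by (auto simp: differentiable_def)
  ultimately show ?case
    using Suc.prems unfolding C_k.simps fr by (intro conjI allI C_k_mult C_k_const) auto
qed

lemma C_k_affine: "C_k k (\<lambda>x. b - a \<bullet> x)"
proof -
  have fr: "((\<lambda>x. b - a \<bullet> x) has_derivative (\<lambda>h. - (a \<bullet> h))) (at x)" for x
    by (auto intro!: derivative_eq_intros)
  show ?thesis
    using fr frechet_derivative_eqI[OF fr] differentiable_def
    by (cases k) (auto intro!: continuous_intros simp: C_k_const)
qed

lemma smooth_const: "smooth (\<lambda>_. c)"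
  and smooth_add: "smooth f \<Longrightarrow> smooth g \<Longrightarrow> smooth (\<lambda>x. f x + g x)"
  and smooth_mult: "smooth f \<Longrightarrow> smooth g \<Longrightarrow> smooth (\<lambda>x. f x * g x)"
  and smooth_compose: "smooth h \<Longrightarrow> smooth f \<Longrightarrow> smooth (\<lambda>x. h (f x))"
  and smooth_inverse: "(\<And>x. f x \<noteq> 0) \<Longrightarrow> smooth f \<Longrightarrow> smooth (\<lambda>x. inverse (f x))"
  and smooth_affine: "smooth (\<lambda>x. b - a \<bullet> x)"
  for h :: "real \<Rightarrow> real"
  by (simp_all add: smooth_def C_k_const C_k_add C_k_mult C_k_compose C_k_inverse C_k_affine)

lemma smooth_sum: "(\<And>i. i \<in> I \<Longrightarrow> smooth (f i)) \<Longrightarrow> smooth (\<lambda>x. \<Sum>i\<in>I. f i x)"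
  by (induction I rule: infinite_finite_induct) (auto intro: smooth_const smooth_add)

lemma smooth_prod: "(\<And>i. i \<in> I \<Longrightarrow> smooth (f i)) \<Longrightarrow> smooth (\<lambda>x. \<Prod>i\<in>I. f i x)"
  by (induction I rule: infinite_finite_induct) (auto intro: smooth_const smooth_mult)

lemma smooth_line_derivative:
  assumes "smooth f"
  shows "((\<lambda>t. f (p + t *\<^sub>R a)) has_real_derivative
           frechet_derivative f (at (p + t *\<^sub>R a)) a) (at t)"
proof -
  have 1: "((\<lambda>t. p + t *\<^sub>R a) has_derivative (\<lambda>h. h *\<^sub>R a)) (at t)"
    by (auto intro!: derivative_eq_intros)
  have d: "(f has_derivative frechet_derivative f (at y)) (at y)" for y
    using assms by (rule smooth_has_derivative)
  have "((\<lambda>t. f (p + t *\<^sub>R a)) has_derivative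
      (\<lambda>h. frechet_derivative f (at (p + t *\<^sub>R a)) (h *\<^sub>R a))) (at t)"
    using diff_chain_at[OF 1 d] by (simp add: o_def)
  moreover have "frechet_derivative f (at (p + t *\<^sub>R a)) (h *\<^sub>R a)
      = frechet_derivative f (at (p + t *\<^sub>R a)) a * h" for h
    using linear_scale[OF has_derivative_linear[OF d]] by simp
  ultimately show ?thesis
    by (simp add: has_field_derivative_def)
qed

text \<open>
  The mean value theorem, applied first in the direction \<open>a\<close> and then in the direction \<open>b\<close>. The
  left-hand side is symmetric in \<open>a\<close> and \<open>b\<close>; comparing the two orders as \<open>s \<rightarrow> 0\<close> gives the
  symmetry of second derivatives.
\<close>

lemma second_difference_mean_value:
  assumes "smooth f" "s > 0"
  shows "\<exists>\<sigma> \<tau>. 0 < \<sigma> \<and> \<sigma> < s \<and> 0 < \<tau> \<and> \<tau> < s \<and>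
    f (x + s *\<^sub>R a + s *\<^sub>R b) - f (x + s *\<^sub>R a) - f (x + s *\<^sub>R b) + f x
      = s\<^sup>2 * differential f [b, a] (x + \<sigma> *\<^sub>R a + \<tau> *\<^sub>R b)"
proof -
  define F where "F \<sigma> = f ((x + s *\<^sub>R b) + \<sigma> *\<^sub>R a) - f (x + \<sigma> *\<^sub>R a)" for \<sigma>
  define G where "G = (\<lambda>x. frechet_derivative f (at x) a)"
  have G: "smooth G" unfolding G_def using assms(1) by (rule smooth_frechet)
  have dF: "(F has_real_derivative G (x + s *\<^sub>R b + \<sigma> *\<^sub>R a) - G (x + \<sigma> *\<^sub>R a)) (at \<sigma>)" for \<sigma>
    unfolding F_def G_def by (intro DERIV_diff smooth_line_derivative assms)
  obtain \<sigma> where \<sigma>: "0 < \<sigma>" "\<sigma> < s"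
    "F s - F 0 = (s - 0) * (G (x + s *\<^sub>R b + \<sigma> *\<^sub>R a) - G (x + \<sigma> *\<^sub>R a))"
    using MVT2[OF assms(2) dF] by blast
  obtain \<tau> where \<tau>: "0 < \<tau>" "\<tau> < s"
    "G ((x + \<sigma> *\<^sub>R a) + s *\<^sub>R b) - G ((x + \<sigma> *\<^sub>R a) + 0 *\<^sub>R b)
      = (s - 0) * frechet_derivative G (at (x + \<sigma> *\<^sub>R a + \<tau> *\<^sub>R b)) b"
    using MVT2[OF assms(2) smooth_line_derivative[OF G]] by blast
  have e: "x + \<sigma> *\<^sub>R a + s *\<^sub>R b = x + s *\<^sub>R b + \<sigma> *\<^sub>R a" for \<sigma> by simp
  have "F s - F 0 = s * (s * frechet_derivative G (at (x + \<sigma> *\<^sub>R a + \<tau> *\<^sub>R b)) b)"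
    using \<sigma>(3) \<tau>(3) e by simp
  then have "f (x + s *\<^sub>R a + s *\<^sub>R b) - f (x + s *\<^sub>R a) - f (x + s *\<^sub>R b) + f x
      = s\<^sup>2 * differential f [b, a] (x + \<sigma> *\<^sub>R a + \<tau> *\<^sub>R b)"
    unfolding e[of s] F_def G_def by (simp add: power2_eq_square mult.assoc)
  then show ?thesis using \<sigma>(1,2) \<tau>(1,2) by blast
qed

lemma differential_swap:
  assumes "smooth f"
  shows "differential f [b, a] x = differential f [a, b] x"
proof -
  have ex: "\<exists>\<sigma> \<tau>. 0 < \<sigma> \<and> \<sigma> < s \<and> 0 < \<tau> \<and> \<tau> < s \<and>
    f (x + s *\<^sub>R a + s *\<^sub>R b) - f (x + s *\<^sub>R a) - f (x + s *\<^sub>R b) + f x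
      = s\<^sup>2 * differential f [b, a] (x + \<sigma> *\<^sub>R a + \<tau> *\<^sub>R b)" if "s > 0" for s a b
    using second_difference_mean_value[OF assms that] .
  define s where "s n = inverse (real (Suc n))" for n
  have s: "s n > 0" for n unfolding s_def by simp
  have s0: "s \<longlonglongrightarrow> 0" unfolding s_def by (rule LIMSEQ_inverse_real_of_nat)
  obtain \<sigma> \<tau> where 1: "\<And>n. 0 < \<sigma> n \<and> \<sigma> n < s n \<and> 0 < \<tau> n \<and> \<tau> n < s n \<and>
      f (x + s n *\<^sub>R a + s n *\<^sub>R b) - f (x + s n *\<^sub>R a) - f (x + s n *\<^sub>R b) + f x
      = (s n)\<^sup>2 * differential f [b, a] (x + \<sigma> n *\<^sub>R a + \<tau> n *\<^sub>R b)"
    using ex[OF s, of _ a b] by metis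
  obtain \<sigma>' \<tau>' where 2: "\<And>n. 0 < \<sigma>' n \<and> \<sigma>' n < s n \<and> 0 < \<tau>' n \<and> \<tau>' n < s n \<and>
      f (x + s n *\<^sub>R b + s n *\<^sub>R a) - f (x + s n *\<^sub>R b) - f (x + s n *\<^sub>R a) + f x
      = (s n)\<^sup>2 * differential f [a, b] (x + \<sigma>' n *\<^sub>R b + \<tau>' n *\<^sub>R a)"
    using ex[OF s, of _ b a] by metis
  have eq: "differential f [b, a] (x + \<sigma> n *\<^sub>R a + \<tau> n *\<^sub>R b) = differential f [a, b] (x + \<sigma>' n *\<^sub>R b + \<tau>' n *\<^sub>R a)" for n
  proof -
    have "(s n)\<^sup>2 * differential f [b, a] (x + \<sigma> n *\<^sub>R a + \<tau> n *\<^sub>R b)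
        = (s n)\<^sup>2 * differential f [a, b] (x + \<sigma>' n *\<^sub>R b + \<tau>' n *\<^sub>R a)"
      using 1[of n] 2[of n] by (simp add: algebra_simps)
    then show ?thesis using s[of n] by simp
  qed
  have lims: "\<sigma> \<longlonglongrightarrow> 0" "\<tau> \<longlonglongrightarrow> 0" "\<sigma>' \<longlonglongrightarrow> 0" "\<tau>' \<longlonglongrightarrow> 0"
    using 1 2 by (auto intro!: tendsto_sandwich[OF _ _ tendsto_const s0] always_eventually less_imp_le)
  have c: "isCont (differential f as) x" for as
    using smooth_continuous[OF smooth_differential[OF assms], of UNIV as]
    by (simp add: continuous_on_eq_continuous_at)
  have "(\<lambda>n. x + \<sigma> n *\<^sub>R a + \<tau> n *\<^sub>R b) \<longlonglongrightarrow> x + 0 *\<^sub>R a + 0 *\<^sub>R b"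
    by (intro tendsto_intros lims)
  then have l1: "(\<lambda>n. differential f [b, a] (x + \<sigma> n *\<^sub>R a + \<tau> n *\<^sub>R b)) \<longlonglongrightarrow> differential f [b, a] x"
    using isCont_tendsto_compose[OF c] by fastforce
  have "(\<lambda>n. x + \<sigma>' n *\<^sub>R b + \<tau>' n *\<^sub>R a) \<longlonglongrightarrow> x + 0 *\<^sub>R b + 0 *\<^sub>R a"
    by (intro tendsto_intros lims)
  then have l2: "(\<lambda>n. differential f [a, b] (x + \<sigma>' n *\<^sub>R b + \<tau>' n *\<^sub>R a)) \<longlonglongrightarrow> differential f [a, b] x"
    using isCont_tendsto_compose[OF c] by fastforce
  show ?thesis using l1 l2 unfolding eq by (rule LIMSEQ_unique)
qed

lemma differential_move_front:
  assumes "smooth f"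
  shows "differential f (as @ a # bs) = differential f (a # as @ bs)"
proof (induction as)
  case (Cons b as)
  define g where "g = differential f (as @ bs)"
  have g: "smooth g" unfolding g_def by (rule smooth_differential[OF assms])
  have "differential f ((b # as) @ a # bs) = differential g [b, a]"
    using Cons by (simp add: g_def)
  also have "\<dots> = differential g [a, b]" using differential_swap[OF g] by blast
  finally show ?case by (simp add: g_def)
qed simp

lemma differential_perm:
  assumes "smooth f" "mset as = mset bs"
  shows "differential f as = differential f bs"
  using assms(2)
proof (induction as arbitrary: bs)
  case (Cons a as)
  then obtain xs ys where bs: "bs = xs @ a # ys"
    by (metis list.set_intros(1) set_mset_mset split_list)
  with Cons.prems have "mset as = mset (xs @ ys)" by simp
  then have "differential f as = differential f (xs @ ys)" by (rule Cons.IH)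
  then show ?case using differential_move_front[OF assms(1), of xs a ys] bs by simp
qed auto

lemma differential_linear:
  assumes "smooth f"
  shows "linear (\<lambda>a. differential f (a # as) x)"
  using has_derivative_linear[OF smooth_has_derivative[OF smooth_differential[OF assms]]]
  by simp

lemma differential_sum:
  assumes "finite I" "\<And>i. i \<in> I \<Longrightarrow> smooth (f i)"
  shows "differential (\<lambda>x. \<Sum>i\<in>I. f i x) as = (\<lambda>x. \<Sum>i\<in>I. differential (f i) as x)"
proof (induction as)
  case (Cons a as)
  have "frechet_derivative (\<lambda>x. \<Sum>i\<in>I. differential (f i) as x) (at x) =
     (\<lambda>h. \<Sum>i\<in>I. frechet_derivative (differential (f i) as) (at x) h)" for x
    by (intro frechet_derivative_eqI has_derivative_sum smooth_has_derivative smooth_differential assms)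
  then show ?case using Cons by simp
qed simp

lemma differential_local:
  assumes "open U" "\<And>x. x \<in> U \<Longrightarrow> f x = g x" "smooth f" "x \<in> U"
  shows "differential f as x = differential g as x"
  using assms(4)
proof (induction as arbitrary: x)
  case (Cons a as)
  have "(differential f as has_derivative frechet_derivative (differential f as) (at x)) (at x)"
    by (intro smooth_has_derivative smooth_differential assms)
  then have "(differential g as has_derivative frechet_derivative (differential f as) (at x)) (at x)"
    using Cons assms(1) has_derivative_transform_within_open by blast
  then show ?case using frechet_derivative_eqI by (metis differential.simps(2))
qed (use assms in auto)

text \<open>
  Used to show that a function cut off by a partition of unity has vanishing derivatives also on
  the boundary of the region off which it vanishes.
\<close>

lemma differential_zero_on_closure:
  assumes "open U" "\<And>x. x \<in> U \<Longrightarrow> f x = 0" "smooth f" "x \<in> closure U"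
  shows "differential f as x = 0"
proof -
  have z: "differential (\<lambda>_::'a. 0::real) as = (\<lambda>_. 0)"
    by (induction as) (auto simp: frechet_derivative_const)
  have "differential f as y = 0" if "y \<in> U" for y
    using differential_local[OF assms(1,2,3) that, of as] z by simp
  then show ?thesis
    using continuous_constant_on_closure[of U "differential f as" 0 x] assms(4)
      smooth_continuous[OF smooth_differential[OF assms(3)]] by blast
qed

section \<open>The Euler--Maclaurin formula in one variable\<close>

text \<open>
  Division of formal power series is exact here since \<open>1 - e\<^sup>-\<^sup>X\<close> has order one.
\<close>

lemma fps_todd_times: "(fps_X / (1 - fps_exp (- 1))) * (1 - fps_exp (- 1)) = (fps_X :: real fps)"
proof -
  let ?d = "1 - fps_exp (- 1) :: real fps"
  have "subdegree ?d = 1"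
    by (rule subdegreeI) auto
  then have "?d dvd fps_X"
    by (subst fps_dvd_iff) auto
  then show ?thesis by (rule dvd_div_mult_self)
qed

lemma bern_convolution:
  "(\<Sum>q\<le>s. bern q / fact q * fps_nth (1 - fps_exp (- 1)) (s - q)) = (if s = 1 then 1 else 0)"
proof -
  have "(\<Sum>q\<le>s. bern q / fact q * fps_nth (1 - fps_exp (- 1)) (s - q))
      = fps_nth ((fps_X / (1 - fps_exp (- 1))) * (1 - fps_exp (- 1))) s"
    by (simp add: fps_mult_nth bern_def atLeast0AtMost)
  then show ?thesis by (simp add: fps_todd_times)
qed

lemma bern_0: "bern 0 = 1"
  using bern_convolution[of 1] by simp

text \<open>
  The factor in the error bound: the sum of the Taylor remainders of the terms of the
  Euler--Maclaurin sum, each with its coefficient.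
\<close>

definition em_const :: "nat \<Rightarrow> real" where
  "em_const Q = (\<Sum>q\<le>Q. \<bar>bern q / fact q\<bar> / fact (Q + 2 - q))"

text \<open>
  Let \<open>g\<^sub>1\<close> be the function to be summed, \<open>g\<^sub>0\<close> an antiderivative and \<open>g\<^sub>2, g\<^sub>3, \<dots>\<close> its derivatives.
  Formally \<open>E = D / (1 - e\<^sup>-\<^sup>D)\<close> applied to \<open>g\<^sub>0\<close>, with \<open>D\<close> standing for \<open>\<epsilon>\<close> times the derivative,
  while a backward step of length \<open>\<epsilon>\<close> is \<open>e\<^sup>-\<^sup>D\<close>. Hence \<open>E x - E (x - \<epsilon>)\<close> is \<open>D g\<^sub>0 = \<epsilon> g\<^sub>1\<close>.
  Taylor's formula makes this rigorous up to the stated remainder, and the identity between the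
  coefficients is \<open>bern_convolution\<close>.
\<close>

lemma Euler_Maclaurin_step:
  fixes g :: "nat \<Rightarrow> real \<Rightarrow> real" and x \<epsilon> B :: real
  assumes d: "\<And>q t. x - \<epsilon> \<le> t \<Longrightarrow> (g q has_real_derivative g (Suc q) t) (at t)"
    and B: "\<And>t. \<bar>g (Q + 2) t\<bar> \<le> B" and e: "\<epsilon> > 0"
  defines "E \<equiv> \<lambda>x. \<Sum>q\<le>Q. bern q / fact q * \<epsilon> ^ q * g q x"
  shows "\<bar>E x - E (x - \<epsilon>) - \<epsilon> * g 1 x\<bar> \<le> em_const Q * B * \<epsilon> ^ (Q + 2)"
proof -
  define \<beta> where "\<beta> q = bern q / fact q" for q
  define \<gamma> where "\<gamma> m = fps_nth (1 - fps_exp (- 1 :: real)) m" for m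
  have \<gamma>: "\<gamma> m = - ((- 1) ^ m / fact m)" if "m > 0" for m
    using that by (simp add: \<gamma>_def)
  have \<gamma>0: "\<gamma> 0 = 0" by (simp add: \<gamma>_def)
  have tay: "\<exists>t. g q (x - \<epsilon>) = (\<Sum>m<Q + 2 - q. g (q + m) x / fact m * (- \<epsilon>) ^ m)
      + g (Q + 2) t / fact (Q + 2 - q) * (- \<epsilon>) ^ (Q + 2 - q)" if q: "q \<le> Q" for q
  proof -
    have eq: "q + (Q + 2 - q) = Q + 2" "(x - \<epsilon>) - x = - \<epsilon>" using q by auto
    have ex: "\<exists>t. (if x - \<epsilon> < x then x - \<epsilon> < t \<and> t < x else x < t \<and> t < x - \<epsilon>) \<and>
        g q (x - \<epsilon>) = (\<Sum>m<Q + 2 - q. g (q + m) x / fact m * ((x - \<epsilon>) - x) ^ m)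
          + g (q + (Q + 2 - q)) t / fact (Q + 2 - q) * ((x - \<epsilon>) - x) ^ (Q + 2 - q)"
    proof (rule Taylor[of _ "\<lambda>m. g (q + m)" _ "x - \<epsilon>" x])
      show "\<forall>m t. m < Q + 2 - q \<and> x - \<epsilon> \<le> t \<and> t \<le> x \<longrightarrow> DERIV (g (q + m)) t :> g (q + Suc m) t"
        using d by (simp only: add_Suc_right) blast
    qed (use q e in auto)
    show ?thesis using ex[unfolded eq] by blast
  qed
  have "\<forall>q\<in>{..Q}. \<exists>t. g q (x - \<epsilon>) = (\<Sum>m<Q + 2 - q. g (q + m) x / fact m * (- \<epsilon>) ^ m)
      + g (Q + 2) t / fact (Q + 2 - q) * (- \<epsilon>) ^ (Q + 2 - q)"
    using tay by simp
  from bchoice[OF this] obtain T where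
    "\<forall>q\<in>{..Q}. g q (x - \<epsilon>) = (\<Sum>m<Q + 2 - q. g (q + m) x / fact m * (- \<epsilon>) ^ m)
      + g (Q + 2) (T q) / fact (Q + 2 - q) * (- \<epsilon>) ^ (Q + 2 - q)" ..
  then have T: "\<And>q. q \<le> Q \<Longrightarrow> g q (x - \<epsilon>) = (\<Sum>m<Q + 2 - q. g (q + m) x / fact m * (- \<epsilon>) ^ m)
      + g (Q + 2) (T q) / fact (Q + 2 - q) * (- \<epsilon>) ^ (Q + 2 - q)"
    by blast
  define r where "r q = g (Q + 2) (T q) / fact (Q + 2 - q) * (- \<epsilon>) ^ (Q + 2 - q)" for q
  have diff: "g q x - g q (x - \<epsilon>) = (\<Sum>m\<le>Q + 1 - q. \<gamma> m * \<epsilon> ^ m * g (q + m) x) - r q" if q: "q \<le> Q" for q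
  proof -
    have s: "{..<Q + 2 - q} = {..Q + 1 - q}" using q by auto
    have "g q x - (\<Sum>m\<le>Q + 1 - q. g (q + m) x / fact m * (- \<epsilon>) ^ m)
        = (\<Sum>m\<le>Q + 1 - q. (if m = 0 then g q x else 0) - g (q + m) x / fact m * (- \<epsilon>) ^ m)"
      by (simp add: sum_subtractf)
    also have "\<dots> = (\<Sum>m\<le>Q + 1 - q. \<gamma> m * \<epsilon> ^ m * g (q + m) x)"
    proof (rule sum.cong[OF refl])
      fix m
      have "(- \<epsilon>) ^ m = (- 1) ^ m * \<epsilon> ^ m" by (metis mult_minus1 power_mult_distrib)
      then show "(if m = 0 then g q x else 0) - g (q + m) x / fact m * (- \<epsilon>) ^ m
          = \<gamma> m * \<epsilon> ^ m * g (q + m) x"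
        by (cases "m = 0") (simp_all add: \<gamma>0 \<gamma>)
    qed
    finally show ?thesis using T[OF q] unfolding s r_def by simp
  qed
  have "E x - E (x - \<epsilon>) = (\<Sum>q\<le>Q. \<beta> q * \<epsilon> ^ q * (g q x - g q (x - \<epsilon>)))"
    by (simp add: E_def \<beta>_def sum_subtractf right_diff_distrib)
  also have "\<dots> = (\<Sum>q\<le>Q. \<beta> q * \<epsilon> ^ q * (\<Sum>m\<le>Q + 1 - q. \<gamma> m * \<epsilon> ^ m * g (q + m) x))
      - (\<Sum>q\<le>Q. \<beta> q * \<epsilon> ^ q * r q)"
    by (simp add: diff sum_subtractf algebra_simps)
  also have "(\<Sum>q\<le>Q. \<beta> q * \<epsilon> ^ q * (\<Sum>m\<le>Q + 1 - q. \<gamma> m * \<epsilon> ^ m * g (q + m) x))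
      = (\<Sum>q\<le>Q + 1. \<beta> q * \<epsilon> ^ q * (\<Sum>m\<le>Q + 1 - q. \<gamma> m * \<epsilon> ^ m * g (q + m) x))"
    by (simp add: \<gamma>0)
  also have "\<dots> = (\<Sum>q\<le>Q + 1. \<Sum>m\<le>Q + 1 - q. \<beta> q * \<gamma> m * \<epsilon> ^ (q + m) * g (q + m) x)"
    by (simp add: sum_distrib_left power_add mult_ac)
  also have "\<dots> = (\<Sum>(q, m)\<in>{(q, m). q + m \<le> Q + 1}. \<beta> q * \<gamma> m * \<epsilon> ^ (q + m) * g (q + m) x)"
    by (subst sum.Sigma) (auto intro!: sum.cong)
  also have "\<dots> = (\<Sum>s\<le>Q + 1. \<Sum>q\<le>s. \<beta> q * \<gamma> (s - q) * \<epsilon> ^ (q + (s - q)) * g (q + (s - q)) x)"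
    by (rule sum.triangle_reindex_eq)
  also have "\<dots> = (\<Sum>s\<le>Q + 1. (\<Sum>q\<le>s. \<beta> q * \<gamma> (s - q)) * (\<epsilon> ^ s * g s x))"
    unfolding sum_distrib_right by (intro sum.cong refl) simp
  also have "\<dots> = (\<Sum>s\<le>Q + 1. if s = 1 then \<epsilon> * g 1 x else 0)"
    using bern_convolution by (intro sum.cong) (auto simp: \<beta>_def \<gamma>_def)
  also have "\<dots> = \<epsilon> * g 1 x" by simp
  finally have "E x - E (x - \<epsilon>) - \<epsilon> * g 1 x = - (\<Sum>q\<le>Q. \<beta> q * \<epsilon> ^ q * r q)" by simp
  then have "\<bar>E x - E (x - \<epsilon>) - \<epsilon> * g 1 x\<bar> \<le> (\<Sum>q\<le>Q. \<bar>\<beta> q * \<epsilon> ^ q * r q\<bar>)"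
    by simp
  also have "\<dots> \<le> (\<Sum>q\<le>Q. \<bar>\<beta> q\<bar> / fact (Q + 2 - q) * (B * \<epsilon> ^ (Q + 2)))"
  proof (rule sum_mono)
    fix q assume "q \<in> {..Q}"
    then have p: "\<epsilon> ^ (Q + 2) = \<epsilon> ^ q * \<epsilon> ^ (Q + 2 - q)" by (simp flip: power_add)
    have "\<bar>\<beta> q * \<epsilon> ^ q * r q\<bar> = \<bar>\<beta> q\<bar> / fact (Q + 2 - q) * (\<bar>g (Q + 2) (T q)\<bar> * \<epsilon> ^ (Q + 2))"
      using e unfolding p by (simp add: r_def abs_mult power_abs)
    also have "\<dots> \<le> \<bar>\<beta> q\<bar> / fact (Q + 2 - q) * (B * \<epsilon> ^ (Q + 2))"
      using e by (intro mult_left_mono mult_right_mono B) auto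
    finally show "\<bar>\<beta> q * \<epsilon> ^ q * r q\<bar> \<le> \<bar>\<beta> q\<bar> / fact (Q + 2 - q) * (B * \<epsilon> ^ (Q + 2))" .
  qed
  also have "\<dots> = em_const Q * B * \<epsilon> ^ (Q + 2)"
    by (simp add: em_const_def \<beta>_def sum_distrib_right mult.assoc)
  finally show ?thesis .
qed

text \<open>
  The single steps telescope. There are \<open>L N\<close> of them, which costs one power of \<open>1 / N\<close> in the
  error. As all \<open>g q\<close> vanish at the left end point, that end contributes nothing.
\<close>

lemma Euler_Maclaurin_integer_interval:
  fixes g :: "nat \<Rightarrow> real \<Rightarrow> real" and a B :: real
  assumes d: "\<And>q t. a \<le> t \<Longrightarrow> (g q has_real_derivative g (Suc q) t) (at t)"
    and B: "\<And>t. \<bar>g (Q + 2) t\<bar> \<le> B" and N: "N > 0"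
    and a: "\<And>q. g q a = 0"
  shows "\<bar>(\<Sum>j\<le>L * N. g 1 (a + real j / real N)) / real N
      - (\<Sum>q\<le>Q. bern q / fact q * g q (a + real L) / real N ^ q)\<bar>
      \<le> em_const Q * B * real L / real N ^ (Q + 1)"
proof -
  define \<epsilon> where "\<epsilon> = 1 / real N"
  have e: "\<epsilon> > 0" using N by (simp add: \<epsilon>_def)
  define E where "E x = (\<Sum>q\<le>Q. bern q / fact q * \<epsilon> ^ q * g q x)" for x
  define X where "X j = a + real j * \<epsilon>" for j
  have step: "\<bar>E (X (Suc j)) - E (X j) - \<epsilon> * g 1 (X (Suc j))\<bar> \<le> em_const Q * B * \<epsilon> ^ (Q + 2)" for j
  proof -
    have X: "X (Suc j) - \<epsilon> = X j" by (simp add: X_def algebra_simps)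
    moreover have "a \<le> X j" using e by (simp add: X_def)
    ultimately have dX: "(g q has_real_derivative g (Suc q) t) (at t)" if "X (Suc j) - \<epsilon> \<le> t" for q t
      using d[of t q] that by simp
    show ?thesis
      using Euler_Maclaurin_step[of "X (Suc j)" \<epsilon> g, OF dX B e] unfolding E_def X by simp
  qed
  have E0: "E (X 0) = 0" by (simp add: E_def X_def a)
  have sum0: "(\<Sum>j\<le>M. g 1 (X j)) = (\<Sum>j<M. g 1 (X (Suc j)))" for M
    by (subst sum.atMost_shift) (simp add: X_def a lessThan_Suc_atMost)
  have tel: "E (X (L * N)) = (\<Sum>j<L * N. E (X (Suc j)) - E (X j))"
    using sum_lessThan_telescope[of "\<lambda>j. E (X j)" "L * N"] E0 by simp
  have "\<bar>E (X (L * N)) - \<epsilon> * (\<Sum>j\<le>L * N. g 1 (X j))\<bar>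
      = \<bar>\<Sum>j<L * N. E (X (Suc j)) - E (X j) - \<epsilon> * g 1 (X (Suc j))\<bar>"
    unfolding tel sum0 by (simp add: sum_subtractf sum_distrib_left)
  also have "\<dots> \<le> (\<Sum>j<L * N. em_const Q * B * \<epsilon> ^ (Q + 2))"
    by (rule order_trans[OF sum_abs sum_mono[OF step]])
  also have "\<dots> = em_const Q * B * real L * \<epsilon> ^ (Q + 1)"
    using N by (simp add: \<epsilon>_def)
  finally have main: "\<bar>E (X (L * N)) - \<epsilon> * (\<Sum>j\<le>L * N. g 1 (X j))\<bar> \<le> em_const Q * B * real L * \<epsilon> ^ (Q + 1)" .
  have XL: "X (L * N) = a + real L" using N by (simp add: X_def \<epsilon>_def)
  have "E (X (L * N)) = (\<Sum>q\<le>Q. bern q / fact q * g q (a + real L) / real N ^ q)"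
    unfolding XL E_def by (intro sum.cong) (auto simp: \<epsilon>_def power_divide)
  moreover have "\<epsilon> * (\<Sum>j\<le>L * N. g 1 (X j)) = (\<Sum>j\<le>L * N. g 1 (a + real j / real N)) / real N"
    by (simp add: X_def \<epsilon>_def)
  ultimately show ?thesis
    using main N by (simp add: \<epsilon>_def power_divide abs_minus_commute)
qed

section \<open>Wedge coordinates and measures on one coordinate\<close>

text \<open>
  The matrices with rows \<open>u\<^sub>i\<close> and with columns \<open>v\<^sub>i\<close> are inverse to each other on one side, hence
  on both.
\<close>

lemma dual_basis_expand:
  fixes u v :: "'n::finite \<Rightarrow> real ^ 'n"
  assumes "dual_basis u v"
  shows "(\<Sum>i\<in>UNIV. (u i \<bullet> x) *\<^sub>R v i) = x"
proof -
  define A :: "real ^ 'n ^ 'n" where "A = (\<chi> i. u i)"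
  define B :: "real ^ 'n ^ 'n" where "B = (\<chi> k i. v i $ k)"
  have "A ** B = mat 1"
  proof -
    have "(A ** B) $ i $ j = (mat 1 :: real ^ 'n ^ 'n) $ i $ j" for i j
      using assms by (simp add: A_def B_def matrix_matrix_mult_def mat_def dual_basis_def inner_vec_def)
    then show ?thesis by (simp add: vec_eq_iff)
  qed
  then have "B ** A = mat 1" by (simp add: matrix_left_right_inverse)
  then have "B *v (A *v x) = x" by (simp add: matrix_vector_mul_assoc)
  moreover have "(B *v (A *v x)) = (\<Sum>i\<in>UNIV. (u i \<bullet> x) *\<^sub>R v i)"
    by (simp add: vec_eq_iff A_def B_def matrix_vector_mult_def inner_vec_def mult.commute)
  ultimately show ?thesis by simp
qed

locale wedge_coordinates =
  fixes u v :: "'n::finite \<Rightarrow> real ^ 'n" and c :: "'n \<Rightarrow> int" and \<rho> :: nat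
  assumes dual: "dual_basis u v"
    and c_bound: "\<And>i. \<bar>c i\<bar> \<le> int \<rho>"
begin

definition point :: "('n \<Rightarrow> real) \<Rightarrow> real ^ 'n" where
  "point y = (\<Sum>i\<in>UNIV. y i *\<^sub>R v i)"

lemma u_v: "u i \<bullet> v j = (if i = j then 1 else 0)"
  using dual by (simp add: dual_basis_def)

lemma u_point [simp]: "u i \<bullet> point y = y i"
  by (simp add: point_def inner_sum_right u_v if_distrib cong: if_cong)

lemma point_u [simp]: "point (\<lambda>i. u i \<bullet> x) = x"
  using dual_basis_expand[OF dual] by (simp add: point_def)

lemma point_upd: "point (x(i := t)) = point (x(i := 0)) + t *\<^sub>R v i"
proof -
  have "point (x(i := t)) = (\<Sum>j\<in>UNIV. (x(i := 0)) j *\<^sub>R v j + (if j = i then t *\<^sub>R v i else 0))"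
    unfolding point_def by (intro sum.cong) auto
  then show ?thesis by (simp add: point_def sum.distrib)
qed

text \<open>
  The number \<open>\<rho>\<close> is chosen so large that the function and the end points \<open>c\<^sub>i\<close> live in the box\n  \<open>\<bar>y\<^sub>i\<bar> \<le> \<rho>\<close> of wedge coordinates.
\<close>

definition supported :: "(real ^ 'n \<Rightarrow> real) \<Rightarrow> bool" where
  "supported f \<longleftrightarrow> continuous_on UNIV f \<and> (\<forall>x i. \<bar>u i \<bullet> x\<bar> \<ge> real \<rho> \<longrightarrow> f x = 0)"

lemma supported_bounded:
  assumes "supported f"
  obtains B where "B \<ge> 0" "\<And>x. \<bar>f x\<bar> \<le> B"
proof -
  define S where "S = {x. \<forall>i. \<bar>u i \<bullet> x\<bar> \<le> real \<rho>}"
  have "S \<subseteq> cball 0 (\<Sum>i\<in>UNIV. real \<rho> * norm (v i))"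
  proof
    fix x assume x: "x \<in> S"
    have "norm x = norm (\<Sum>i\<in>UNIV. (u i \<bullet> x) *\<^sub>R v i)" using dual_basis_expand[OF dual] by metis
    also have "\<dots> \<le> (\<Sum>i\<in>UNIV. real \<rho> * norm (v i))"
      using x by (intro sum_norm_le) (auto simp: S_def intro!: mult_right_mono)
    finally show "x \<in> cball 0 (\<Sum>i\<in>UNIV. real \<rho> * norm (v i))" by simp
  qed
  then have "bounded S" using bounded_cball bounded_subset by blast
  moreover have "closed S"
  proof -
    have "S = (\<Inter>i. {x. \<bar>u i \<bullet> x\<bar> \<le> real \<rho>})" by (auto simp: S_def)
    then show ?thesis by (auto intro!: closed_INT closed_Collect_le continuous_intros)
  qed
  ultimately have "compact (f ` S)"
    using assms by (intro compact_continuous_image)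
      (auto simp: supported_def compact_eq_bounded_closed intro: continuous_on_subset)
  then obtain B where B: "\<And>x. x \<in> S \<Longrightarrow> \<bar>f x\<bar> \<le> B"
    using compact_imp_bounded bounded_real by (metis imageI)
  have "\<bar>f x\<bar> \<le> max B 0" for x
  proof (cases "x \<in> S")
    case False
    then obtain i where "\<bar>u i \<bullet> x\<bar> \<ge> real \<rho>" by (auto simp: S_def not_le intro: less_imp_le)
    then show ?thesis using assms by (auto simp: supported_def)
  qed (use B in fastforce)
  then show ?thesis by (intro that[of "max B 0"]) auto
qed

lemma supported_differential:
  assumes "smooth f" "supported f"
  shows "supported (differential f as)"
proof -
  have "differential f as x = 0" if x: "\<bar>u i \<bullet> x\<bar> \<ge> real \<rho>" for x i
  proof (rule differential_zero_on_closure[OF _ _ assms(1)])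
    show "open {x. \<bar>u i \<bullet> x\<bar> > real \<rho>}"
      by (intro open_Collect_less continuous_intros)
    show "f y = 0" if "y \<in> {x. \<bar>u i \<bullet> x\<bar> > real \<rho>}" for y
      using that assms(2) unfolding supported_def by (metis less_imp_le mem_Collect_eq)
    show "x \<in> closure {x. \<bar>u i \<bullet> x\<bar> > real \<rho>}"
    proof -
      define w where "w = (if u i \<bullet> x < 0 then - v i else v i)"
      have w: "\<bar>u i \<bullet> (x + r *\<^sub>R w)\<bar> > real \<rho>" if "r > 0" for r
        using that x by (cases "u i \<bullet> x < 0") (simp_all add: inner_right_distrib inner_diff_right u_v w_def)
      have "(\<lambda>n. x + inverse (real (Suc n)) *\<^sub>R w) \<longlonglongrightarrow> x + 0 *\<^sub>R w"
        by (intro tendsto_intros LIMSEQ_inverse_real_of_nat)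
      then show ?thesis unfolding closure_sequential using w
        by (intro exI conjI) (auto simp del: of_nat_Suc)
    qed
  qed
  then show ?thesis
    using smooth_continuous[OF smooth_differential[OF assms(1)]] by (auto simp: supported_def)
qed

text \<open>
  The points \<open>k / N\<close> with \<open>k \<in> \<int>\<close> and \<open>-\<rho> \<le> k / N \<le> c\<^sub>i\<close>, each with mass \<open>1 / N\<close>. Cutting off at
  \<open>-\<rho>\<close>, where the functions to be integrated vanish, makes this and the next measure finite, with
  a bound that does not involve \<open>N\<close>.
\<close>

definition count_coord :: "nat \<Rightarrow> 'n \<Rightarrow> real measure" where
  "count_coord N i = distr (point_measure {..nat (c i + int \<rho>) * N} (\<lambda>_. ennreal (1 / real N))) borel
     (\<lambda>j. - real \<rho> + real j / real N)"

definition ray_coord :: "'n \<Rightarrow> real measure" where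
  "ray_coord i = density lborel (\<lambda>t. indicator {- real \<rho>..of_int (c i)} t)"

definition end_coord :: "'n \<Rightarrow> real measure" where
  "end_coord i = distr (count_space {()}) borel (\<lambda>_. of_int (c i))"

text \<open>
  A bound for the mass that covers all three kinds of measures on one coordinate.
\<close>

definition bounded_coord :: "real measure \<Rightarrow> bool" where
  "bounded_coord M \<longleftrightarrow> sets M = sets borel \<and> finite_measure M \<and> measure M UNIV \<le> 2 * real \<rho> + 1"

lemma c_nat: "real (nat (c i + int \<rho>)) = of_int (c i) + real \<rho>"
  using c_bound[of i] by simp

lemma c_le: "of_int (c i) \<le> real \<rho>" "- real \<rho> \<le> of_int (c i)"
  using c_bound[of i] by (auto simp: abs_le_iff)

lemma point_measure_finite: "finite A \<Longrightarrow> finite_measure (point_measure A (\<lambda>_. ennreal r))"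
  by (intro finite_measureI) (simp add: emeasure_point_measure_finite space_point_measure ennreal_mult_eq_top_iff)

lemma measure_space_eq_1: "measure M (space M) = (\<integral>t. 1 \<partial>M)"
  by simp

lemma integral_count_coord:
  fixes h :: "real \<Rightarrow> real"
  assumes "h \<in> borel_measurable borel"
  shows "integral\<^sup>L (count_coord N i) h
    = (\<Sum>j\<le>nat (c i + int \<rho>) * N. h (- real \<rho> + real j / real N)) / real N"
proof -
  have "integral\<^sup>L (count_coord N i) h = integral\<^sup>L (point_measure {..nat (c i + int \<rho>) * N} (\<lambda>_. ennreal (1 / real N)))
      (\<lambda>j. h (- real \<rho> + real j / real N))"
    unfolding count_coord_def using assms by (intro integral_distr) (auto simp: measurable_def space_point_measure)
  also have "\<dots> = (\<Sum>j\<le>nat (c i + int \<rho>) * N. 1 / real N * h (- real \<rho> + real j / real N))"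
    by (subst lebesgue_integral_point_measure_finite) auto
  finally show ?thesis by (simp add: sum_divide_distrib)
qed

lemma bounded_count_coord: "N > 0 \<Longrightarrow> bounded_coord (count_coord N i)"
proof -
  assume N: "N > 0"
  have s: "sets (count_coord N i) = sets borel" "space (count_coord N i) = UNIV"
    by (simp_all add: count_coord_def)
  have f: "finite_measure (count_coord N i)"
    unfolding count_coord_def
    by (intro finite_measure.finite_measure_distr point_measure_finite)
      (auto simp: measurable_def space_point_measure)
  have "measure (count_coord N i) UNIV = (\<integral>t. 1 \<partial>count_coord N i)"
    using measure_space_eq_1[of "count_coord N i"] s by simp
  also have "\<dots> = (real (nat (c i + int \<rho>)) * real N + 1) / real N"
    by (subst integral_count_coord) auto
  also have "\<dots> = of_int (c i) + real \<rho> + 1 / real N" using N c_nat[of i] by (simp add: field_simps)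
  also have "\<dots> \<le> 2 * real \<rho> + 1"
  proof -
    have "1 / real N \<le> 1" using N by (simp add: field_simps)
    then show ?thesis using c_le[of i] by linarith
  qed
  finally show ?thesis using s f by (simp add: bounded_coord_def)
qed

lemma integral_end_coord:
  "(h :: real \<Rightarrow> real) \<in> borel_measurable borel \<Longrightarrow> integral\<^sup>L (end_coord i) h = h (of_int (c i))"
  by (simp add: end_coord_def integral_distr lebesgue_integral_count_space_finite)

lemma bounded_end_coord: "bounded_coord (end_coord i)"
proof -
  have "emeasure (end_coord i) UNIV = 1"
    by (simp add: end_coord_def emeasure_distr)
  then show ?thesis unfolding bounded_coord_def
    by (auto intro!: finite_measureI simp: end_coord_def measure_def)
qed

lemma integral_ray_coord:
  "(h :: real \<Rightarrow> real) \<in> borel_measurable borel \<Longrightarrow>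
    integral\<^sup>L (ray_coord i) h = (LINT t:{- real \<rho>..of_int (c i)}|lborel. h t)"
  unfolding ray_coord_def set_lebesgue_integral_def
  by (subst integral_density[symmetric]) (auto simp: ennreal_indicator)

lemma bounded_ray_coord: "bounded_coord (ray_coord i)"
proof -
  have "emeasure (ray_coord i) UNIV = ennreal (of_int (c i) + real \<rho>)"
    unfolding ray_coord_def using c_le[of i] by (subst emeasure_density) (auto simp: nn_integral_indicator)
  then show ?thesis
    using c_le[of i] unfolding bounded_coord_def
    by (auto intro!: finite_measureI simp: ray_coord_def measure_def)
qed

end

section \<open>Replacing one coordinate measure\<close>

context wedge_coordinates begin

lemma bounded_coord_sets: "bounded_coord M \<Longrightarrow> sets M = sets borel"
  and bounded_coord_space: "bounded_coord M \<Longrightarrow> space M = UNIV"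
  and bounded_coord_finite: "bounded_coord M \<Longrightarrow> finite_measure M"
  unfolding bounded_coord_def using sets_eq_imp_space_eq[of M borel] by auto

definition bounded_measurable :: "('n \<Rightarrow> real) measure \<Rightarrow> (('n \<Rightarrow> real) \<Rightarrow> real) \<Rightarrow> bool" where
  "bounded_measurable M h \<longleftrightarrow> h \<in> borel_measurable M \<and> (\<exists>C. \<forall>y. \<bar>h y\<bar> \<le> C)"

abbreviation coord_space :: "('n \<Rightarrow> real) measure" where
  "coord_space \<equiv> PiM UNIV (\<lambda>_. borel)"

lemma sets_PiM_bounded:
  fixes M :: "'n \<Rightarrow> real measure"
  shows "(\<And>i. bounded_coord (M i)) \<Longrightarrow> sets (PiM I M) = sets (PiM I (\<lambda>_. borel))"
  by (intro sets_PiM_cong) (auto simp: bounded_coord_sets)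

lemma product_sigma_finite_bounded:
  fixes M :: "'n \<Rightarrow> real measure"
  shows "(\<And>i. bounded_coord (M i)) \<Longrightarrow> product_sigma_finite M"
  unfolding product_sigma_finite_def
  using bounded_coord_finite finite_measure.axioms(1) by blast

lemma PiM_bounded:
  fixes M :: "'n \<Rightarrow> real measure"
  assumes "\<And>i. bounded_coord (M i)"
  shows "finite_measure (PiM I M)" "measure (PiM I M) (space (PiM I M)) \<le> (2 * real \<rho> + 1) ^ card I"
proof -
  interpret product_sigma_finite M by (rule product_sigma_finite_bounded[OF assms])
  have e: "emeasure (PiM I M) (space (PiM I M)) = (\<Prod>i\<in>I. emeasure (M i) (space (M i)))"
    unfolding space_PiM by (rule emeasure_PiM) auto
  also have "\<dots> = (\<Prod>i\<in>I. ennreal (measure (M i) UNIV))"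
    using assms bounded_coord_space bounded_coord_finite
    by (intro prod.cong) (auto simp: finite_measure.emeasure_eq_measure)
  also have "\<dots> = ennreal (\<Prod>i\<in>I. measure (M i) UNIV)"
    by (simp add: prod_ennreal)
  finally have e: "emeasure (PiM I M) (space (PiM I M)) = ennreal (\<Prod>i\<in>I. measure (M i) UNIV)" .
  then show "finite_measure (PiM I M)" by (intro finite_measureI) simp
  have "measure (PiM I M) (space (PiM I M)) = (\<Prod>i\<in>I. measure (M i) UNIV)"
    using e by (simp add: measure_def prod_nonneg)
  also have "\<dots> \<le> (\<Prod>i\<in>I. 2 * real \<rho> + 1)"
    using assms by (intro prod_mono) (auto simp: bounded_coord_def)
  finally show "measure (PiM I M) (space (PiM I M)) \<le> (2 * real \<rho> + 1) ^ card I" by simp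
qed

lemma bounded_integrable_PiM:
  fixes M :: "'n \<Rightarrow> real measure"
  assumes "\<And>i. bounded_coord (M i)" "h \<in> borel_measurable (PiM I (\<lambda>_. borel))" "\<And>y. \<bar>h y\<bar> \<le> C"
  shows "integrable (PiM I M) (h :: _ \<Rightarrow> real)"
proof -
  have "h \<in> borel_measurable (PiM I M)"
    using assms(2) measurable_cong_sets[OF sets_PiM_bounded[of M I, OF assms(1)] refl, of borel] by auto
  then show ?thesis
    using assms(3) by (intro finite_measure.integrable_const_bound[OF PiM_bounded(1)[OF assms(1)], of _ C]) auto
qed

lemma bounded_measurable_integrable:
  "(\<And>i. bounded_coord (M i)) \<Longrightarrow> bounded_measurable coord_space h \<Longrightarrow> integrable (PiM UNIV M) h"
  unfolding bounded_measurable_def by (auto intro: bounded_integrable_PiM)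

text \<open>
  Fubini's theorem with the coordinate \<open>i\<close> integrated first.
\<close>

lemma integral_PiM_coordinate:
  assumes M: "\<And>i. bounded_coord (M i)" and h: "bounded_measurable coord_space h"
  shows "integral\<^sup>L (PiM UNIV M) h = (\<integral>x. (\<integral>t. h (x(i := t)) \<partial>M i) \<partial>PiM (UNIV - {i}) M)"
    and "integrable (PiM (UNIV - {i}) M) (\<lambda>x. \<integral>t. h (x(i := t)) \<partial>M i)"
proof -
  interpret product_sigma_finite M by (rule product_sigma_finite_bounded[OF M])
  have ins: "insert i (UNIV - {i}) = UNIV" by auto
  show "integral\<^sup>L (PiM UNIV M) h = (\<integral>x. (\<integral>t. h (x(i := t)) \<partial>M i) \<partial>PiM (UNIV - {i}) M)"
    using product_integral_insert[of "UNIV - {i}" i h] bounded_measurable_integrable[OF M h]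
    unfolding ins by simp
  obtain C where C: "\<And>y. \<bar>h y\<bar> \<le> C" using h by (auto simp: bounded_measurable_def)
  have hm: "h \<in> borel_measurable (PiM UNIV M)"
    using bounded_measurable_integrable[OF M h] by auto
  have "(\<lambda>(x, t). x(i := t)) \<in> measurable (PiM (UNIV - {i}) M \<Otimes>\<^sub>M M i) (PiM UNIV M)"
    using measurable_add_dim[of i "UNIV - {i}" M] unfolding ins .
  from measurable_compose[OF this hm]
  have "(\<lambda>(x, t). h (x(i := t))) \<in> borel_measurable (PiM (UNIV - {i}) M \<Otimes>\<^sub>M M i)"
    by (simp add: case_prod_unfold)
  then have m: "(\<lambda>x. \<integral>t. h (x(i := t)) \<partial>M i) \<in> borel_measurable (PiM (UNIV - {i}) M)"
    by (rule M.borel_measurable_lebesgue_integral)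
  have "\<bar>\<integral>t. h (x(i := t)) \<partial>M i\<bar> \<le> C * measure (M i) (space (M i))" for x
  proof -
    have "\<bar>\<integral>t. h (x(i := t)) \<partial>M i\<bar> \<le> (\<integral>t. \<bar>h (x(i := t))\<bar> \<partial>M i)"
      by (rule integral_abs_bound)
    also have "\<dots> \<le> (\<integral>t. C \<partial>M i)"
      by (rule integral_mono')
        (use C order_trans[OF abs_ge_zero C] finite_measure.integrable_const[OF bounded_coord_finite[OF M]] in auto)
    finally show ?thesis by (simp add: mult.commute)
  qed
  then show "integrable (PiM (UNIV - {i}) M) (\<lambda>x. \<integral>t. h (x(i := t)) \<partial>M i)"
    using m by (intro finite_measure.integrable_const_bound[OF PiM_bounded(1)[OF M]]) auto
qed

text \<open>
  An identity between integrals over one coordinate that holds up to \<open>\<epsilon>\<close>, uniformly in the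
  remaining coordinates, integrates to an identity between product integrals. It serves for the
  Euler--Maclaurin formula, where \<open>\<epsilon>\<close> is the error term, and with \<open>\<epsilon> = 0\<close> for integration by
  parts.
\<close>

lemma replace_coordinate:
  assumes M: "\<And>j. bounded_coord (M j)" and A: "bounded_coord A"
    and B: "\<And>q. q \<in> S \<Longrightarrow> bounded_coord (B q)"
    and h: "bounded_measurable coord_space h"
    and g: "\<And>q. q \<in> S \<Longrightarrow> bounded_measurable coord_space (g q)"
    and le: "\<And>x. \<bar>(\<integral>t. h (x(i := t)) \<partial>A) - (\<Sum>q\<in>S. \<kappa> q * (\<integral>t. g q (x(i := t)) \<partial>B q))\<bar> \<le> \<epsilon>"
  shows "\<bar>integral\<^sup>L (PiM UNIV (M(i := A))) h - (\<Sum>q\<in>S. \<kappa> q * integral\<^sup>L (PiM UNIV (M(i := B q))) (g q))\<bar>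
    \<le> \<epsilon> * (2 * real \<rho> + 1) ^ (CARD('n) - 1)"
proof -
  let ?P = "PiM (UNIV - {i}) M"
  have eq: "PiM (UNIV - {i}) (M(i := X)) = ?P" for X by (intro PiM_cong) auto
  have bA: "bounded_coord ((M(i := A)) j)" for j using M A by simp
  have bB: "bounded_coord ((M(i := B q)) j)" if "q \<in> S" for q j using M B that by simp
  have fA: "integral\<^sup>L (PiM UNIV (M(i := A))) h = (\<integral>x. (\<integral>t. h (x(i := t)) \<partial>A) \<partial>?P)"
      "integrable ?P (\<lambda>x. \<integral>t. h (x(i := t)) \<partial>A)"
    using integral_PiM_coordinate[of "M(i := A)" h i, OF bA h] unfolding eq fun_upd_same by auto
  have fB: "integral\<^sup>L (PiM UNIV (M(i := B q))) (g q) = (\<integral>x. (\<integral>t. g q (x(i := t)) \<partial>B q) \<partial>?P)"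
      "integrable ?P (\<lambda>x. \<integral>t. g q (x(i := t)) \<partial>B q)" if "q \<in> S" for q
    using integral_PiM_coordinate[of "M(i := B q)" "g q" i, OF bB[OF that] g[OF that]]
    unfolding eq fun_upd_same by auto
  let ?H = "\<lambda>x. (\<integral>t. h (x(i := t)) \<partial>A) - (\<Sum>q\<in>S. \<kappa> q * (\<integral>t. g q (x(i := t)) \<partial>B q))"
  have "integral\<^sup>L (PiM UNIV (M(i := A))) h - (\<Sum>q\<in>S. \<kappa> q * integral\<^sup>L (PiM UNIV (M(i := B q))) (g q))
      = (\<integral>x. (\<integral>t. h (x(i := t)) \<partial>A) \<partial>?P) - (\<Sum>q\<in>S. \<kappa> q * (\<integral>x. (\<integral>t. g q (x(i := t)) \<partial>B q) \<partial>?P))"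
    using fA(1) fB(1) by simp
  also have "\<dots> = integral\<^sup>L ?P ?H"
    using fA(2) fB(2) by (subst Bochner_Integration.integral_diff) auto
  finally have eq1: "integral\<^sup>L (PiM UNIV (M(i := A))) h
      - (\<Sum>q\<in>S. \<kappa> q * integral\<^sup>L (PiM UNIV (M(i := B q))) (g q)) = integral\<^sup>L ?P ?H" .
  interpret finite_measure ?P by (rule PiM_bounded[OF M])
  have e0: "0 \<le> \<epsilon>" using order_trans[OF abs_ge_zero le] .
  have "\<bar>integral\<^sup>L ?P ?H\<bar> \<le> (\<integral>x. \<bar>?H x\<bar> \<partial>?P)" by (rule integral_abs_bound)
  also have "\<dots> \<le> (\<integral>x. \<epsilon> \<partial>?P)" by (rule integral_mono') (use le e0 in auto)
  also have "\<dots> = \<epsilon> * measure ?P (space ?P)" by simp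
  also have "\<dots> \<le> \<epsilon> * (2 * real \<rho> + 1) ^ card (UNIV - {i})"
    using PiM_bounded(2)[OF M] e0 by (intro mult_left_mono)
  finally show ?thesis unfolding eq1 by simp
qed

lemma point_measurable: "point \<in> borel_measurable coord_space"
  unfolding point_def by measurable

lemma supported_bounded_measurable:
  assumes "supported g"
  shows "bounded_measurable coord_space (\<lambda>y. g (point y))"
proof -
  have "g \<in> borel_measurable borel"
    using assms by (auto simp: supported_def intro: borel_measurable_continuous_onI)
  then show ?thesis
    using measurable_compose[OF point_measurable] supported_bounded[OF assms]
    unfolding bounded_measurable_def by metis
qed

text \<open>
  Along the \<open>i\<close>-th coordinate line through \<open>point x\<close>, the \<open>q\<close>-th derivative of a differential of
  \<open>f\<close> is again a differential of \<open>f\<close>.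
\<close>

definition slice :: "(real ^ 'n \<Rightarrow> real) \<Rightarrow> (real ^ 'n) list \<Rightarrow> 'n \<Rightarrow> ('n \<Rightarrow> real) \<Rightarrow> nat \<Rightarrow> real \<Rightarrow> real" where
  "slice f as i x q t = differential f (replicate q (v i) @ as) (point (x(i := t)))"

lemma slice_derivative:
  assumes "smooth f"
  shows "(slice f as i x q has_real_derivative slice f as i x (Suc q) t) (at t)"
  using smooth_line_derivative[OF smooth_differential[OF assms], of "replicate q (v i) @ as" "point (x(i := 0))" "v i" t]
  unfolding slice_def point_upd[of x i t] by (subst point_upd) simp

lemma slice_continuous: "smooth f \<Longrightarrow> continuous_on S (slice f as i x q)"
  by (meson slice_derivative DERIV_continuous_on has_field_derivative_at_within)

lemma slice_measurable: "smooth f \<Longrightarrow> slice f as i x q \<in> borel_measurable borel"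
  by (intro borel_measurable_continuous_onI slice_continuous)

lemma slice_zero:
  assumes "smooth f" "supported f" "t \<le> - real \<rho>"
  shows "slice f as i x q t = 0"
proof -
  have "\<bar>u i \<bullet> point (x(i := t))\<bar> \<ge> real \<rho>" using assms(3) by simp
  then show ?thesis
    using supported_differential[OF assms(1,2)] unfolding slice_def supported_def by blast
qed

text \<open>
  The constant comes from a bound for a derivative of \<open>f\<close> on the whole space, so it depends neither
  on \<open>N\<close> nor on the line. The exponent \<open>q - 1\<close> is truncated on purpose: for \<open>q = 0\<close> the function itself is
  integrated over the ray.
\<close>

lemma Euler_Maclaurin_coordinate:
  assumes f: "smooth f" "supported f"
  shows "\<exists>C. \<forall>N>0. \<forall>x. \<bar>(\<integral>t. differential f as (point (x(i := t))) \<partial>count_coord N i)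
    - (\<Sum>q\<le>Q. bern q / fact q / real N ^ q *
        (\<integral>t. differential f (replicate (q - 1) (v i) @ as) (point (x(i := t)))
           \<partial>(if q = 0 then ray_coord i else end_coord i)))\<bar>
    \<le> C / real N ^ (Q + 1)"
proof -
  obtain B where B: "\<And>y. \<bar>differential f (replicate (Q + 1) (v i) @ as) y\<bar> \<le> B"
    using supported_bounded[OF supported_differential[OF f]] by blast
  define C where "C = em_const Q * B * real (nat (c i + int \<rho>))"
  have "\<bar>(\<integral>t. differential f as (point (x(i := t))) \<partial>count_coord N i)
    - (\<Sum>q\<le>Q. bern q / fact q / real N ^ q *
        (\<integral>t. differential f (replicate (q - 1) (v i) @ as) (point (x(i := t)))
           \<partial>(if q = 0 then ray_coord i else end_coord i)))\<bar>
    \<le> C / real N ^ (Q + 1)" if N: "N > 0" for N x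
  proof -
    let ?H = "slice f as i x"
    note cH = slice_continuous[OF f(1)] and mH = slice_measurable[OF f(1)]
    \<comment> \<open>Starting the antiderivative one unit below \<open>-\<rho>\<close> makes it two-sided differentiable at \<open>-\<rho>\<close>.\<close>
    define g where "g q t = (case q of 0 \<Rightarrow> integral {- real \<rho> - 1..t} (?H 0) | Suc p \<Rightarrow> ?H p t)" for q t
    have g0: "g 0 = (\<lambda>t. integral {- real \<rho> - 1..t} (?H 0))" and gS: "g (Suc p) = ?H p" for p
      by (auto simp: g_def)
    have dg: "(g q has_real_derivative g (Suc q) t) (at t)" if "- real \<rho> \<le> t" for q t
    proof (cases q)
      case 0
      have "((\<lambda>t. integral {- real \<rho> - 1..t} (?H 0)) has_real_derivative ?H 0 t) (at t within {- real \<rho> - 1..t + 1})"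
        by (rule integral_has_real_derivative[OF cH]) (use that in auto)
      moreover have "at t within {- real \<rho> - 1..t + 1} = at t"
        by (rule at_within_interior) (use that in auto)
      ultimately show ?thesis unfolding 0 g0 gS by simp
    qed (use slice_derivative[OF f(1)] gS in auto)
    have int0: "integral {- real \<rho> - 1..- real \<rho>} (?H 0) = 0"
      by (subst integral_cong[of _ _ "\<lambda>_. 0"]) (auto simp: slice_zero[OF f])
    have ga: "g q (- real \<rho>) = 0" for q
      by (cases q) (auto simp: g0 gS int0 slice_zero[OF f])
    have gB: "\<bar>g (Q + 2) t\<bar> \<le> B" for t
      using B by (simp add: gS slice_def)
    have em: "\<bar>(\<Sum>j\<le>nat (c i + int \<rho>) * N. g 1 (- real \<rho> + real j / real N)) / real N
        - (\<Sum>q\<le>Q. bern q / fact q * g q (- real \<rho> + real (nat (c i + int \<rho>))) / real N ^ q)\<bar>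
        \<le> em_const Q * B * real (nat (c i + int \<rho>)) / real N ^ (Q + 1)"
      by (rule Euler_Maclaurin_integer_interval[OF dg gB N ga])
    have cc: "- real \<rho> + real (nat (c i + int \<rho>)) = of_int (c i)" using c_nat[of i] by simp
    have g1: "g 1 = ?H 0" using gS[of 0] by simp
    have t0: "(\<integral>t. ?H 0 t \<partial>count_coord N i)
        = (\<Sum>j\<le>nat (c i + int \<rho>) * N. g 1 (- real \<rho> + real j / real N)) / real N"
      unfolding g1 by (rule integral_count_coord[OF mH])
    have tq: "(\<integral>t. ?H (q - 1) t \<partial>(if q = 0 then ray_coord i else end_coord i)) = g q (of_int (c i))" for q
    proof (cases q)
      case 0
      have "set_lebesgue_integral lborel {- real \<rho>..of_int (c i)} (?H 0) = integral {- real \<rho>..of_int (c i)} (?H 0)"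
        by (intro set_borel_integral_eq_integral(2) borel_integrable_atLeastAtMost') (rule cH)
      also have "\<dots> = integral {- real \<rho> - 1..of_int (c i)} (?H 0)"
        using Henstock_Kurzweil_Integration.integral_combine[of "- real \<rho> - 1" "- real \<rho>" "of_int (c i)" "?H 0"]
          c_le[of i] int0 integrable_continuous_real[OF cH] by simp
      finally show ?thesis using integral_ray_coord[OF mH] 0 by (simp add: g0)
    next
      case (Suc p)
      then show ?thesis using integral_end_coord[OF mH] by (simp add: gS)
    qed
    have Has: "differential f as (point (x(i := t))) = ?H 0 t" for t by (simp add: slice_def)
    show ?thesis
      unfolding Has slice_def[symmetric] t0 tq using em unfolding cc C_def by simp
  qed
  then show ?thesis by blast
qed

end

section \<open>Expansion in all coordinates\<close>

lemma index_list: "distinct (index_list :: 'n::finite list)" "set (index_list :: 'n list) = UNIV"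
proof -
  obtain xs :: "'n list" where "set xs = UNIV \<and> distinct xs"
    using finite_distinct_list[of "UNIV :: 'n set"] by auto
  then have "\<exists>xs :: 'n list. distinct xs \<and> set xs = UNIV" by blast
  from someI_ex[OF this]
  show "distinct (index_list :: 'n list)" "set (index_list :: 'n list) = UNIV"
    unfolding index_list_def by blast+
qed

lemma int_vecs_inner: "x \<in> int_vecs \<Longrightarrow> y \<in> int_vecs \<Longrightarrow> x \<bullet> y \<in> \<int>"
  unfolding int_vecs_def inner_vec_def by (auto intro!: Ints_sum Ints_mult)

lemma int_vecs_sum: "(\<And>i. i \<in> I \<Longrightarrow> f i \<in> int_vecs) \<Longrightarrow> (\<Sum>i\<in>I. f i) \<in> int_vecs"
  unfolding int_vecs_def by (auto intro!: Ints_sum)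

lemma int_vecs_scale: "x \<in> int_vecs \<Longrightarrow> a \<in> \<int> \<Longrightarrow> a *\<^sub>R x \<in> int_vecs"
  unfolding int_vecs_def by (auto intro!: Ints_mult)

lemma axis_int_vecs: "axis k 1 \<in> int_vecs"
  unfolding int_vecs_def by (simp add: axis_def)

text \<open>
  The \<open>u\<^sub>i\<close> generate \<open>\<int>\<^sup>n\<close>, so every coordinate of \<open>v\<^sub>j\<close> is an integer combination of the numbers
  \<open>\<langle>u\<^sub>i, v\<^sub>j\<rangle> \<in> {0, 1}\<close>.
\<close>

lemma dual_basis_int_vecs:
  assumes "regular_integer_wedge u" "dual_basis u v"
  shows "v j \<in> int_vecs"
proof -
  have "v j \<bullet> axis k 1 \<in> \<int>" for k
  proof -
    have "axis k 1 \<in> range (\<lambda>a :: real ^ 'a \<Rightarrow> int. \<Sum>w\<in>range u. of_int (a w) *\<^sub>R w)"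
      using assms(1) axis_int_vecs[of k] unfolding regular_integer_wedge_def lattice_basis_def by auto
    then obtain a :: "real ^ 'a \<Rightarrow> int" where a: "axis k 1 = (\<Sum>w\<in>range u. of_int (a w) *\<^sub>R w)" by blast
    show ?thesis using assms(2) unfolding a
      by (auto simp: inner_sum_right dual_basis_def inner_commute intro!: Ints_sum Ints_mult)
  qed
  then show ?thesis by (simp add: int_vecs_def inner_axis)
qed

lemma int_vecs_iff_coordinates:
  assumes "regular_integer_wedge u" "dual_basis u v"
  shows "x \<in> int_vecs \<longleftrightarrow> (\<forall>i. u i \<bullet> x \<in> \<int>)"
proof
  show "\<forall>i. u i \<bullet> x \<in> \<int>" if "x \<in> int_vecs"
    using that assms(1) int_vecs_inner unfolding regular_integer_wedge_def primitive_vec_def by blast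
  show "x \<in> int_vecs" if "\<forall>i. u i \<bullet> x \<in> \<int>"
    using that dual_basis_int_vecs[OF assms] dual_basis_expand[OF assms(2), of x]
    by (metis (no_types, lifting) int_vecs_scale int_vecs_sum)
qed

context wedge_coordinates begin

definition face_measure :: "'n set \<Rightarrow> ('n \<Rightarrow> real) measure" where
  "face_measure J = PiM UNIV (\<lambda>i. if i \<in> J then end_coord i else ray_coord i)"

text \<open>
  The integral over the face on which the coordinates in \<open>J\<close> are equal to \<open>c\<close>, with respect to the
  measure in which the lattice of the face has covolume one.
\<close>

definition coord_integral :: "'n set \<Rightarrow> (real ^ 'n \<Rightarrow> real) \<Rightarrow> real" where
  "coord_integral J g = (\<integral>y. g (point y) \<partial>face_measure J)"

text \<open>
  The state of the expansion when the coordinates in the list have been treated: these carry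
  Lebesgue measure or a point mass, the others still carry the counting measure.
\<close>

definition mixed_measure :: "nat \<Rightarrow> 'n list \<Rightarrow> ('n \<Rightarrow> nat) \<Rightarrow> 'n \<Rightarrow> real measure" where
  "mixed_measure N is \<alpha> i =
     (if i \<in> set is then if \<alpha> i = 0 then ray_coord i else end_coord i else count_coord N i)"

definition partial_tuple :: "'n list \<Rightarrow> ('n \<Rightarrow> nat) \<Rightarrow> (real ^ 'n) list" where
  "partial_tuple is \<alpha> = concat (map (\<lambda>i. replicate (\<alpha> i - 1) (v i)) is)"

definition partial_indices :: "nat \<Rightarrow> 'n list \<Rightarrow> ('n \<Rightarrow> nat) set" where
  "partial_indices Q is = PiE UNIV (\<lambda>i. if i \<in> set is then {..Q} else {0})"

text \<open>
  Exponents up to \<open>Q\<close> are kept in every coordinate separately. This includes monomials of total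
  degree above \<open>Q\<close>, which are discarded at the end.
\<close>

definition partial_expansion :: "(real ^ 'n \<Rightarrow> real) \<Rightarrow> nat \<Rightarrow> nat \<Rightarrow> 'n list \<Rightarrow> real" where
  "partial_expansion f N Q is = (\<Sum>\<alpha>\<in>partial_indices Q is.
     (\<Prod>i\<in>set is. bern (\<alpha> i) / fact (\<alpha> i)) / real N ^ (\<Sum>i\<in>UNIV. \<alpha> i) *
     (\<integral>y. differential f (partial_tuple is \<alpha>) (point y) \<partial>PiM UNIV (mixed_measure N is \<alpha>)))"

lemma bounded_mixed: "N > 0 \<Longrightarrow> bounded_coord (mixed_measure N is \<alpha> i)"
  by (simp add: mixed_measure_def bounded_count_coord bounded_end_coord bounded_ray_coord)

lemma finite_partial_indices: "finite (partial_indices Q is)"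
  unfolding partial_indices_def by (intro finite_PiE) auto

lemma sum_partial_indices_Cons:
  assumes i: "i \<notin> set is"
  shows "(\<Sum>\<beta>\<in>partial_indices Q (i # is). F \<beta>) = (\<Sum>\<alpha>\<in>partial_indices Q is. \<Sum>q\<le>Q. F (\<alpha>(i := q)))"
proof -
  have "(\<Sum>\<alpha>\<in>partial_indices Q is. \<Sum>q\<le>Q. F (\<alpha>(i := q)))
      = (\<Sum>(\<alpha>, q)\<in>partial_indices Q is \<times> {..Q}. F (\<alpha>(i := q)))"
    by (simp add: sum.cartesian_product)
  also have "\<dots> = (\<Sum>\<beta>\<in>partial_indices Q (i # is). F \<beta>)"
    by (rule sum.reindex_bij_witness[where j = "\<lambda>(\<alpha>, q). \<alpha>(i := q)" and i = "\<lambda>\<beta>. (\<beta>(i := 0), \<beta> i)"])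
      (use i in \<open>auto simp: partial_indices_def PiE_UNIV_domain Pi_iff fun_eq_iff split: if_splits\<close>)
  finally show ?thesis by simp
qed

text \<open>
  The new coordinate is put in front of the list because \<open>differential\<close> applies the head of its
  list last; in this way the tuples arising are those of \<open>multi_tuple\<close>, in the same order.
\<close>

lemma partial_expansion_step:
  assumes f: "smooth f" "supported f" and i: "i \<notin> set is"
  shows "\<exists>C. \<forall>N>0. \<bar>partial_expansion f N Q is - partial_expansion f N Q (i # is)\<bar> \<le> C / real N ^ (Q + 1)"
proof -
  define I where "I = partial_indices Q is"
  define k where "k \<alpha> = (\<Prod>i\<in>set is. bern (\<alpha> i) / fact (\<alpha> i))" for \<alpha> :: "'n \<Rightarrow> nat"
  define s where "s \<alpha> = (\<Sum>i\<in>UNIV. \<alpha> i)" for \<alpha> :: "'n \<Rightarrow> nat"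
  let ?meas = "\<lambda>q. if q = 0 then ray_coord i else end_coord i"
  have "\<forall>\<alpha>. \<exists>C. \<forall>N>0. \<forall>x. \<bar>(\<integral>t. differential f (partial_tuple is \<alpha>) (point (x(i := t))) \<partial>count_coord N i)
    - (\<Sum>q\<le>Q. bern q / fact q / real N ^ q *
        (\<integral>t. differential f (replicate (q - 1) (v i) @ partial_tuple is \<alpha>) (point (x(i := t))) \<partial>?meas q))\<bar>
    \<le> C / real N ^ (Q + 1)"
    by (intro allI Euler_Maclaurin_coordinate[OF f])
  from choice[OF this] obtain C where "\<forall>\<alpha>. \<forall>N>0. \<forall>x. \<bar>(\<integral>t. differential f (partial_tuple is \<alpha>) (point (x(i := t))) \<partial>count_coord N i)
    - (\<Sum>q\<le>Q. bern q / fact q / real N ^ q *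
        (\<integral>t. differential f (replicate (q - 1) (v i) @ partial_tuple is \<alpha>) (point (x(i := t))) \<partial>?meas q))\<bar>
    \<le> C \<alpha> / real N ^ (Q + 1)" ..
  then have C: "\<bar>(\<integral>t. differential f (partial_tuple is \<alpha>) (point (x(i := t))) \<partial>count_coord N i)
    - (\<Sum>q\<le>Q. bern q / fact q / real N ^ q *
        (\<integral>t. differential f (replicate (q - 1) (v i) @ partial_tuple is \<alpha>) (point (x(i := t))) \<partial>?meas q))\<bar>
    \<le> C \<alpha> / real N ^ (Q + 1)" if "N > 0" for \<alpha> N x
    using that by blast
  define K where "K = (2 * real \<rho> + 1) ^ (CARD('n) - 1)"
  define D where "D = (\<Sum>\<alpha>\<in>I. \<bar>k \<alpha>\<bar> * (C \<alpha> * K))"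
  have "\<bar>partial_expansion f N Q is - partial_expansion f N Q (i # is)\<bar> \<le> D / real N ^ (Q + 1)" if N: "N > 0" for N
  proof -
    define T where "T \<alpha> = (\<integral>y. differential f (partial_tuple is \<alpha>) (point y) \<partial>PiM UNIV (mixed_measure N is \<alpha>))" for \<alpha>
    define U where "U \<alpha> q = (\<integral>y. differential f (replicate (q - 1) (v i) @ partial_tuple is \<alpha>) (point y)
        \<partial>PiM UNIV ((mixed_measure N is \<alpha>)(i := ?meas q)))" for \<alpha> q
    have one: "\<bar>T \<alpha> - (\<Sum>q\<le>Q. bern q / fact q / real N ^ q * U \<alpha> q)\<bar> \<le> C \<alpha> / real N ^ (Q + 1) * K" for \<alpha>
    proof -
      have "mixed_measure N is \<alpha> = (mixed_measure N is \<alpha>)(i := count_coord N i)"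
        using i by (auto simp: mixed_measure_def fun_eq_iff)
      then have T: "T \<alpha> = (\<integral>y. differential f (partial_tuple is \<alpha>) (point y)
          \<partial>PiM UNIV ((mixed_measure N is \<alpha>)(i := count_coord N i)))"
        unfolding T_def by simp
      show ?thesis unfolding T U_def K_def
        by (intro replace_coordinate bounded_mixed N supported_bounded_measurable
              supported_differential f C[OF N] bounded_count_coord)
          (auto simp: bounded_ray_coord bounded_end_coord)
    qed
    have F: "(\<Prod>j\<in>set (i # is). bern ((\<alpha>(i := q)) j) / fact ((\<alpha>(i := q)) j)) / real N ^ s (\<alpha>(i := q)) *
        (\<integral>y. differential f (partial_tuple (i # is) (\<alpha>(i := q))) (point y)
          \<partial>PiM UNIV (mixed_measure N (i # is) (\<alpha>(i := q))))
      = k \<alpha> / real N ^ s \<alpha> * (bern q / fact q / real N ^ q * U \<alpha> q)" if "\<alpha> \<in> I" for \<alpha> q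
    proof -
      have a0: "\<alpha> i = 0" using that i by (auto simp: I_def partial_indices_def PiE_UNIV_domain Pi_iff split: if_splits)
      have "(\<Prod>j\<in>set is. bern ((\<alpha>(i := q)) j) / fact ((\<alpha>(i := q)) j)) = k \<alpha>"
        unfolding k_def using i by (intro prod.cong) auto
      then have 1: "(\<Prod>j\<in>set (i # is). bern ((\<alpha>(i := q)) j) / fact ((\<alpha>(i := q)) j)) = bern q / fact q * k \<alpha>"
        using i by simp
      have "s (\<alpha>(i := q)) = (\<Sum>j\<in>UNIV. \<alpha> j + (if j = i then q else 0))"
        unfolding s_def using a0 by (intro sum.cong) auto
      then have 2: "s (\<alpha>(i := q)) = s \<alpha> + q" by (simp add: s_def sum.distrib)
      have m: "map (\<lambda>j. replicate ((\<alpha>(i := q)) j - 1) (v j)) is = map (\<lambda>j. replicate (\<alpha> j - 1) (v j)) is"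
        using i by (intro map_cong) auto
      then have 3: "partial_tuple (i # is) (\<alpha>(i := q)) = replicate (q - 1) (v i) @ partial_tuple is \<alpha>"
        unfolding partial_tuple_def list.map concat.simps m by (simp only: fun_upd_same)
      have 4: "mixed_measure N (i # is) (\<alpha>(i := q)) = (mixed_measure N is \<alpha>)(i := ?meas q)"
        using i by (auto simp: mixed_measure_def fun_eq_iff)
      show ?thesis unfolding 1 2 3 4 U_def by (simp add: power_add mult_ac)
    qed
    have "partial_expansion f N Q (i # is) = (\<Sum>\<alpha>\<in>I. \<Sum>q\<le>Q. k \<alpha> / real N ^ s \<alpha> * (bern q / fact q / real N ^ q * U \<alpha> q))"
      unfolding partial_expansion_def sum_partial_indices_Cons[OF i] I_def[symmetric]
      using F unfolding s_def by (intro sum.cong refl) blast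
    also have "\<dots> = (\<Sum>\<alpha>\<in>I. k \<alpha> / real N ^ s \<alpha> * (\<Sum>q\<le>Q. bern q / fact q / real N ^ q * U \<alpha> q))"
      by (simp add: sum_distrib_left)
    finally have "partial_expansion f N Q is - partial_expansion f N Q (i # is)
        = (\<Sum>\<alpha>\<in>I. k \<alpha> / real N ^ s \<alpha> * (T \<alpha> - (\<Sum>q\<le>Q. bern q / fact q / real N ^ q * U \<alpha> q)))"
      unfolding partial_expansion_def I_def[symmetric] k_def[symmetric] s_def[symmetric] T_def[symmetric]
      by (simp add: sum_subtractf right_diff_distrib)
    also have "\<bar>\<dots>\<bar> \<le> (\<Sum>\<alpha>\<in>I. \<bar>k \<alpha>\<bar> * (C \<alpha> / real N ^ (Q + 1) * K))"
    proof (rule order_trans[OF sum_abs sum_mono])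
      fix \<alpha>
      have "\<bar>k \<alpha> / real N ^ s \<alpha>\<bar> \<le> \<bar>k \<alpha>\<bar>"
      proof -
        have "1 \<le> real N ^ s \<alpha>" using N by (intro one_le_power) simp
        then have "\<bar>k \<alpha>\<bar> / real N ^ s \<alpha> \<le> \<bar>k \<alpha>\<bar> / 1" using N by (intro divide_left_mono) auto
        then show ?thesis by (simp add: abs_divide)
      qed
      then show "\<bar>k \<alpha> / real N ^ s \<alpha> * (T \<alpha> - (\<Sum>q\<le>Q. bern q / fact q / real N ^ q * U \<alpha> q))\<bar>
          \<le> \<bar>k \<alpha>\<bar> * (C \<alpha> / real N ^ (Q + 1) * K)"
        unfolding abs_mult using one[of \<alpha>] by (intro mult_mono) auto
    qed
    also have "\<dots> = D / real N ^ (Q + 1)"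
      by (simp add: D_def sum_divide_distrib)
    finally show ?thesis .
  qed
  then show ?thesis by blast
qed

lemma partial_expansion_all:
  assumes f: "smooth f" "supported f" and "distinct is"
  shows "\<exists>C. \<forall>N>0. \<bar>(\<integral>y. f (point y) \<partial>PiM UNIV (count_coord N)) - partial_expansion f N Q is\<bar>
    \<le> C / real N ^ (Q + 1)"
  using assms(3)
proof (induction "is")
  case Nil
  have 1: "partial_indices Q [] = {\<lambda>_. 0}"
    by (auto simp: partial_indices_def PiE_UNIV_domain Pi_iff)
  have 2: "mixed_measure N [] \<alpha> = count_coord N" for N \<alpha>
    by (auto simp: mixed_measure_def)
  have "(\<integral>y. f (point y) \<partial>PiM UNIV (count_coord N)) = partial_expansion f N Q []" for N
    unfolding partial_expansion_def 1 2 by (simp add: partial_tuple_def)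
  then show ?case by (intro exI[of _ 0]) simp
next
  case (Cons i "is")
  then obtain C where C: "\<forall>N>0. \<bar>(\<integral>y. f (point y) \<partial>PiM UNIV (count_coord N)) - partial_expansion f N Q is\<bar>
    \<le> C / real N ^ (Q + 1)" by auto
  obtain D where D: "\<forall>N>0. \<bar>partial_expansion f N Q is - partial_expansion f N Q (i # is)\<bar> \<le> D / real N ^ (Q + 1)"
    using partial_expansion_step[OF f] Cons.prems by fastforce
  have "\<bar>(\<integral>y. f (point y) \<partial>PiM UNIV (count_coord N)) - partial_expansion f N Q (i # is)\<bar>
    \<le> (C + D) / real N ^ (Q + 1)" if "N > 0" for N
    using C[rule_format, OF that] D[rule_format, OF that] unfolding add_divide_distrib by linarith
  then show ?case by blast
qed

definition coord_coefficient :: "(real ^ 'n \<Rightarrow> real) \<Rightarrow> ('n \<Rightarrow> nat) \<Rightarrow> real" where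
  "coord_coefficient f \<alpha> = (\<Prod>i\<in>UNIV. bern (\<alpha> i) / fact (\<alpha> i)) *
     coord_integral {i. \<alpha> i > 0} (differential f (multi_tuple v (\<lambda>i. \<alpha> i - supp_index \<alpha> i)))"

lemma finite_multi_indices: "finite {\<alpha> :: 'n \<Rightarrow> nat. (\<Sum>i\<in>UNIV. \<alpha> i) = q}"
proof (rule finite_subset)
  show "{\<alpha> :: 'n \<Rightarrow> nat. (\<Sum>i\<in>UNIV. \<alpha> i) = q} \<subseteq> PiE UNIV (\<lambda>_. {..q})"
    using member_le_sum[of _ "UNIV :: 'n set"] by (fastforce simp: PiE_UNIV_domain)
qed (auto intro: finite_PiE)

text \<open>
  All coordinates have been replaced; the monomials of degree above \<open>Q\<close> are \<open>O(N\<^sup>-\<^sup>Q\<^sup>-\<^sup>1)\<close>.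
\<close>

lemma coordinate_expansion:
  assumes f: "smooth f" "supported f"
  shows "asymptotic_expansion (\<lambda>N. \<integral>y. f (point y) \<partial>PiM UNIV (count_coord N))
    (\<lambda>q. \<Sum>\<alpha>\<in>{\<alpha>. (\<Sum>i\<in>UNIV. \<alpha> i) = q}. coord_coefficient f \<alpha>)"
  unfolding asymptotic_expansion_def
proof
  fix Q
  obtain C where C: "\<forall>N>0. \<bar>(\<integral>y. f (point y) \<partial>PiM UNIV (count_coord N)) - partial_expansion f N Q index_list\<bar>
    \<le> C / real N ^ (Q + 1)"
    using partial_expansion_all[OF f index_list(1)] by blast
  define I where "I = partial_indices Q (index_list :: 'n list)"
  define s where "s \<alpha> = (\<Sum>i\<in>UNIV. \<alpha> i)" for \<alpha> :: "'n \<Rightarrow> nat"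
  define D where "D = (\<Sum>\<alpha>\<in>I. \<bar>coord_coefficient f \<alpha>\<bar>)"
  have fin: "finite I" unfolding I_def by (rule finite_partial_indices)
  have exp: "partial_expansion f N Q index_list = (\<Sum>\<alpha>\<in>I. coord_coefficient f \<alpha> / real N ^ s \<alpha>)" for N
  proof -
    have 1: "PiM UNIV (mixed_measure N index_list \<alpha>) = face_measure {i. \<alpha> i > 0}" for \<alpha>
      unfolding face_measure_def by (intro PiM_cong) (auto simp: mixed_measure_def index_list)
    have 2: "partial_tuple index_list \<alpha> = multi_tuple v (\<lambda>i. \<alpha> i - supp_index \<alpha> i)" for \<alpha>
      unfolding partial_tuple_def multi_tuple_def supp_index_def
      by (intro arg_cong[of _ _ concat] map_cong) auto
    show ?thesis
      unfolding partial_expansion_def 1 2 I_def coord_coefficient_def coord_integral_def s_def index_list(2)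
      by (intro sum.cong) auto
  qed
  have le: "\<alpha> \<in> I" if "s \<alpha> \<le> Q" for \<alpha>
    using that member_le_sum[of _ "UNIV :: 'n set" \<alpha>] order_trans
    by (fastforce simp: I_def partial_indices_def index_list PiE_UNIV_domain s_def)
  have low: "(\<Sum>q\<le>Q. (\<Sum>\<alpha>\<in>{\<alpha>. (\<Sum>i\<in>UNIV. \<alpha> i) = q}. coord_coefficient f \<alpha>) / real N ^ q)
      = (\<Sum>\<alpha>\<in>{\<alpha> \<in> I. s \<alpha> \<le> Q}. coord_coefficient f \<alpha> / real N ^ s \<alpha>)" for N
  proof -
    have "(\<Sum>\<alpha>\<in>{\<alpha> \<in> I. s \<alpha> \<le> Q}. coord_coefficient f \<alpha> / real N ^ s \<alpha>)
        = (\<Sum>q\<le>Q. \<Sum>\<alpha>\<in>{\<alpha> \<in> {\<alpha> \<in> I. s \<alpha> \<le> Q}. s \<alpha> = q}. coord_coefficient f \<alpha> / real N ^ s \<alpha>)"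
      using fin by (intro sum.group[symmetric]) auto
    also have "\<dots> = (\<Sum>q\<le>Q. (\<Sum>\<alpha>\<in>{\<alpha>. (\<Sum>i\<in>UNIV. \<alpha> i) = q}. coord_coefficient f \<alpha>) / real N ^ q)"
      unfolding sum_divide_distrib
      by (intro sum.cong) (auto simp: s_def[symmetric] intro: le)
    finally show ?thesis by simp
  qed
  have "\<bar>(\<integral>y. f (point y) \<partial>PiM UNIV (count_coord N)) -
      (\<Sum>q\<le>Q. (\<Sum>\<alpha>\<in>{\<alpha>. (\<Sum>i\<in>UNIV. \<alpha> i) = q}. coord_coefficient f \<alpha>) / real N ^ q)\<bar>
      \<le> (C + D) * \<bar>1 / real N ^ (Q + 1)\<bar>" if N: "N > 0" for N
  proof -
    have "(\<Sum>\<alpha>\<in>I. coord_coefficient f \<alpha> / real N ^ s \<alpha>)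
        - (\<Sum>\<alpha>\<in>{\<alpha> \<in> I. s \<alpha> \<le> Q}. coord_coefficient f \<alpha> / real N ^ s \<alpha>)
        = (\<Sum>\<alpha>\<in>I - {\<alpha> \<in> I. s \<alpha> \<le> Q}. coord_coefficient f \<alpha> / real N ^ s \<alpha>)"
      using fin by (subst sum_diff) auto
    also have "\<bar>\<dots>\<bar> \<le> (\<Sum>\<alpha>\<in>I - {\<alpha> \<in> I. s \<alpha> \<le> Q}. \<bar>coord_coefficient f \<alpha>\<bar> / real N ^ (Q + 1))"
    proof (rule order_trans[OF sum_abs sum_mono])
      fix \<alpha> assume "\<alpha> \<in> I - {\<alpha> \<in> I. s \<alpha> \<le> Q}"
      then have "real N ^ (Q + 1) \<le> real N ^ s \<alpha>" using N by (intro power_increasing) auto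
      then show "\<bar>coord_coefficient f \<alpha> / real N ^ s \<alpha>\<bar> \<le> \<bar>coord_coefficient f \<alpha>\<bar> / real N ^ (Q + 1)"
        using N by (simp add: abs_divide power_abs frac_le)
    qed
    also have "\<dots> \<le> (\<Sum>\<alpha>\<in>I. \<bar>coord_coefficient f \<alpha>\<bar> / real N ^ (Q + 1))"
      using fin by (intro sum_mono2) auto
    also have "\<dots> = D / real N ^ (Q + 1)" by (simp add: D_def sum_divide_distrib)
    finally have "\<bar>partial_expansion f N Q index_list
        - (\<Sum>\<alpha>\<in>{\<alpha> \<in> I. s \<alpha> \<le> Q}. coord_coefficient f \<alpha> / real N ^ s \<alpha>)\<bar> \<le> D / real N ^ (Q + 1)"
      unfolding exp .
    moreover have "\<bar>(\<integral>y. f (point y) \<partial>PiM UNIV (count_coord N)) - partial_expansion f N Q index_list\<bar>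
        \<le> C / real N ^ (Q + 1)"
      using C N by blast
    ultimately have "\<bar>(\<integral>y. f (point y) \<partial>PiM UNIV (count_coord N)) -
        (\<Sum>\<alpha>\<in>{\<alpha> \<in> I. s \<alpha> \<le> Q}. coord_coefficient f \<alpha> / real N ^ s \<alpha>)\<bar>
        \<le> C / real N ^ (Q + 1) + D / real N ^ (Q + 1)"
      by linarith
    then show ?thesis unfolding low by (simp add: add_divide_distrib)
  qed
  then show "(\<lambda>N. (\<integral>y. f (point y) \<partial>PiM UNIV (count_coord N)) -
      (\<Sum>q\<le>Q. (\<Sum>\<alpha>\<in>{\<alpha>. (\<Sum>i\<in>UNIV. \<alpha> i) = q}. coord_coefficient f \<alpha>) / real N ^ q))
      \<in> O(\<lambda>N. 1 / real N ^ (Q + 1))"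
    by (intro bigoI[of _ "C + D"] eventually_mono[OF eventually_gt_at_top[of 0]]) simp
qed

end

section \<open>Riemann sums and integration by parts in coordinates\<close>

context wedge_coordinates begin

lemma integral_PiM_count_coord:
  fixes I :: "'n set" and h :: "('n \<Rightarrow> real) \<Rightarrow> real"
  assumes "finite I" and N: "N > 0"
    and "h \<in> borel_measurable (PiM I (\<lambda>_. borel))" "\<And>y. \<bar>h y\<bar> \<le> C"
  shows "integral\<^sup>L (PiM I (count_coord N)) h =
    (\<Sum>k\<in>PiE I (\<lambda>i. {..nat (c i + int \<rho>) * N}). h (\<lambda>i\<in>I. - real \<rho> + real (k i) / real N)) / real N ^ card I"
  using assms(1,3,4)
proof (induction I arbitrary: h)
  case empty
  then show ?case
    by (simp add: PiM_empty lebesgue_integral_count_space_finite restrict_def)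
next
  case (insert i I)
  interpret product_sigma_finite "count_coord N"
    by (rule product_sigma_finite_bounded[OF bounded_count_coord[OF N]])
  define X where "X j = - real \<rho> + real j / real N" for j :: nat
  let ?A = "\<lambda>i. {..nat (c i + int \<rho>) * N}"
  have meas: "(\<lambda>x. h (x(i := t))) \<in> borel_measurable (PiM I (\<lambda>_. borel))" for t
    by (rule measurable_compose[OF measurable_fun_upd insert.prems(1)]) auto
  have meas1: "(\<lambda>t. h (x(i := t))) \<in> borel_measurable borel" if "x \<in> space (PiM I (count_coord N))" for x
  proof -
    have "x \<in> space (PiM I (\<lambda>_. borel))"
      using that sets_eq_imp_space_eq[OF sets_PiM_bounded[of "count_coord N" I, OF bounded_count_coord[OF N]]] by simp
    from measurable_component_update[OF this insert.hyps(2)]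
    show ?thesis by (rule measurable_compose[OF _ insert.prems(1)])
  qed
  have int: "integrable (PiM I (count_coord N)) (\<lambda>x. h (x(i := t)))" for t
    by (rule bounded_integrable_PiM[OF bounded_count_coord[OF N] meas insert.prems(2)])
  have "integral\<^sup>L (PiM (insert i I) (count_coord N)) h
      = (\<integral>x. (\<integral>t. h (x(i := t)) \<partial>count_coord N i) \<partial>PiM I (count_coord N))"
    by (intro product_integral_insert insert.hyps
        bounded_integrable_PiM[OF bounded_count_coord[OF N] insert.prems])
  also have "\<dots> = (\<integral>x. (\<Sum>j\<in>?A i. h (x(i := X j))) / real N \<partial>PiM I (count_coord N))"
    by (intro Bochner_Integration.integral_cong refl) (simp add: integral_count_coord[OF meas1] X_def)
  also have "\<dots> = (\<Sum>j\<in>?A i. (\<integral>x. h (x(i := X j)) \<partial>PiM I (count_coord N))) / real N"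
    using int by simp
  also have "\<dots> = (\<Sum>j\<in>?A i. (\<Sum>k\<in>PiE I ?A. h ((\<lambda>l\<in>I. X (k l))(i := X j))) / real N ^ card I) / real N"
    unfolding insert.IH[OF meas insert.prems(2)] X_def ..
  also have "\<dots> = (\<Sum>j\<in>?A i. \<Sum>k\<in>PiE I ?A. h ((\<lambda>l\<in>I. X (k l))(i := X j))) / real N ^ card (insert i I)"
    using insert.hyps by (simp add: sum_divide_distrib mult.commute)
  also have "(\<Sum>j\<in>?A i. \<Sum>k\<in>PiE I ?A. h ((\<lambda>l\<in>I. X (k l))(i := X j)))
      = (\<Sum>(j, k)\<in>?A i \<times> PiE I ?A. h (\<lambda>l\<in>insert i I. X ((k(i := j)) l)))"
    unfolding sum.cartesian_product
    by (intro sum.cong refl) (use insert.hyps in \<open>auto intro!: arg_cong[of _ _ h] simp: fun_eq_iff\<close>)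
  also have "\<dots> = (\<Sum>k\<in>PiE (insert i I) ?A. h (\<lambda>l\<in>insert i I. X (k l)))"
    unfolding PiE_insert_eq by (subst sum.reindex[OF inj_combinator[OF insert.hyps(2)]]) (auto simp: case_prod_unfold)
  finally show ?case unfolding X_def .
qed

text \<open>
  The lattice points of \<open>N W\<close> with all coordinates at least \<open>-\<rho> N\<close> are parametrised by their
  coordinates, counted from \<open>-\<rho> N\<close>; at the other lattice points \<open>f\<close> vanishes.
\<close>

lemma riemann_sum_eq_integral:
  assumes regular: "regular_integer_wedge u" and f: "supported f" and N: "N > 0"
  shows "riemann_sum f (wedge u c) N = (\<integral>y. f (point y) \<partial>PiM UNIV (count_coord N))"
proof -
  define A where "A = PiE UNIV (\<lambda>i. {..nat (c i + int \<rho>) * N})"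
  define X where "X j = - real \<rho> + real j / real N" for j :: nat
  define \<phi> where "\<phi> k = real N *\<^sub>R point (\<lambda>i. X (k i))" for k :: "'n \<Rightarrow> nat"
  define K where "K = int_vecs \<inter> (\<lambda>x. real N *\<^sub>R x) ` wedge u c"
  define K' where "K' = {k \<in> K. \<forall>i. - real \<rho> * real N \<le> u i \<bullet> k}"
  have u\<phi>: "u i \<bullet> \<phi> k = - real \<rho> * real N + real (k i)" for k i
    using N by (simp add: \<phi>_def X_def algebra_simps)
  have K: "k \<in> K \<longleftrightarrow> (\<forall>i. u i \<bullet> k \<in> \<int> \<and> u i \<bullet> k \<le> of_int (c i) * real N)" for k
  proof -
    have "k \<in> (\<lambda>x. real N *\<^sub>R x) ` wedge u c \<longleftrightarrow> (1 / real N) *\<^sub>R k \<in> wedge u c"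
      using N by (auto intro!: image_eqI[of _ _ "(1 / real N) *\<^sub>R k"])
    also have "\<dots> \<longleftrightarrow> (\<forall>i. u i \<bullet> k \<le> of_int (c i) * real N)"
      using N by (simp add: wedge_def field_simps)
    finally show ?thesis
      unfolding K_def using int_vecs_iff_coordinates[OF regular dual] by auto
  qed
  have bij: "bij_betw \<phi> A K'"
  proof (rule bij_betwI[where g = "\<lambda>k i. nat \<lfloor>u i \<bullet> k + real \<rho> * real N\<rfloor>"])
    show "\<phi> \<in> A \<rightarrow> K'"
    proof
      fix k assume k: "k \<in> A"
      have "u i \<bullet> \<phi> k \<in> \<int>" for i unfolding u\<phi> by auto
      moreover have "u i \<bullet> \<phi> k \<le> of_int (c i) * real N" for i
      proof -
        have "k i \<le> nat (c i + int \<rho>) * N" using k by (auto simp: A_def)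
        then have "real (k i) \<le> real (nat (c i + int \<rho>) * N)" by (rule of_nat_mono)
        then show ?thesis unfolding u\<phi> using c_nat[of i] by (simp add: algebra_simps)
      qed
      ultimately show "\<phi> k \<in> K'" unfolding K'_def K using u\<phi> by simp
    qed
    show "(\<lambda>k i. nat \<lfloor>u i \<bullet> k + real \<rho> * real N\<rfloor>) \<in> K' \<rightarrow> A"
    proof
      fix k assume k: "k \<in> K'"
      have "nat \<lfloor>u i \<bullet> k + real \<rho> * real N\<rfloor> \<le> nat (c i + int \<rho>) * N" for i
      proof -
        have "u i \<bullet> k + real \<rho> * real N \<le> real (nat (c i + int \<rho>) * N)"
          using k c_nat[of i] by (simp add: K'_def K algebra_simps)
        then have "\<lfloor>u i \<bullet> k + real \<rho> * real N\<rfloor> \<le> int (nat (c i + int \<rho>) * N)"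
          by linarith
        then show ?thesis by linarith
      qed
      then show "(\<lambda>i. nat \<lfloor>u i \<bullet> k + real \<rho> * real N\<rfloor>) \<in> A"
        by (simp add: A_def PiE_UNIV_domain)
    qed
    show "(\<lambda>i. nat \<lfloor>u i \<bullet> \<phi> k + real \<rho> * real N\<rfloor>) = k" if "k \<in> A" for k
      unfolding u\<phi> by simp
    show "\<phi> (\<lambda>i. nat \<lfloor>u i \<bullet> k + real \<rho> * real N\<rfloor>) = k" if k: "k \<in> K'" for k
    proof -
      have "u i \<bullet> \<phi> (\<lambda>i. nat \<lfloor>u i \<bullet> k + real \<rho> * real N\<rfloor>) = u i \<bullet> k" for i
      proof -
        have "u i \<bullet> k \<in> \<int>" "- real \<rho> * real N \<le> u i \<bullet> k" using k by (auto simp: K'_def K)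
        then have "u i \<bullet> k + real \<rho> * real N \<in> \<int>" "0 \<le> u i \<bullet> k + real \<rho> * real N" by auto
        moreover from this(1) obtain z where "u i \<bullet> k + real \<rho> * real N = of_int z" by (rule Ints_cases)
        ultimately have "real (nat \<lfloor>u i \<bullet> k + real \<rho> * real N\<rfloor>) = u i \<bullet> k + real \<rho> * real N"
          by simp
        then show ?thesis unfolding u\<phi> by simp
      qed
      then have "point (\<lambda>i. u i \<bullet> \<phi> (\<lambda>i. nat \<lfloor>u i \<bullet> k + real \<rho> * real N\<rfloor>)) = point (\<lambda>i. u i \<bullet> k)"
        by (simp only:)
      then show ?thesis by (simp only: point_u)
    qed
  qed
  have finA: "finite A" unfolding A_def by (intro finite_PiE) auto
  have "(\<Sum>\<^sub>\<infinity>k\<in>K. f (k /\<^sub>R real N)) = (\<Sum>\<^sub>\<infinity>k\<in>K'. f (k /\<^sub>R real N))"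
  proof (rule infsum_cong_neutral)
    fix k assume "k \<in> K - K'"
    then obtain i where "u i \<bullet> k < - real \<rho> * real N" by (auto simp: K'_def not_le)
    then have "u i \<bullet> (k /\<^sub>R real N) < - real \<rho>" using N by (simp add: field_simps)
    then show "f (k /\<^sub>R real N) = 0"
      using f unfolding supported_def by (metis abs_ge_minus_self le_minus_iff less_imp_le order_trans)
  qed (auto simp: K'_def)
  also have "\<dots> = (\<Sum>k\<in>K'. f (k /\<^sub>R real N))"
    using bij_betw_finite[OF bij] finA by (intro infsum_finite) simp
  also have "\<dots> = (\<Sum>k\<in>A. f (\<phi> k /\<^sub>R real N))"
    by (rule sum.reindex_bij_betw[OF bij, symmetric])
  also have "\<dots> = (\<Sum>k\<in>A. f (point (\<lambda>i\<in>UNIV. X (k i))))"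
    using N by (simp add: \<phi>_def restrict_UNIV)
  finally have "riemann_sum f (wedge u c) N = (\<Sum>k\<in>A. f (point (\<lambda>i\<in>UNIV. X (k i)))) / real N ^ CARD('n)"
    unfolding riemann_sum_def K_def by simp
  also have "\<dots> = (\<integral>y. f (point y) \<partial>PiM UNIV (count_coord N))"
  proof -
    obtain C where "\<And>x. \<bar>f x\<bar> \<le> C" using supported_bounded[OF f] by blast
    then show ?thesis
      using integral_PiM_count_coord[OF _ N, of UNIV "\<lambda>y. f (point y)" C]
        supported_bounded_measurable[OF f]
      unfolding A_def X_def by (simp add: bounded_measurable_def)
  qed
  finally show ?thesis .
qed

lemma bounded_face_measure: "bounded_coord (if i \<in> J then end_coord i else ray_coord i)"
  by (simp add: bounded_end_coord bounded_ray_coord)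

lemma coord_integrable: "supported g \<Longrightarrow> integrable (face_measure J) (\<lambda>y. g (point y))"
  unfolding face_measure_def
  by (intro bounded_measurable_integrable bounded_face_measure supported_bounded_measurable)

lemma coord_integral_add:
  "supported g \<Longrightarrow> supported h \<Longrightarrow> coord_integral J (\<lambda>x. g x + h x) = coord_integral J g + coord_integral J h"
  unfolding coord_integral_def by (simp add: coord_integrable)

lemma coord_integral_scale: "coord_integral J (\<lambda>x. a * g x) = a * coord_integral J g"
  unfolding coord_integral_def by simp

lemma coord_integral_sum:
  "(\<And>i. i \<in> I \<Longrightarrow> supported (g i)) \<Longrightarrow>
    coord_integral J (\<lambda>x. \<Sum>i\<in>I. g i x) = (\<Sum>i\<in>I. coord_integral J (g i))"
  unfolding coord_integral_def by (simp add: coord_integrable)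

text \<open>
  The fundamental theorem of calculus on the ray \<open>y\<^sub>j \<le> c\<^sub>j\<close>.
\<close>

lemma coord_integral_by_parts:
  assumes f: "smooth f" "supported f" and j: "j \<notin> J"
  shows "coord_integral J (differential f (v j # as)) = coord_integral (insert j J) (differential f as)"
proof -
  let ?M = "\<lambda>i. if i \<in> J then end_coord i else ray_coord i"
  have eq: "(\<integral>t. differential f (v j # as) (point (x(j := t))) \<partial>ray_coord j)
      = (\<integral>t. differential f as (point (x(j := t))) \<partial>end_coord j)" for x
  proof -
    let ?H = "slice f as j x"
    have "(\<integral>t. ?H 1 t \<partial>ray_coord j) = integral {- real \<rho>..of_int (c j)} (?H 1)"
      unfolding integral_ray_coord[OF slice_measurable[OF f(1)]]
      by (intro set_borel_integral_eq_integral(2) borel_integrable_atLeastAtMost') (rule slice_continuous[OF f(1)])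
    also have "\<dots> = ?H 0 (of_int (c j)) - ?H 0 (- real \<rho>)"
      using c_le[of j] slice_derivative[OF f(1), of as j x 0]
      by (intro integral_unique fundamental_theorem_of_calculus)
        (auto simp: has_real_derivative_iff_has_vector_derivative[symmetric] intro: has_field_derivative_at_within)
    also have "\<dots> = (\<integral>t. ?H 0 t \<partial>end_coord j)"
      by (simp add: slice_zero[OF f] integral_end_coord[OF slice_measurable[OF f(1)]])
    finally show ?thesis by (simp add: slice_def)
  qed
  have "\<bar>integral\<^sup>L (PiM UNIV (?M(j := ray_coord j))) (\<lambda>y. differential f (v j # as) (point y))
      - (\<Sum>q\<in>{()}. 1 * integral\<^sup>L (PiM UNIV (?M(j := end_coord j))) (\<lambda>y. differential f as (point y)))\<bar>
      \<le> 0 * (2 * real \<rho> + 1) ^ (CARD('n) - 1)"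
    by (intro replace_coordinate bounded_face_measure bounded_ray_coord bounded_end_coord
        supported_bounded_measurable supported_differential f) (use eq in simp)
  moreover have "?M(j := ray_coord j) = ?M" using j by (auto simp: fun_eq_iff)
  moreover have "?M(j := end_coord j) = (\<lambda>i. if i \<in> insert j J then end_coord i else ray_coord i)"
    by (auto simp: fun_eq_iff)
  ultimately show ?thesis by (simp add: coord_integral_def face_measure_def)
qed

end

section \<open>Invariant measures on a subspace\<close>

text \<open>
  Lebesgue measure on the span of the \<open>w\<^sub>i\<close>, normalised so that the parallelotope they span has
  volume one. It is indexed by a family in order to treat orthonormal bases, lattice bases and
  the \<open>v\<^sub>i\<close> uniformly.
\<close>

definition span_measure :: "'i set \<Rightarrow> ('i \<Rightarrow> 'a::euclidean_space) \<Rightarrow> 'a measure" where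
  "span_measure I w = distr (\<Pi>\<^sub>M i\<in>I. lborel) borel (\<lambda>t. \<Sum>i\<in>I. t i *\<^sub>R w i)"

lemma sets_span_measure [simp, measurable_cong]: "sets (span_measure I w) = sets borel"
  and space_span_measure [simp]: "space (span_measure I w) = UNIV"
  by (simp_all add: span_measure_def)

lemma combination_measurable:
  "(\<lambda>t. \<Sum>i\<in>I. t i *\<^sub>R (w i :: 'a::euclidean_space)) \<in> borel_measurable (\<Pi>\<^sub>M i\<in>I. lborel)"
  by measurable

lemma nn_integral_span_measure:
  "f \<in> borel_measurable borel \<Longrightarrow>
    (\<integral>\<^sup>+x. f x \<partial>span_measure I w) = (\<integral>\<^sup>+t. f (\<Sum>i\<in>I. t i *\<^sub>R w i) \<partial>(\<Pi>\<^sub>M i\<in>I. lborel))"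
  unfolding span_measure_def using combination_measurable by (subst nn_integral_distr) auto

lemma product_sigma_finite_lborel: "product_sigma_finite (\<lambda>_. lborel)"
  by (simp add: product_sigma_finite_def sigma_finite_lborel)

lemma nn_integral_PiM_lborel_affine:
  fixes \<sigma> :: real and I :: "'i set"
  assumes "finite I" "h \<in> borel_measurable (\<Pi>\<^sub>M i\<in>I. lborel)" "\<bar>\<sigma>\<bar> = 1"
  shows "(\<integral>\<^sup>+t. h (\<lambda>i\<in>I. s i + \<sigma> * t i) \<partial>(\<Pi>\<^sub>M i\<in>I. lborel)) = (\<integral>\<^sup>+t. h t \<partial>(\<Pi>\<^sub>M i\<in>I. lborel))"
  using assms(1,2)
proof (induction I arbitrary: h)
  case empty
  then show ?case by (simp add: PiM_empty nn_integral_count_space_finite restrict_def)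
next
  case (insert i I)
  interpret product_sigma_finite "\<lambda>_. lborel :: real measure" by (rule product_sigma_finite_lborel)
  note [measurable] = insert.prems
  have \<sigma>: "\<sigma> \<noteq> 0" using assms(3) by auto
  have up: "(\<lambda>(x, y). x(i := y)) \<in> measurable ((\<Pi>\<^sub>M i\<in>I. lborel) \<Otimes>\<^sub>M lborel) (\<Pi>\<^sub>M i\<in>insert i I. lborel)"
    by (rule measurable_add_dim)
  have m2: "(\<lambda>(x, y). h (x(i := y))) \<in> borel_measurable ((\<Pi>\<^sub>M i\<in>I. lborel) \<Otimes>\<^sub>M lborel)"
    using measurable_compose[OF up insert.prems] by (simp add: case_prod_unfold)
  have m3: "(\<lambda>x. \<integral>\<^sup>+y. h (x(i := y)) \<partial>lborel) \<in> borel_measurable (\<Pi>\<^sub>M i\<in>I. lborel)"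
    by (rule sigma_finite_measure.borel_measurable_nn_integral[OF sigma_finite_lborel m2])
  have sm: "(\<lambda>t. \<lambda>k\<in>insert i I. s k + \<sigma> * t k) \<in> measurable (\<Pi>\<^sub>M i\<in>insert i I. lborel) (\<Pi>\<^sub>M i\<in>insert i I. lborel)"
    by measurable
  have "(\<integral>\<^sup>+t. h (\<lambda>k\<in>insert i I. s k + \<sigma> * t k) \<partial>(\<Pi>\<^sub>M i\<in>insert i I. lborel))
      = (\<integral>\<^sup>+x. \<integral>\<^sup>+y. h (\<lambda>k\<in>insert i I. s k + \<sigma> * (x(i := y)) k) \<partial>lborel \<partial>(\<Pi>\<^sub>M i\<in>I. lborel))"
    by (intro product_nn_integral_insert insert.hyps measurable_compose[OF sm insert.prems])
  also have "\<dots> = (\<integral>\<^sup>+x. \<integral>\<^sup>+y. h ((\<lambda>k\<in>I. s k + \<sigma> * x k)(i := y)) \<partial>lborel \<partial>(\<Pi>\<^sub>M i\<in>I. lborel))"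
  proof (rule nn_integral_cong)
    fix x :: "'i \<Rightarrow> real"
    let ?x = "\<lambda>k\<in>I. s k + \<sigma> * x k"
    have "?x \<in> space (\<Pi>\<^sub>M i\<in>I. lborel)" by (simp add: space_PiM)
    from measurable_component_update[OF this insert.hyps(2)]
    have "(\<lambda>y. h (?x(i := y))) \<in> borel_measurable lborel"
      by (rule measurable_compose[OF _ insert.prems])
    then have "(\<integral>\<^sup>+y. h (?x(i := y)) \<partial>lborel) = \<bar>\<sigma>\<bar> * (\<integral>\<^sup>+y. h (?x(i := s i + \<sigma> * y)) \<partial>lborel)"
      by (intro nn_integral_real_affine \<sigma>) simp
    moreover have "?x(i := s i + \<sigma> * y) = (\<lambda>k\<in>insert i I. s k + \<sigma> * (x(i := y)) k)" for y
      using insert.hyps(2) by (auto simp: fun_eq_iff)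
    ultimately show "(\<integral>\<^sup>+y. h (\<lambda>k\<in>insert i I. s k + \<sigma> * (x(i := y)) k) \<partial>lborel)
        = (\<integral>\<^sup>+y. h (?x(i := y)) \<partial>lborel)"
      using assms(3) by simp
  qed
  also have "\<dots> = (\<integral>\<^sup>+x. \<integral>\<^sup>+y. h (x(i := y)) \<partial>lborel \<partial>(\<Pi>\<^sub>M i\<in>I. lborel))"
    by (rule insert.IH[OF m3])
  also have "\<dots> = (\<integral>\<^sup>+t. h t \<partial>(\<Pi>\<^sub>M i\<in>insert i I. lborel))"
    by (rule product_nn_integral_insert[symmetric, OF insert.hyps insert.prems])
  finally show ?case .
qed

lemma span_image_combination:
  assumes "finite I" "x \<in> span (w ` I)"
  obtains s where "x = (\<Sum>i\<in>I. s i *\<^sub>R w i)"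
proof -
  let ?S = "range (\<lambda>s. \<Sum>i\<in>I. s i *\<^sub>R w i)"
  have "subspace ?S"
  proof (rule subspaceI)
    show "0 \<in> ?S" by (intro range_eqI[of _ _ "\<lambda>_. 0"]) simp
    show "x + y \<in> ?S" if "x \<in> ?S" "y \<in> ?S" for x y
    proof -
      obtain s t where "x = (\<Sum>i\<in>I. s i *\<^sub>R w i)" "y = (\<Sum>i\<in>I. t i *\<^sub>R w i)" using \<open>x \<in> ?S\<close> \<open>y \<in> ?S\<close> by blast
      then show ?thesis
        by (intro range_eqI[of _ _ "\<lambda>i. s i + t i"]) (simp add: sum.distrib scaleR_left_distrib)
    qed
    show "c *\<^sub>R x \<in> ?S" if "x \<in> ?S" for c x
    proof -
      obtain s where "x = (\<Sum>i\<in>I. s i *\<^sub>R w i)" using \<open>x \<in> ?S\<close> by blast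
      then show ?thesis
        by (intro range_eqI[of _ _ "\<lambda>i. c * s i"]) (simp add: scaleR_sum_right)
    qed
  qed
  moreover have "w ` I \<subseteq> ?S"
  proof
    fix y assume "y \<in> w ` I"
    then obtain j where j: "j \<in> I" "y = w j" by blast
    have "(\<Sum>i\<in>I. (if i = j then 1 else 0) *\<^sub>R w i) = (\<Sum>i\<in>I. if i = j then w j else 0)"
      by (intro sum.cong) auto
    then show "y \<in> ?S" using j assms(1)
      by (intro range_eqI[of _ _ "\<lambda>i. if i = j then 1 else 0"]) simp
  qed
  ultimately show ?thesis using assms(2) span_minimal that by blast
qed

lemma combination_in_span: "(\<Sum>i\<in>I. s i *\<^sub>R w i) \<in> span (w ` I)"
  by (intro span_sum span_scale span_base) auto

text \<open>
  Invariance under translations along the subspace and under the reflection in a point.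
\<close>

lemma nn_integral_span_measure_affine:
  fixes f :: "'a::euclidean_space \<Rightarrow> ennreal" and \<sigma> :: real
  assumes "finite I" "x \<in> span (w ` I)" "f \<in> borel_measurable borel" "\<bar>\<sigma>\<bar> = 1"
  shows "(\<integral>\<^sup>+y. f (x + \<sigma> *\<^sub>R y) \<partial>span_measure I w) = (\<integral>\<^sup>+y. f y \<partial>span_measure I w)"
proof -
  obtain s where s: "x = (\<Sum>i\<in>I. s i *\<^sub>R w i)" by (rule span_image_combination[OF assms(1,2)])
  have [measurable]: "f \<in> borel_measurable borel" by fact
  let ?h = "\<lambda>t. f (\<Sum>i\<in>I. t i *\<^sub>R w i)"
  have "(\<integral>\<^sup>+y. f (x + \<sigma> *\<^sub>R y) \<partial>span_measure I w) = (\<integral>\<^sup>+t. f (x + \<sigma> *\<^sub>R (\<Sum>i\<in>I. t i *\<^sub>R w i)) \<partial>(\<Pi>\<^sub>M i\<in>I. lborel))"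
    by (intro nn_integral_span_measure) measurable
  also have "\<dots> = (\<integral>\<^sup>+t. ?h (\<lambda>i\<in>I. s i + \<sigma> * t i) \<partial>(\<Pi>\<^sub>M i\<in>I. lborel))"
    by (intro nn_integral_cong arg_cong[of _ _ f])
      (simp add: s sum.distrib scaleR_left_distrib scaleR_sum_right)
  also have "\<dots> = (\<integral>\<^sup>+t. ?h t \<partial>(\<Pi>\<^sub>M i\<in>I. lborel))"
    using combination_measurable
    by (intro nn_integral_PiM_lborel_affine assms measurable_compose[OF combination_measurable assms(3)])
  also have "\<dots> = (\<integral>\<^sup>+y. f y \<partial>span_measure I w)"
    using assms(3) by (rule nn_integral_span_measure[symmetric])
  finally show ?thesis .
qed

lemma sigma_finite_PiM_lborel: "finite I \<Longrightarrow> sigma_finite_measure (\<Pi>\<^sub>M i\<in>I. lborel :: real measure)"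
  using product_sigma_finite.sigma_finite[OF product_sigma_finite_lborel] .

text \<open>
  Uniqueness of an invariant measure, by Fubini's theorem. Write \<open>\<mu>\<close> and \<open>\<nu>\<close> for the two measures.
  The substitutions \<open>y \<mapsto> y + x\<close>, then \<open>x \<mapsto> x - y\<close>, then \<open>y \<mapsto> x - y\<close> turn
  \<open>\<integral>\<integral> f x g y d\<nu> d\<mu>\<close> into \<open>\<integral>\<integral> f (x - y) g x\<close> and finally into \<open>\<integral>\<integral> f y g x d\<nu> d\<mu>\<close>.
\<close>

lemma span_measure_proportional:
  fixes f g :: "'a::euclidean_space \<Rightarrow> ennreal" and w :: "'i \<Rightarrow> 'a" and z :: "'k \<Rightarrow> 'a"
  assumes "finite I" "finite K" and span: "span (w ` I) = span (z ` K)"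
    and f: "f \<in> borel_measurable borel" and g: "g \<in> borel_measurable borel"
  shows "(\<integral>\<^sup>+x. f x \<partial>span_measure I w) * (\<integral>\<^sup>+x. g x \<partial>span_measure K z)
       = (\<integral>\<^sup>+x. g x \<partial>span_measure I w) * (\<integral>\<^sup>+x. f x \<partial>span_measure K z)"
proof -
  note [measurable] = f g
  let ?P = "\<Pi>\<^sub>M i\<in>I. lborel :: real measure" and ?Q = "\<Pi>\<^sub>M i\<in>K. lborel :: real measure"
  let ?p = "\<lambda>t. \<Sum>i\<in>I. t i *\<^sub>R w i" and ?q = "\<lambda>t. \<Sum>i\<in>K. t i *\<^sub>R z i"
  have [measurable]: "?p \<in> borel_measurable ?P" "?q \<in> borel_measurable ?Q"
    by (rule combination_measurable)+
  interpret pair_sigma_finite ?P ?Q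
    by (simp add: pair_sigma_finite_def sigma_finite_PiM_lborel assms)
  have p: "?p t \<in> span (z ` K)" for t using combination_in_span span by metis
  have q: "- ?q t \<in> span (w ` I)" "?q t \<in> span (w ` I)" for t
    using combination_in_span[of t z K] span span_neg by auto
  have "(\<integral>\<^sup>+x. f x \<partial>span_measure I w) * (\<integral>\<^sup>+x. g x \<partial>span_measure K z)
      = (\<integral>\<^sup>+t. f (?p t) * (\<integral>\<^sup>+s. g (?q s) \<partial>?Q) \<partial>?P)"
    by (simp add: nn_integral_span_measure f g nn_integral_multc)
  also have "\<dots> = (\<integral>\<^sup>+t. \<integral>\<^sup>+s. f (?p t) * g (?p t + ?q s) \<partial>?Q \<partial>?P)"
  proof (rule nn_integral_cong)
    fix t
    have "(\<integral>\<^sup>+s. g (?q s) \<partial>?Q) = (\<integral>\<^sup>+y. g (?p t + 1 *\<^sub>R y) \<partial>span_measure K z)"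
      using nn_integral_span_measure_affine[OF assms(2) p g, of 1] by (simp add: nn_integral_span_measure)
    also have "\<dots> = (\<integral>\<^sup>+s. g (?p t + ?q s) \<partial>?Q)"
      by (subst nn_integral_span_measure) auto
    finally show "f (?p t) * (\<integral>\<^sup>+s. g (?q s) \<partial>?Q) = (\<integral>\<^sup>+s. f (?p t) * g (?p t + ?q s) \<partial>?Q)"
      by (simp add: nn_integral_cmult)
  qed
  also have "\<dots> = (\<integral>\<^sup>+s. \<integral>\<^sup>+t. f (?p t) * g (?p t + ?q s) \<partial>?P \<partial>?Q)"
    by (rule Fubini'[symmetric]) measurable
  also have "\<dots> = (\<integral>\<^sup>+s. \<integral>\<^sup>+t. f (?p t - ?q s) * g (?p t) \<partial>?P \<partial>?Q)"
  proof (rule nn_integral_cong)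
    fix s
    have "(\<integral>\<^sup>+t. f (?p t) * g (?p t + ?q s) \<partial>?P) = (\<integral>\<^sup>+y. f y * g (y + ?q s) \<partial>span_measure I w)"
      by (subst nn_integral_span_measure) auto
    also have "\<dots> = (\<integral>\<^sup>+y. f (- ?q s + 1 *\<^sub>R y) * g ((- ?q s + 1 *\<^sub>R y) + ?q s) \<partial>span_measure I w)"
      by (rule nn_integral_span_measure_affine[OF assms(1) q(1), symmetric]) auto
    also have "\<dots> = (\<integral>\<^sup>+t. f (?p t - ?q s) * g (?p t) \<partial>?P)"
      by (subst nn_integral_span_measure) auto
    finally show "(\<integral>\<^sup>+t. f (?p t) * g (?p t + ?q s) \<partial>?P) = (\<integral>\<^sup>+t. f (?p t - ?q s) * g (?p t) \<partial>?P)" .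
  qed
  also have "\<dots> = (\<integral>\<^sup>+t. \<integral>\<^sup>+s. f (?p t - ?q s) * g (?p t) \<partial>?Q \<partial>?P)"
    by (rule Fubini') measurable
  also have "\<dots> = (\<integral>\<^sup>+t. (\<integral>\<^sup>+s. f (?q s) \<partial>?Q) * g (?p t) \<partial>?P)"
  proof (rule nn_integral_cong)
    fix t
    have "(\<integral>\<^sup>+s. f (?p t - ?q s) \<partial>?Q) = (\<integral>\<^sup>+y. f (?p t + (- 1) *\<^sub>R y) \<partial>span_measure K z)"
      by (subst nn_integral_span_measure) auto
    also have "\<dots> = (\<integral>\<^sup>+s. f (?q s) \<partial>?Q)"
      using nn_integral_span_measure_affine[OF assms(2) p f, of "- 1"] by (simp add: nn_integral_span_measure)
    finally show "(\<integral>\<^sup>+s. f (?p t - ?q s) * g (?p t) \<partial>?Q) = (\<integral>\<^sup>+s. f (?q s) \<partial>?Q) * g (?p t)"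
      by (simp add: nn_integral_multc)
  qed
  also have "\<dots> = (\<integral>\<^sup>+x. g x \<partial>span_measure I w) * (\<integral>\<^sup>+x. f x \<partial>span_measure K z)"
    unfolding nn_integral_span_measure[OF f] nn_integral_span_measure[OF g]
    by (subst nn_integral_cmult) (auto simp: mult.commute)
  finally show ?thesis .
qed

text \<open>
  Linear functionals \<open>d\<^sub>i\<close> reading off the coordinates with respect to the \<open>w\<^sub>i\<close>.
\<close>

definition dual_family :: "'i set \<Rightarrow> ('i \<Rightarrow> 'a::euclidean_space) \<Rightarrow> ('i \<Rightarrow> 'a) \<Rightarrow> bool" where
  "dual_family I w d \<longleftrightarrow> finite I \<and> (\<forall>i\<in>I. \<forall>j\<in>I. d i \<bullet> w j = (if i = j then 1 else 0))"

text \<open>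
  Only the intersection with the span of the family matters. Described by inequalities, the set is
  evidently measurable.
\<close>

definition fundamental_cell :: "'i set \<Rightarrow> ('i \<Rightarrow> 'a::euclidean_space) \<Rightarrow> 'a set" where
  "fundamental_cell I d = {x. \<forall>i\<in>I. 0 \<le> d i \<bullet> x \<and> d i \<bullet> x < 1}"

definition lattice_of :: "'i set \<Rightarrow> ('i \<Rightarrow> 'a::euclidean_space) \<Rightarrow> 'a set" where
  "lattice_of I w = range (\<lambda>a :: 'i \<Rightarrow> int. \<Sum>i\<in>I. of_int (a i) *\<^sub>R w i)"

lemma dual_family_coordinate:
  "dual_family I w d \<Longrightarrow> i \<in> I \<Longrightarrow> d i \<bullet> (\<Sum>j\<in>I. t j *\<^sub>R w j) = t i"
proof -
  assume d: "dual_family I w d" "i \<in> I"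
  have "d i \<bullet> (\<Sum>j\<in>I. t j *\<^sub>R w j) = (\<Sum>j\<in>I. if i = j then t i else 0)"
    unfolding inner_sum_right using d by (intro sum.cong) (auto simp: dual_family_def)
  then show ?thesis using d by (simp add: dual_family_def)
qed

lemma fundamental_cell_measurable [measurable]: "finite I \<Longrightarrow> fundamental_cell I d \<in> sets borel"
  unfolding fundamental_cell_def by measurable

lemma emeasure_span_measure_box:
  assumes "dual_family I w d" "A \<in> sets borel" "\<And>i. B i \<in> sets borel"
    and "\<And>t. (\<Sum>i\<in>I. t i *\<^sub>R w i) \<in> A \<longleftrightarrow> (\<forall>i\<in>I. t i \<in> B i)"
  shows "emeasure (span_measure I w) A = (\<Prod>i\<in>I. emeasure lborel (B i))"
proof -
  interpret product_sigma_finite "\<lambda>_. lborel :: real measure" by (rule product_sigma_finite_lborel)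
  have "emeasure (span_measure I w) A
      = emeasure (\<Pi>\<^sub>M i\<in>I. lborel) ((\<lambda>t. \<Sum>i\<in>I. t i *\<^sub>R w i) -` A \<inter> space (\<Pi>\<^sub>M i\<in>I. lborel))"
    unfolding span_measure_def by (intro emeasure_distr combination_measurable assms)
  also have "(\<lambda>t. \<Sum>i\<in>I. t i *\<^sub>R w i) -` A \<inter> space (\<Pi>\<^sub>M i\<in>I. lborel) = PiE I B"
    using assms(4) by (auto simp: space_PiM PiE_iff)
  also have "emeasure (\<Pi>\<^sub>M i\<in>I. lborel) (PiE I B) = (\<Prod>i\<in>I. emeasure lborel (B i))"
    using assms by (intro emeasure_PiM) (auto simp: dual_family_def)
  finally show ?thesis .
qed

lemma emeasure_fundamental_cell:
  assumes "dual_family I w d"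
  shows "emeasure (span_measure I w) (fundamental_cell I d) = 1"
proof -
  have "emeasure (span_measure I w) (fundamental_cell I d) = (\<Prod>i\<in>I. emeasure lborel {0..<1::real})"
    using assms dual_family_coordinate[OF assms]
    by (intro emeasure_span_measure_box[OF assms]) (auto simp: fundamental_cell_def dual_family_def)
  then show ?thesis by simp
qed

lemma lattice_of_span: "lattice_of I w \<subseteq> span (w ` I)"
  unfolding lattice_of_def by (auto intro: combination_in_span)

lemma countable_lattice_of:
  fixes w :: "'i \<Rightarrow> 'a::euclidean_space"
  shows "finite I \<Longrightarrow> countable (lattice_of I w)"
proof -
  assume "finite I"
  have "lattice_of I w \<subseteq> (\<lambda>a. \<Sum>i\<in>I. of_int (a i) *\<^sub>R w i) ` (PiE I (\<lambda>_. UNIV :: int set))"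
  proof
    fix x assume "x \<in> lattice_of I w"
    then obtain a :: "'i \<Rightarrow> int" where "x = (\<Sum>i\<in>I. of_int (a i) *\<^sub>R w i)" unfolding lattice_of_def by blast
    then show "x \<in> (\<lambda>a. \<Sum>i\<in>I. of_int (a i) *\<^sub>R w i) ` (PiE I (\<lambda>_. UNIV :: int set))"
      by (intro image_eqI[of _ _ "restrict a I"]) auto
  qed
  then show ?thesis
    by (rule countable_subset) (intro countable_image countable_PiE \<open>finite I\<close>, simp)
qed

lemma uminus_lattice_of:
  fixes w :: "'i \<Rightarrow> 'a::euclidean_space"
  shows "x \<in> lattice_of I w \<Longrightarrow> - x \<in> lattice_of I w"
proof -
  assume "x \<in> lattice_of I w"
  then obtain a :: "'i \<Rightarrow> int" where "x = (\<Sum>i\<in>I. of_int (a i) *\<^sub>R w i)" unfolding lattice_of_def by blast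
  then have "- x = (\<Sum>i\<in>I. of_int (- a i) *\<^sub>R w i)" by (simp add: sum_negf)
  then show ?thesis unfolding lattice_of_def by (rule range_eqI[of _ _ "\<lambda>i. - a i"])
qed

lemma fundamental_cell_unique_translate:
  fixes w :: "'i \<Rightarrow> 'a::euclidean_space"
  assumes d: "dual_family I w d" and x: "x \<in> span (w ` I)"
  shows "\<exists>!l. l \<in> lattice_of I w \<and> x + l \<in> fundamental_cell I d"
proof -
  have fin: "finite I" using d by (simp add: dual_family_def)
  obtain s where s: "x = (\<Sum>i\<in>I. s i *\<^sub>R w i)" by (rule span_image_combination[OF fin x])
  have co: "d i \<bullet> (x + (\<Sum>i\<in>I. of_int (a i) *\<^sub>R w i)) = s i + of_int (a i)" if "i \<in> I" for a i
    unfolding s inner_right_distrib by (simp add: dual_family_coordinate[OF d that])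
  have iff: "x + (\<Sum>i\<in>I. of_int (a i) *\<^sub>R w i) \<in> fundamental_cell I d \<longleftrightarrow> (\<forall>i\<in>I. a i = - \<lfloor>s i\<rfloor>)" for a
  proof -
    have "0 \<le> s i + of_int (a i) \<and> s i + of_int (a i) < 1 \<longleftrightarrow> a i = - \<lfloor>s i\<rfloor>" for i
      by linarith
    then show ?thesis by (simp add: fundamental_cell_def co)
  qed
  show ?thesis
  proof (rule ex1I)
    show "(\<Sum>i\<in>I. of_int (- \<lfloor>s i\<rfloor>) *\<^sub>R w i) \<in> lattice_of I w \<and>
        x + (\<Sum>i\<in>I. of_int (- \<lfloor>s i\<rfloor>) *\<^sub>R w i) \<in> fundamental_cell I d"
      using iff[of "\<lambda>i. - \<lfloor>s i\<rfloor>"] unfolding lattice_of_def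
      by (auto intro: range_eqI[of _ _ "\<lambda>i. - \<lfloor>s i\<rfloor>"])
    fix l assume l: "l \<in> lattice_of I w \<and> x + l \<in> fundamental_cell I d"
    then obtain a :: "'i \<Rightarrow> int" where a: "l = (\<Sum>i\<in>I. of_int (a i) *\<^sub>R w i)" unfolding lattice_of_def by blast
    then have "\<forall>i\<in>I. a i = - \<lfloor>s i\<rfloor>" using l iff[of a] by blast
    then show "l = (\<Sum>i\<in>I. of_int (- \<lfloor>s i\<rfloor>) *\<^sub>R w i)" unfolding a by (intro sum.cong) auto
  qed
qed

lemma nn_integral_count_space_unique:
  assumes "\<exists>!l. l \<in> L \<and> P l"
  shows "(\<integral>\<^sup>+l. indicator {l. P l} l \<partial>count_space L) = 1"
proof -
  from assms obtain l0 where l0: "l0 \<in> L" "P l0" "\<And>l. l \<in> L \<Longrightarrow> P l \<Longrightarrow> l = l0" by blast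
  have "(\<integral>\<^sup>+l. indicator {l. P l} l \<partial>count_space L) = (\<integral>\<^sup>+l. indicator {l0} l \<partial>count_space L)"
    by (intro nn_integral_cong) (auto simp: indicator_def l0(1,2) dest: l0(3))
  also have "\<dots> = 1" using l0(1) by (simp add: one_ennreal_def[symmetric])
  finally show ?thesis .
qed

lemma AE_span_measure: "AE x in span_measure I w. x \<in> span (w ` I)"
  unfolding span_measure_def
  by (subst AE_distr_iff)
    (auto intro!: combination_measurable combination_in_span closed_subspace simp: borel_closed)

text \<open>
  Two fundamental cells \<open>D\<close>, \<open>E\<close> of the same lattice have the same measure: cutting \<open>E\<close> along the
  translates of \<open>D\<close> and moving the pieces into \<open>D\<close> covers \<open>D\<close> exactly once. As the measures are
  proportional and both give \<open>E\<close> measure one, they agree.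
\<close>

lemma span_measure_lattice_invariant:
  fixes w :: "'i \<Rightarrow> 'a::euclidean_space" and z :: "'k \<Rightarrow> 'a"
  assumes d: "dual_family I w d" and e: "dual_family K z e" and L: "lattice_of I w = lattice_of K z"
    and span: "span (w ` I) = span (z ` K)"
  shows "span_measure I w = span_measure K z"
proof (rule measure_eqI)
  have fin: "finite I" "finite K" using d e by (auto simp: dual_family_def)
  note [measurable] = fundamental_cell_measurable[OF fin(1), of d] fundamental_cell_measurable[OF fin(2), of e]
  let ?L = "lattice_of I w" and ?\<mu> = "span_measure I w"
  let ?D = "fundamental_cell I d" and ?E = "fundamental_cell K e"
  have cL: "countable ?L" by (rule countable_lattice_of[OF fin(1)])
  have "emeasure ?\<mu> ?E = (\<integral>\<^sup>+x. indicator ?E x \<partial>?\<mu>)" by simp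
  also have "\<dots> = (\<integral>\<^sup>+x. \<integral>\<^sup>+l. indicator ?E x * indicator ?D (x + l) \<partial>count_space ?L \<partial>?\<mu>)"
  proof (rule nn_integral_cong_AE, rule AE_mp[OF AE_span_measure], rule AE_I2, rule impI)
    fix x assume "x \<in> span (w ` I)"
    then have "(\<integral>\<^sup>+l. indicator {l. x + l \<in> ?D} l \<partial>count_space ?L) = 1"
      by (intro nn_integral_count_space_unique fundamental_cell_unique_translate[OF d])
    moreover have "indicator {l. x + l \<in> ?D} l = (indicator ?D (x + l) :: ennreal)" for l
      by (simp add: indicator_def)
    ultimately show "indicator ?E x = (\<integral>\<^sup>+l. indicator ?E x * indicator ?D (x + l) \<partial>count_space ?L)"
      by (simp add: nn_integral_cmult)
  qed
  also have "\<dots> = (\<integral>\<^sup>+l. \<integral>\<^sup>+x. indicator ?E x * indicator ?D (x + l) \<partial>?\<mu> \<partial>count_space ?L)"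
    by (rule nn_integral_count_space_nn_integral[OF cL]) measurable
  also have "\<dots> = (\<integral>\<^sup>+l. \<integral>\<^sup>+x. indicator ?E (x - l) * indicator ?D x \<partial>?\<mu> \<partial>count_space ?L)"
  proof (rule nn_integral_cong)
    fix l assume "l \<in> space (count_space ?L)"
    then have l: "- l \<in> span (w ` I)" using lattice_of_span[of I w] span_neg by auto
    have "(\<integral>\<^sup>+x. indicator ?E x * indicator ?D (x + l) \<partial>?\<mu>)
        = (\<integral>\<^sup>+x. indicator ?E (- l + 1 *\<^sub>R x) * indicator ?D ((- l + 1 *\<^sub>R x) + l) \<partial>?\<mu>)"
      by (rule nn_integral_span_measure_affine[OF fin(1) l, symmetric]) auto
    then show "(\<integral>\<^sup>+x. indicator ?E x * indicator ?D (x + l) \<partial>?\<mu>)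
        = (\<integral>\<^sup>+x. indicator ?E (x - l) * indicator ?D x \<partial>?\<mu>)" by simp
  qed
  also have "\<dots> = (\<integral>\<^sup>+x. \<integral>\<^sup>+l. indicator ?E (x - l) * indicator ?D x \<partial>count_space ?L \<partial>?\<mu>)"
    by (rule nn_integral_count_space_nn_integral[OF cL, symmetric]) measurable
  also have "\<dots> = (\<integral>\<^sup>+x. indicator ?D x \<partial>?\<mu>)"
  proof (rule nn_integral_cong_AE, rule AE_mp[OF AE_span_measure], rule AE_I2, rule impI)
    fix x assume "x \<in> span (w ` I)"
    then have x: "x \<in> span (z ` K)" using span by simp
    have "\<exists>!l. l \<in> ?L \<and> x - l \<in> ?E"
    proof -
      obtain l where l: "l \<in> ?L" "x + l \<in> ?E" "\<And>m. m \<in> ?L \<Longrightarrow> x + m \<in> ?E \<Longrightarrow> m = l"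
        using fundamental_cell_unique_translate[OF e x] unfolding L by blast
      show ?thesis
      proof (rule ex1I[of _ "- l"])
        fix m assume "m \<in> ?L \<and> x - m \<in> ?E"
        then have "- m = l" using l(3)[of "- m"] uminus_lattice_of by auto
        then show "m = - l" by (simp add: minus_equation_iff)
      qed (use l(1,2) uminus_lattice_of in auto)
    qed
    then have "(\<integral>\<^sup>+l. indicator {l. x - l \<in> ?E} l \<partial>count_space ?L) = 1"
      by (rule nn_integral_count_space_unique)
    moreover have "indicator {l. x - l \<in> ?E} l = (indicator ?E (x - l) :: ennreal)" for l
      by (simp add: indicator_def)
    ultimately show "(\<integral>\<^sup>+l. indicator ?E (x - l) * indicator ?D x \<partial>count_space ?L) = indicator ?D x"
      by (simp add: nn_integral_multc)
  qed
  also have "\<dots> = 1" using emeasure_fundamental_cell[OF d] by simp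
  finally have E1: "emeasure ?\<mu> ?E = 1" .
  fix A assume "A \<in> sets ?\<mu>"
  then have [measurable]: "A \<in> sets borel" by simp
  have "emeasure ?\<mu> A * emeasure (span_measure K z) ?E = emeasure ?\<mu> ?E * emeasure (span_measure K z) A"
    using span_measure_proportional[OF fin span, of "indicator A" "indicator ?E"] by simp
  then show "emeasure ?\<mu> A = emeasure (span_measure K z) A"
    using E1 emeasure_fundamental_cell[OF e] by simp
qed simp

section \<open>Face integrals in lattice coordinates\<close>

lemma dual_family_inj_on: "dual_family I w d \<Longrightarrow> inj_on w I"
  unfolding dual_family_def inj_on_def by (metis zero_neq_one)

lemma orthonormal_basis_dual_family:
  assumes "orthonormal_basis B L"
  shows "dual_family B (\<lambda>b. b) (\<lambda>b. b)"
proof -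
  have "0 \<notin> B" using assms by (force simp: orthonormal_basis_def)
  then have "finite B"
    using assms pairwise_orthogonal_independent independent_imp_finite unfolding orthonormal_basis_def by blast
  then show ?thesis
    using assms unfolding dual_family_def orthonormal_basis_def pairwise_def orthogonal_def
    by (auto simp: norm_eq_1)
qed

lemma some_orthonormal_basis:
  assumes "subspace L"
  shows "orthonormal_basis (SOME B. orthonormal_basis B L) L"
proof (rule someI_ex)
  obtain B where "pairwise orthogonal B" "\<And>x. x \<in> B \<Longrightarrow> norm x = 1" "span B = L"
    using orthonormal_basis_subspace[OF assms] by metis
  then show "\<exists>B. orthonormal_basis B L" by (auto simp: orthonormal_basis_def)
qed

text \<open>
  The measure underlying \<open>affine_lborel\<close>, with the same choice of an orthonormal basis.
\<close>

definition subspace_measure :: "'a::euclidean_space set \<Rightarrow> 'a measure" where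
  "subspace_measure L = span_measure (SOME B. orthonormal_basis B L) (\<lambda>b. b)"

text \<open>
  The ratio of the two normalisations, measured on the unit cube of the orthonormal basis.
\<close>

definition lattice_density :: "'i set \<Rightarrow> ('i \<Rightarrow> 'a::euclidean_space) \<Rightarrow> real" where
  "lattice_density I w = measure (span_measure I w)
     (fundamental_cell (SOME B. orthonormal_basis B (span (w ` I))) (\<lambda>b. b))"

lemma sets_subspace_measure [simp, measurable_cong]: "sets (subspace_measure L) = sets borel"
  and space_subspace_measure [simp]: "space (subspace_measure L) = UNIV"
  by (simp_all add: subspace_measure_def)

lemma span_measure_density:
  assumes d: "dual_family I w d"
  shows "span_measure I w = density (subspace_measure (span (w ` I))) (\<lambda>_. ennreal (lattice_density I w))"
    and "lattice_density I w > 0"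
proof -
  define B where "B = (SOME B. orthonormal_basis B (span (w ` I)))"
  define k where "k = emeasure (span_measure I w) (fundamental_cell B (\<lambda>b. b))"
  have B: "orthonormal_basis B (span (w ` I))"
    unfolding B_def by (rule some_orthonormal_basis) simp
  then have e: "dual_family B (\<lambda>b. b) (\<lambda>b. b)" by (rule orthonormal_basis_dual_family)
  have fin: "finite I" "finite B" using d e by (auto simp: dual_family_def)
  have sp: "span (w ` I) = span ((\<lambda>b. b) ` B)" using B by (simp add: orthonormal_basis_def)
  have [measurable]: "fundamental_cell B (\<lambda>b. b) \<in> sets borel" "fundamental_cell I d \<in> sets borel"
    using fin by (auto intro: fundamental_cell_measurable)
  have M: "subspace_measure (span (w ` I)) = span_measure B (\<lambda>b. b)"
    unfolding subspace_measure_def B_def ..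
  have scaled: "emeasure (span_measure I w) A = k * emeasure (span_measure B (\<lambda>b. b)) A" if "A \<in> sets borel" for A
    using span_measure_proportional[OF fin sp, of "indicator A" "indicator (fundamental_cell B (\<lambda>b. b))"] that
      emeasure_fundamental_cell[OF e] by (simp add: k_def)
  have one: "k * emeasure (span_measure B (\<lambda>b. b)) (fundamental_cell I d) = 1"
    using scaled[of "fundamental_cell I d"] emeasure_fundamental_cell[OF d] by simp
  then have "k \<noteq> 0" by auto
  moreover have "k \<noteq> \<infinity>"
  proof
    assume "k = \<infinity>"
    then show False using one by (cases "emeasure (span_measure B (\<lambda>b. b)) (fundamental_cell I d) = 0")
      (auto simp: ennreal_top_mult)
  qed
  moreover have ld: "lattice_density I w = enn2real k"
    by (simp add: lattice_density_def k_def measure_def B_def)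
  ultimately show "lattice_density I w > 0"
    by (simp add: enn2real_positive_iff less_top zero_less_iff_neq_zero)
  have kl: "k = ennreal (lattice_density I w)"
    using \<open>k \<noteq> \<infinity>\<close> by (simp add: ld less_top)
  show "span_measure I w = density (subspace_measure (span (w ` I))) (\<lambda>_. ennreal (lattice_density I w))"
  proof (rule measure_eqI)
    fix A assume "A \<in> sets (span_measure I w)"
    then have A: "A \<in> sets borel" by simp
    then show "emeasure (span_measure I w) A
        = emeasure (density (subspace_measure (span (w ` I))) (\<lambda>_. ennreal (lattice_density I w))) A"
      unfolding M by (simp add: emeasure_density nn_integral_cmult_indicator scaled kl)
  qed simp
qed

lemma direction_space_subset: "x \<in> F \<Longrightarrow> y \<in> F \<Longrightarrow> x - y \<in> direction_space F"
  unfolding direction_space_def by (intro span_base) auto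

lemma span_measure_translate:
  assumes "finite I" "x \<in> span (w ` I)" "A \<in> sets borel"
  shows "emeasure (span_measure I w) ((+) x -` A) = emeasure (span_measure I w) A"
proof -
  have [measurable]: "A \<in> sets borel" by fact
  have m: "(+) x -` A \<in> sets borel"
    using measurable_sets[of "(+) x" borel borel A] by simp
  have "(\<integral>\<^sup>+y. indicator A (x + 1 *\<^sub>R y) \<partial>span_measure I w) = (\<integral>\<^sup>+y. indicator A y \<partial>span_measure I w)"
    by (rule nn_integral_span_measure_affine[OF assms(1,2)]) auto
  moreover have "indicator A (x + 1 *\<^sub>R y) = (indicator ((+) x -` A) y :: ennreal)" for y
    by (simp add: indicator_def)
  ultimately show ?thesis using m by simp
qed

text \<open>
  The base point chosen in \<open>affine_lborel\<close> may be replaced by any point of the affine hull.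
\<close>

lemma affine_lborel_eq:
  assumes "p \<in> S" "p0 - p \<in> direction_space S"
  shows "affine_lborel S = distr (subspace_measure (direction_space S)) borel (\<lambda>x. p0 + x)"
proof -
  define B where "B = (SOME B. orthonormal_basis B (direction_space S))"
  define q where "q = (SOME p. p \<in> S)"
  have q: "q \<in> S" unfolding q_def using assms(1) by (rule someI)
  have B: "orthonormal_basis B (direction_space S)"
    unfolding B_def by (rule some_orthonormal_basis) (simp add: direction_space_def)
  then have fin: "finite B" using orthonormal_basis_dual_family by (auto simp: dual_family_def)
  have "affine_lborel S = distr (\<Pi>\<^sub>M b\<in>B. lborel) borel (\<lambda>t. q + (\<Sum>b\<in>B. t b *\<^sub>R b))"
    unfolding affine_lborel_def Let_def B_def q_def ..
  also have "\<dots> = distr (span_measure B (\<lambda>b. b)) borel (\<lambda>x. q + x)"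
    unfolding span_measure_def
    by (subst distr_distr) (auto simp: o_def intro!: combination_measurable)
  also have "\<dots> = distr (span_measure B (\<lambda>b. b)) borel (\<lambda>x. p0 + x)"
  proof (rule measure_eqI)
    fix A assume "A \<in> sets (distr (span_measure B (\<lambda>b. b)) borel (\<lambda>x. q + x))"
    then have A: "A \<in> sets borel" by simp
    have "p0 - q \<in> direction_space S"
    proof -
      have "(p0 - p) + (p - q) \<in> direction_space S"
        using assms(2) direction_space_subset[OF assms(1) q] unfolding direction_space_def by (rule span_add)
      then show ?thesis by simp
    qed
    then have x: "p0 - q \<in> span ((\<lambda>b. b) ` B)" using B by (simp add: orthonormal_basis_def)
    have m: "(+) q -` A \<in> sets borel"
      using measurable_sets[of "(+) q" borel borel A] A by simp
    have "emeasure (distr (span_measure B (\<lambda>b. b)) borel (\<lambda>x. p0 + x)) A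
        = emeasure (span_measure B (\<lambda>b. b)) ((+) (p0 - q) -` ((+) q -` A))"
    proof -
      have "(+) (p0 - q) -` ((+) q -` A) = (\<lambda>x. p0 + x) -` A" by (simp add: vimage_def)
      then show ?thesis using A by (simp add: emeasure_distr)
    qed
    also have "\<dots> = emeasure (distr (span_measure B (\<lambda>b. b)) borel (\<lambda>x. q + x)) A"
      using A by (subst span_measure_translate[OF fin x m], subst emeasure_distr) auto
    finally show "emeasure (distr (span_measure B (\<lambda>b. b)) borel (\<lambda>x. q + x)) A
        = emeasure (distr (span_measure B (\<lambda>b. b)) borel (\<lambda>x. p0 + x)) A" by simp
  qed simp
  also have "span_measure B (\<lambda>b. b) = subspace_measure (direction_space S)"
    unfolding subspace_measure_def B_def ..
  finally show ?thesis .
qed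

lemma mem_parallelotope_iff:
  assumes d: "dual_family I w d"
  shows "x \<in> parallelotope (w ` I) \<longleftrightarrow> x \<in> span (w ` I) \<and> (\<forall>i\<in>I. 0 \<le> d i \<bullet> x \<and> d i \<bullet> x \<le> 1)"
proof
  have inj: "inj_on w I" by (rule dual_family_inj_on[OF d])
  show "x \<in> span (w ` I) \<and> (\<forall>i\<in>I. 0 \<le> d i \<bullet> x \<and> d i \<bullet> x \<le> 1)" if "x \<in> parallelotope (w ` I)"
  proof -
    obtain t where t: "x = (\<Sum>v\<in>w ` I. t v *\<^sub>R v)" "\<forall>v\<in>w ` I. 0 \<le> t v \<and> t v \<le> 1"
      using \<open>x \<in> parallelotope (w ` I)\<close> by (auto simp: parallelotope_def)
    have x: "x = (\<Sum>i\<in>I. t (w i) *\<^sub>R w i)" using inj by (simp add: t(1) sum.reindex)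
    show ?thesis
      using t(2) combination_in_span[of "\<lambda>i. t (w i)" w I]
      by (auto simp: x dual_family_coordinate[OF d])
  qed
  show "x \<in> parallelotope (w ` I)" if x: "x \<in> span (w ` I) \<and> (\<forall>i\<in>I. 0 \<le> d i \<bullet> x \<and> d i \<bullet> x \<le> 1)"
  proof -
    have fin: "finite I" using d by (simp add: dual_family_def)
    obtain s where s: "x = (\<Sum>i\<in>I. s i *\<^sub>R w i)" using span_image_combination[OF fin] x by blast
    define t where "t v = s (the_inv_into I w v)" for v
    have "x = (\<Sum>v\<in>w ` I. t v *\<^sub>R v)"
      using inj by (simp add: s t_def sum.reindex the_inv_into_f_f)
    moreover have "\<forall>v\<in>w ` I. 0 \<le> t v \<and> t v \<le> 1"
      using x inj by (auto simp: t_def the_inv_into_f_f s dual_family_coordinate[OF d])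
    ultimately show ?thesis unfolding parallelotope_def by blast
  qed
qed

lemma direction_space_parallelotope:
  assumes d: "dual_family I w d"
  shows "direction_space (parallelotope (w ` I)) = span (w ` I)"
proof
  show "direction_space (parallelotope (w ` I)) \<subseteq> span (w ` I)"
    unfolding direction_space_def by (rule span_minimal) (auto simp: mem_parallelotope_iff[OF d] span_diff)
  have "w i \<in> direction_space (parallelotope (w ` I))" if "i \<in> I" for i
  proof -
    have "0 \<le> d j \<bullet> w i \<and> d j \<bullet> w i \<le> 1" if "j \<in> I" for j
      using d that \<open>i \<in> I\<close> unfolding dual_family_def by (metis order_refl zero_le_one)
    then have "w i \<in> parallelotope (w ` I)" "0 \<in> parallelotope (w ` I)"
      using that by (simp_all add: mem_parallelotope_iff[OF d] span_base span_zero)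
    from direction_space_subset[OF this] show ?thesis by simp
  qed
  then show "span (w ` I) \<subseteq> direction_space (parallelotope (w ` I))"
    unfolding direction_space_def by (intro span_minimal) auto
qed

text \<open>
  The closed parallelotope has measure one with respect to its own edges.
\<close>

lemma parallelotope_volume_eq:
  assumes d: "dual_family I w d"
  shows "parallelotope_volume (w ` I) = 1 / lattice_density I w"
proof -
  let ?P = "parallelotope (w ` I)"
  have fin: "finite I" using d by (simp add: dual_family_def)
  have "closed {x \<in> span (w ` I). \<forall>i\<in>I. 0 \<le> d i \<bullet> x \<and> d i \<bullet> x \<le> 1}"
  proof -
    have "{x \<in> span (w ` I). \<forall>i\<in>I. 0 \<le> d i \<bullet> x \<and> d i \<bullet> x \<le> 1}
        = span (w ` I) \<inter> (\<Inter>i\<in>I. {x. 0 \<le> d i \<bullet> x} \<inter> {x. d i \<bullet> x \<le> 1})" by auto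
    moreover have "closed (span (w ` I))" by (simp add: closed_subspace)
    ultimately show ?thesis
      by (auto intro!: closed_Int[OF \<open>closed (span (w ` I))\<close>] closed_INT closed_Int closed_Collect_le continuous_intros)
  qed
  moreover have "?P = {x \<in> span (w ` I). \<forall>i\<in>I. 0 \<le> d i \<bullet> x \<and> d i \<bullet> x \<le> 1}"
    using mem_parallelotope_iff[OF d] by blast
  ultimately have P: "?P \<in> sets borel" by simp
  have "emeasure (span_measure I w) ?P = (\<Prod>i\<in>I. emeasure lborel {0..1::real})"
    by (rule emeasure_span_measure_box[OF d P])
      (auto simp: mem_parallelotope_iff[OF d] combination_in_span dual_family_coordinate[OF d])
  then have "emeasure (span_measure I w) ?P = 1" by simp
  then have "ennreal (lattice_density I w) * emeasure (subspace_measure (span (w ` I))) ?P = 1"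
    using span_measure_density(1)[OF d] P by (simp add: emeasure_density nn_integral_cmult_indicator)
  then have "lattice_density I w * measure (subspace_measure (span (w ` I))) ?P = 1"
    using span_measure_density(2)[OF d] unfolding measure_def
    by (metis enn2real_1 enn2real_ennreal enn2real_mult less_imp_le)
  moreover have "affine_lborel ?P = subspace_measure (span (w ` I))"
  proof -
    have "0 \<in> ?P" by (simp add: mem_parallelotope_iff[OF d] span_zero)
    then have "affine_lborel ?P = distr (subspace_measure (direction_space ?P)) borel (\<lambda>x. 0 + x)"
      by (rule affine_lborel_eq) (simp add: direction_space_def span_zero)
    then show ?thesis
      using distr_id2[of borel "subspace_measure (span (w ` I))"]
      by (simp add: direction_space_parallelotope[OF d])
  qed
  ultimately show ?thesis
    using span_measure_density(2)[OF d] unfolding parallelotope_volume_def by (simp add: field_simps)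
qed

text \<open>
  The Euclidean integral over \<open>F\<close>, divided by the volume of the parallelotope, is the integral in
  the coordinates of the family \<open>w\<close>, with origin \<open>p0\<close>.
\<close>

lemma face_integral_lattice_coordinates:
  assumes d: "dual_family I w d" and F: "direction_space F = span (w ` I)" "F \<in> sets borel"
    and p: "p \<in> F" "p0 - p \<in> span (w ` I)" and g: "g \<in> borel_measurable borel"
  shows "face_integral F g / parallelotope_volume (w ` I)
    = (\<integral>x. indicator F (p0 + x) * g (p0 + x) \<partial>span_measure I w)"
proof -
  note [measurable] = g F(2)
  have "face_integral F g = (\<integral>x. indicator F (p0 + x) * g (p0 + x) \<partial>subspace_measure (span (w ` I)))"
    unfolding face_integral_def set_lebesgue_integral_def
    by (subst affine_lborel_eq[OF p(1), of p0], simp add: F p, subst integral_distr) (auto simp: F)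
  also have "lattice_density I w * \<dots> = (\<integral>x. indicator F (p0 + x) * g (p0 + x) \<partial>span_measure I w)"
    unfolding span_measure_density(1)[OF d]
    using span_measure_density(2)[OF d] by (subst integral_density) auto
  finally show ?thesis by (simp add: parallelotope_volume_eq[OF d] mult.commute)
qed

lemma independent_dual_family:
  fixes V :: "'a::euclidean_space set"
  assumes "independent V"
  obtains d where "dual_family V (\<lambda>v. v) d"
proof -
  have "\<forall>u. \<exists>a. \<forall>v\<in>V. a \<bullet> v = (if u = v then 1 else 0)"
  proof
    fix u
    obtain g :: "'a \<Rightarrow> real" where g: "linear g" "\<forall>v\<in>V. g v = (if u = v then 1 else 0)"
      using linear_independent_extend[OF assms, of "\<lambda>v. if u = v then 1 else 0 :: real"] by metis
    then have "adjoint g 1 \<bullet> v = g v" for v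
      using adjoint_works[OF g(1), of v 1] by (simp add: inner_commute)
    then show "\<exists>a. \<forall>v\<in>V. a \<bullet> v = (if u = v then 1 else 0)"
      using g(2) by (intro exI[of _ "adjoint g 1"]) simp
  qed
  from choice[OF this] obtain d where "\<forall>u. \<forall>v\<in>V. d u \<bullet> v = (if u = v then 1 else 0)" ..
  then have "dual_family V (\<lambda>v. v) d"
    using independent_imp_finite[OF assms] by (auto simp: dual_family_def)
  then show ?thesis by (rule that)
qed

lemma lattice_basis_dual_family:
  assumes "lattice_basis V L"
  obtains d where "dual_family V (\<lambda>v. v) d" "lattice_of V (\<lambda>v. v) = L"
  using assms independent_dual_family unfolding lattice_basis_def lattice_of_def by metis

lemma lattice_of_base:
  assumes "dual_family I w d" "i \<in> I"
  shows "w i \<in> lattice_of I w"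
proof -
  have "(\<Sum>j\<in>I. of_int (if j = i then 1 else 0) *\<^sub>R w j) = (\<Sum>j\<in>I. if j = i then w i else 0)"
    by (intro sum.cong) auto
  also have "\<dots> = w i" using assms by (simp add: dual_family_def)
  finally show ?thesis unfolding lattice_of_def by (intro range_eqI[of _ _ "\<lambda>j. if j = i then 1 else 0"]) simp
qed

lemma span_lattice_of:
  assumes "dual_family I w d"
  shows "span (lattice_of I w) = span (w ` I)"
proof
  show "span (lattice_of I w) \<subseteq> span (w ` I)"
    by (intro span_minimal lattice_of_span subspace_span)
  show "span (w ` I) \<subseteq> span (lattice_of I w)"
    using lattice_of_base[OF assms] by (intro span_mono) auto
qed

lemma span_measure_lattice_eq:
  assumes "dual_family I w d" "dual_family K z e" "lattice_of I w = lattice_of K z"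
  shows "span_measure I w = span_measure K z" "span (w ` I) = span (z ` K)"
proof -
  show sp: "span (w ` I) = span (z ` K)"
    using span_lattice_of assms by metis
  show "span_measure I w = span_measure K z"
    by (rule span_measure_lattice_invariant[OF assms sp])
qed

lemma parallelotope_volume_lattice_eq:
  assumes "dual_family I w d" "dual_family K z e" "lattice_of I w = lattice_of K z"
  shows "parallelotope_volume (w ` I) = parallelotope_volume (z ` K)"
  unfolding parallelotope_volume_eq[OF assms(1)] parallelotope_volume_eq[OF assms(2)]
  by (simp add: lattice_density_def span_measure_lattice_eq[OF assms])

section \<open>The expansion on a wedge\<close>

lemma asymptotic_expansion_cong:
  assumes "\<And>N. N > 0 \<Longrightarrow> S N = T N"
  shows "asymptotic_expansion S a \<longleftrightarrow> asymptotic_expansion T a"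
proof -
  have ev: "eventually (\<lambda>N. S N - (\<Sum>q\<le>Q. a q / real N ^ q) = T N - (\<Sum>q\<le>Q. a q / real N ^ q)) sequentially" for Q
    by (rule eventually_mono[OF eventually_gt_at_top[of 0]]) (simp add: assms)
  then show ?thesis
    unfolding asymptotic_expansion_def by (simp only: landau_o.big.in_cong[OF ev])
qed

definition coordinate_face :: "('n::finite \<Rightarrow> real ^ 'n) \<Rightarrow> ('n \<Rightarrow> int) \<Rightarrow> 'n set \<Rightarrow> (real ^ 'n) set" where
  "coordinate_face u c J = {x \<in> wedge u c. \<forall>i\<in>J. u i \<bullet> x = of_int (c i)}"

lemma wedge_face_eq: "wedge_face u c \<alpha> = coordinate_face u c {i. \<alpha> i > 0}"
  by (auto simp: wedge_face_def coordinate_face_def wedge_facet_def)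

lemma closed_coordinate_face: "closed (coordinate_face u c J)"
proof -
  have "coordinate_face u c J = (\<Inter>i. {x. u i \<bullet> x \<le> of_int (c i)}) \<inter> (\<Inter>i\<in>J. {x. u i \<bullet> x = of_int (c i)})"
    by (auto simp: coordinate_face_def wedge_def)
  then show ?thesis
    by (auto intro!: closed_Int closed_INT closed_Collect_le closed_Collect_eq continuous_intros)
qed

context wedge_coordinates begin

lemma dual_family_v: "dual_family I v u"
  by (simp add: dual_family_def u_v)

lemma point_in_coordinate_face:
  "point y \<in> coordinate_face u c J \<longleftrightarrow> (\<forall>i. y i \<le> of_int (c i)) \<and> (\<forall>i\<in>J. y i = of_int (c i))"
  by (simp add: coordinate_face_def wedge_def)

lemma in_span_v_iff: "x \<in> span (v ` I) \<longleftrightarrow> (\<forall>i. i \<notin> I \<longrightarrow> u i \<bullet> x = 0)"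
proof
  assume "x \<in> span (v ` I)"
  then obtain s where "x = (\<Sum>i\<in>I. s i *\<^sub>R v i)" by (rule span_image_combination[OF finite])
  then show "\<forall>i. i \<notin> I \<longrightarrow> u i \<bullet> x = 0"
    by (auto simp: inner_sum_right u_v intro!: sum.neutral)
next
  assume "\<forall>i. i \<notin> I \<longrightarrow> u i \<bullet> x = 0"
  then have "(\<Sum>i\<in>UNIV. (u i \<bullet> x) *\<^sub>R v i) = (\<Sum>i\<in>I. (u i \<bullet> x) *\<^sub>R v i)"
    by (intro sum.mono_neutral_right) auto
  then have "x = (\<Sum>i\<in>I. (u i \<bullet> x) *\<^sub>R v i)" by (simp add: dual_basis_expand[OF dual])
  then show "x \<in> span (v ` I)" by (metis combination_in_span)
qed

lemma vertex_in_coordinate_face: "point (\<lambda>i. of_int (c i)) \<in> coordinate_face u c J"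
  by (simp add: point_in_coordinate_face)

lemma direction_space_coordinate_face: "direction_space (coordinate_face u c J) = span (v ` (- J))"
proof
  show "direction_space (coordinate_face u c J) \<subseteq> span (v ` (- J))"
    unfolding direction_space_def
    by (rule span_minimal) (auto simp: in_span_v_iff coordinate_face_def inner_diff_right)
  have "v i \<in> direction_space (coordinate_face u c J)" if "i \<notin> J" for i
  proof -
    let ?p = "point (\<lambda>i. of_int (c i))"
    have "point (\<lambda>i. of_int (c i)) - v i \<in> coordinate_face u c J"
      using that by (auto simp: coordinate_face_def wedge_def inner_diff_right u_v)
    from direction_space_subset[OF vertex_in_coordinate_face this] show ?thesis by simp
  qed
  then show "span (v ` (- J)) \<subseteq> direction_space (coordinate_face u c J)"
    unfolding direction_space_def by (intro span_minimal) auto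
qed

lemma emeasure_end_coord: "A \<in> sets borel \<Longrightarrow> emeasure (end_coord i) A = indicator A (of_int (c i))"
  by (simp add: end_coord_def emeasure_distr indicator_def)

lemma emeasure_ray_coord:
  "A \<in> sets borel \<Longrightarrow> emeasure (ray_coord i) A = emeasure lborel ({- real \<rho>..of_int (c i)} \<inter> A)"
  unfolding ray_coord_def by (simp add: emeasure_density flip: indicator_inter_arith)

lemma fix_coordinates_measurable:
  "(\<lambda>x i. if i \<in> J then of_int (c i) else x i) \<in> measurable (\<Pi>\<^sub>M i\<in>- J. lborel) coord_space"
proof (rule measurable_PiM_single')
  fix i :: 'n
  show "(\<lambda>x. if i \<in> J then of_int (c i) else x i) \<in> borel_measurable (\<Pi>\<^sub>M i\<in>- J. lborel)"
    by (cases "i \<in> J") auto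
qed auto

text \<open>
  The product of point masses in the coordinates from \<open>J\<close> and of rays in the others is carried by
  the face. Both sides agree on boxes.
\<close>

lemma face_measure_eq:
  "face_measure J = distr (density (\<Pi>\<^sub>M i\<in>- J. lborel)
       (indicator (PiE (- J) (\<lambda>i. {- real \<rho>..of_int (c i)})))) coord_space
     (\<lambda>x i. if i \<in> J then of_int (c i) else x i)"
  (is "_ = distr (density ?P (indicator ?C)) _ ?m")
proof -
  interpret L: product_sigma_finite "\<lambda>_. lborel :: real measure" by (rule product_sigma_finite_lborel)
  interpret product_sigma_finite "\<lambda>i. if i \<in> J then end_coord i else ray_coord i"
    by (rule product_sigma_finite_bounded[OF bounded_face_measure])
  have m: "?m \<in> measurable ?P coord_space" by (rule fix_coordinates_measurable)
  then have m': "?m \<in> measurable (density ?P (indicator ?C)) coord_space" by simp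
  have C: "?C \<in> sets ?P" by (intro sets_PiM_I_finite) auto
  show ?thesis unfolding face_measure_def
  proof (rule PiM_eqI[symmetric])
    show "sets (distr (density ?P (indicator ?C)) coord_space ?m)
        = sets (\<Pi>\<^sub>M i\<in>UNIV. if i \<in> J then end_coord i else ray_coord i)"
      using sets_PiM_bounded[of "\<lambda>i. if i \<in> J then end_coord i else ray_coord i" UNIV, OF bounded_face_measure] by simp
    fix A assume A: "\<And>i. i \<in> UNIV \<Longrightarrow> A i \<in> sets (if i \<in> J then end_coord i else ray_coord i)"
    have A: "A i \<in> sets borel" for i
      using A[of i] bounded_coord_sets[OF bounded_face_measure[of i J]] by auto
    have AU: "PiE UNIV A \<in> sets coord_space" using A by (intro sets_PiM_I_finite) auto
    have "emeasure (distr (density ?P (indicator ?C)) coord_space ?m) (PiE UNIV A)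
        = emeasure ?P (?C \<inter> (?m -` PiE UNIV A \<inter> space ?P))"
    proof -
      have "?m -` PiE UNIV A \<inter> space ?P \<in> sets ?P" by (rule measurable_sets[OF m AU])
      then show ?thesis using C
        by (subst emeasure_distr[OF m' AU]) (simp add: emeasure_density flip: indicator_inter_arith)
    qed
    also have "?C \<inter> (?m -` PiE UNIV A \<inter> space ?P) =
        (if \<forall>i\<in>J. of_int (c i) \<in> A i then PiE (- J) (\<lambda>i. {- real \<rho>..of_int (c i)} \<inter> A i) else {})"
    proof -
      have "(\<forall>i. (if i \<in> J then of_int (c i) else x i) \<in> A i)
          \<longleftrightarrow> (\<forall>i\<in>J. of_int (c i) \<in> A i) \<and> (\<forall>i\<in>- J. x i \<in> A i)" for x :: "'n \<Rightarrow> real"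
      proof -
        have "(if i \<in> J then of_int (c i) else x i) \<in> A i
            \<longleftrightarrow> (i \<in> J \<longrightarrow> of_int (c i) \<in> A i) \<and> (i \<in> - J \<longrightarrow> x i \<in> A i)" for i by simp
        then show ?thesis by blast
      qed
      then show ?thesis by (auto simp: space_PiM PiE_iff)
    qed
    also have "emeasure ?P \<dots> = (\<Prod>i\<in>J. indicator (A i) (of_int (c i) :: real)) *
        (\<Prod>i\<in>- J. emeasure lborel ({- real \<rho>..of_int (c i)} \<inter> A i))"
    proof (cases "\<forall>i\<in>J. of_int (c i) \<in> A i")
      case True
      then have "(\<Prod>i\<in>J. indicator (A i) (of_int (c i) :: real)) = (1 :: ennreal)" by (intro prod.neutral) auto
      then show ?thesis using True A by (simp add: L.emeasure_PiM)
    next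
      case False
      then have "(\<Prod>i\<in>J. indicator (A i) (of_int (c i) :: real)) = (0 :: ennreal)"
        by (intro prod_zero) (auto simp: indicator_eq_0_iff)
      then show ?thesis unfolding if_not_P[OF False] by simp
    qed
    also have "\<dots> = (\<Prod>i\<in>UNIV. emeasure (if i \<in> J then end_coord i else ray_coord i) (A i))"
    proof -
      have "(\<Prod>i\<in>UNIV. emeasure (if i \<in> J then end_coord i else ray_coord i) (A i))
          = (\<Prod>i\<in>J. emeasure (if i \<in> J then end_coord i else ray_coord i) (A i)) *
            (\<Prod>i\<in>- J. emeasure (if i \<in> J then end_coord i else ray_coord i) (A i))"
        by (subst prod.union_disjoint[symmetric]) auto
      then show ?thesis using A by (simp add: emeasure_end_coord emeasure_ray_coord)
    qed
    finally show "emeasure (distr (density ?P (indicator ?C)) coord_space ?m) (PiE UNIV A)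
        = (\<Prod>i\<in>UNIV. emeasure (if i \<in> J then end_coord i else ray_coord i) (A i))" .
  qed simp
qed

lemma face_integral_coord_integral:
  assumes g: "supported g"
  shows "face_integral (coordinate_face u c J) g / parallelotope_volume (v ` (- J)) = coord_integral J g"
proof -
  let ?F = "coordinate_face u c J"
  let ?m = "\<lambda>x i. if i \<in> J then of_int (c i) else x i"
  let ?C = "PiE (- J) (\<lambda>i. {- real \<rho>..of_int (c i)})"
  let ?P = "\<Pi>\<^sub>M i\<in>- J. lborel :: real measure"
  have gm: "g \<in> borel_measurable borel"
    using g by (auto simp: supported_def intro: borel_measurable_continuous_onI)
  have F: "?F \<in> sets borel" by (rule borel_closed[OF closed_coordinate_face])
  define p0 where "p0 = point (?m (\<lambda>_. 0))"
  have p0: "p0 - point (\<lambda>i. of_int (c i)) \<in> span (v ` (- J))"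
    by (auto simp: in_span_v_iff p0_def inner_diff_right)
  have pt: "p0 + (\<Sum>i\<in>- J. t i *\<^sub>R v i) = point (?m t)" for t
  proof -
    have "u i \<bullet> (p0 + (\<Sum>i\<in>- J. t i *\<^sub>R v i)) = u i \<bullet> point (?m t)" for i
      by (auto simp: inner_right_distrib p0_def inner_sum_right u_v mult_delta_right)
    then have "point (\<lambda>i. u i \<bullet> (p0 + (\<Sum>i\<in>- J. t i *\<^sub>R v i))) = point (\<lambda>i. u i \<bullet> point (?m t))"
      by (simp only:)
    then show ?thesis by (simp only: point_u)
  qed
  have m: "?m \<in> measurable ?P coord_space" by (rule fix_coordinates_measurable)
  have C: "?C \<in> sets ?P" by (intro sets_PiM_I_finite) auto
  have gp: "(\<lambda>y. g (point y)) \<in> borel_measurable coord_space"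
    using supported_bounded_measurable[OF g] by (simp add: bounded_measurable_def)
  have Fm: "(\<lambda>x. indicator ?F (p0 + x) * g (p0 + x)) \<in> borel_measurable borel"
    using F gm by measurable
  have "face_integral ?F g / parallelotope_volume (v ` (- J))
      = (\<integral>x. indicator ?F (p0 + x) * g (p0 + x) \<partial>span_measure (- J) v)"
    by (rule face_integral_lattice_coordinates[OF dual_family_v direction_space_coordinate_face F
          vertex_in_coordinate_face p0 gm])
  also have "\<dots> = (\<integral>t. indicator ?F (point (?m t)) * g (point (?m t)) \<partial>?P)"
    unfolding span_measure_def using Fm combination_measurable[where I = "- J" and w = v]
    by (subst integral_distr) (auto simp: pt)
  also have "\<dots> = (\<integral>t. indicator ?C t * g (point (?m t)) \<partial>?P)"
  proof (rule Bochner_Integration.integral_cong[OF refl])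
    fix t assume t: "t \<in> space ?P"
    show "indicator ?F (point (?m t)) * g (point (?m t)) = indicator ?C t * g (point (?m t))"
    proof (cases "\<exists>i\<in>- J. t i < - real \<rho>")
      case True
      then obtain i where "\<bar>u i \<bullet> point (?m t)\<bar> \<ge> real \<rho>" by force
      then have "g (point (?m t)) = 0" using g unfolding supported_def by blast
      then show ?thesis by simp
    next
      case False
      then have "point (?m t) \<in> ?F \<longleftrightarrow> t \<in> ?C"
        using t by (auto simp: point_in_coordinate_face space_PiM PiE_iff not_less)
      then show ?thesis by (simp add: indicator_def)
    qed
  qed
  also have "\<dots> = (\<integral>t. g (point (?m t)) \<partial>density ?P (indicator ?C))"
  proof -
    have "(\<lambda>t. g (point (?m t))) \<in> borel_measurable ?P" using measurable_compose[OF m gp] .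
    then have "(\<integral>t. g (point (?m t)) \<partial>density ?P (\<lambda>t. ennreal (indicator ?C t)))
        = (\<integral>t. indicator ?C t *\<^sub>R g (point (?m t)) \<partial>?P)"
      using C by (intro integral_density) auto
    moreover have "(\<lambda>t. ennreal (indicator ?C t)) = indicator ?C"
      by (simp add: fun_eq_iff ennreal_indicator)
    ultimately show ?thesis by simp
  qed
  also have "\<dots> = (\<integral>y. g (point y) \<partial>face_measure J)"
    unfolding face_measure_eq using m by (subst integral_distr[OF _ gp]) simp_all
  finally show ?thesis by (simp add: coord_integral_def)
qed

lemma wedge_coefficient_eq:
  assumes "smooth f" "supported f"
  shows "wedge_const v \<alpha> * face_integral (wedge_face u c \<alpha>)
      (differential f (multi_tuple v (\<lambda>i. \<alpha> i - supp_index \<alpha> i))) = coord_coefficient f \<alpha>"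
proof -
  have "{i. \<alpha> i = 0} = - {i. \<alpha> i > 0}" by auto
  moreover have "(\<Prod>i\<in>UNIV. bern (\<alpha> i) / fact (\<alpha> i)) = 1 / (\<Prod>i\<in>UNIV. fact (\<alpha> i)) * (\<Prod>i\<in>UNIV. bern (\<alpha> i))"
    by (simp add: prod_dividef)
  ultimately show ?thesis
    unfolding wedge_const_def wedge_jacobian_def coord_coefficient_def wedge_face_eq
    by (simp add: face_integral_coord_integral[OF supported_differential[OF assms], symmetric])
qed

lemma wedge_expansion:
  assumes "regular_integer_wedge u" "smooth f" "supported f"
  shows "asymptotic_expansion (riemann_sum f (wedge u c))
    (\<lambda>q. \<Sum>\<alpha>\<in>{\<alpha>. (\<Sum>i\<in>UNIV. \<alpha> i) = q}. coord_coefficient f \<alpha>)"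
  using coordinate_expansion[OF assms(2,3)]
    asymptotic_expansion_cong[OF riemann_sum_eq_integral[OF assms(1,3)]] by simp

lemma lattice_of_v:
  assumes "regular_integer_wedge u"
  shows "lattice_of I v = span (v ` I) \<inter> int_vecs"
proof
  show "lattice_of I v \<subseteq> span (v ` I) \<inter> int_vecs"
    using lattice_of_span[of I v] dual_basis_int_vecs[OF assms dual]
    by (auto simp: lattice_of_def intro!: int_vecs_sum int_vecs_scale)
  show "span (v ` I) \<inter> int_vecs \<subseteq> lattice_of I v"
  proof
    fix x assume x: "x \<in> span (v ` I) \<inter> int_vecs"
    then obtain s where s: "x = (\<Sum>i\<in>I. s i *\<^sub>R v i)" using span_image_combination[of I x v] by auto
    have "s i \<in> \<int>" if "i \<in> I" for i
    proof -
      have "u i \<bullet> x = s i" unfolding s by (rule dual_family_coordinate[OF dual_family_v that])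
      moreover have "u i \<bullet> x \<in> \<int>" using x int_vecs_iff_coordinates[OF assms dual] by blast
      ultimately show ?thesis by simp
    qed
    then have "x = (\<Sum>i\<in>I. of_int \<lfloor>s i\<rfloor> *\<^sub>R v i)" unfolding s by (intro sum.cong) auto
    then show "x \<in> lattice_of I v"
      unfolding lattice_of_def by (rule range_eqI[of _ _ "\<lambda>i. \<lfloor>s i\<rfloor>"])
  qed
qed

text \<open>
  The standard basis and the \<open>v\<^sub>i\<close> generate the same lattice, so the coordinate measure on the whole
  space is Lebesgue measure.
\<close>

lemma coord_integral_empty:
  assumes r: "regular_integer_wedge u" and g: "supported g"
  shows "coord_integral {} g = (LINT x:wedge u c|lborel. g x)"
proof -
  have d: "dual_family Basis (\<lambda>b. b) (\<lambda>b :: real ^ 'n. b)"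
    by (auto simp: dual_family_def inner_Basis)
  have "lattice_of Basis (\<lambda>b. b) = (int_vecs :: (real ^ 'n) set)"
  proof
    have "b \<in> int_vecs" if "b \<in> Basis" for b :: "real ^ 'n"
      using that by (auto simp: Basis_vec_def axis_int_vecs)
    then show "lattice_of Basis (\<lambda>b. b) \<subseteq> (int_vecs :: (real ^ 'n) set)"
      by (auto simp: lattice_of_def intro!: int_vecs_sum int_vecs_scale)
    show "(int_vecs :: (real ^ 'n) set) \<subseteq> lattice_of Basis (\<lambda>b. b)"
    proof
      fix x :: "real ^ 'n" assume x: "x \<in> int_vecs"
      have "x \<bullet> b \<in> \<int>" if "b \<in> Basis" for b using x \<open>\<And>b. b \<in> Basis \<Longrightarrow> b \<in> int_vecs\<close>[OF that] by (rule int_vecs_inner)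
      then have "x = (\<Sum>b\<in>Basis. of_int \<lfloor>x \<bullet> b\<rfloor> *\<^sub>R b)"
        by (subst euclidean_representation[symmetric]) (auto intro!: sum.cong)
      then show "x \<in> lattice_of Basis (\<lambda>b. b)"
        unfolding lattice_of_def by (rule range_eqI[of _ _ "\<lambda>b. \<lfloor>x \<bullet> b\<rfloor>"])
    qed
  qed
  moreover have "lattice_of UNIV v = int_vecs"
  proof -
    have "span (range v) = UNIV" using in_span_v_iff[of _ UNIV] by auto
    then show ?thesis using lattice_of_v[OF r, of UNIV] by simp
  qed
  ultimately have eq: "span_measure UNIV v = lborel"
    using span_measure_lattice_eq(1)[OF dual_family_v d, of UNIV] by (simp add: span_measure_def lborel_eq[symmetric])
  have gm: "g \<in> borel_measurable borel"
    using g by (auto simp: supported_def intro: borel_measurable_continuous_onI)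
  have F: "coordinate_face u c {} = wedge u c" by (simp add: coordinate_face_def)
  have "face_integral (coordinate_face u c {}) g / parallelotope_volume (v ` UNIV)
      = (\<integral>x. indicator (coordinate_face u c {}) (0 + x) * g (0 + x) \<partial>span_measure UNIV v)"
    by (rule face_integral_lattice_coordinates[OF dual_family_v _ _ vertex_in_coordinate_face _ gm])
      (auto simp: direction_space_coordinate_face closed_coordinate_face in_span_v_iff)
  then show ?thesis
    using face_integral_coord_integral[OF g, of "{}"] unfolding eq F set_lebesgue_integral_def by simp
qed

end

lemma wedge_coordinates_exists:
  fixes u v :: "'n::finite \<Rightarrow> real ^ 'n"
  assumes "dual_basis u v" "continuous_on UNIV f" "compact (closure {x. f x \<noteq> 0})"
  obtains \<rho> where "wedge_coordinates u v c \<rho>" "wedge_coordinates.supported u \<rho> f"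
proof -
  have "bounded {x. f x \<noteq> 0}"
    using assms(3) compact_imp_bounded bounded_subset closure_subset by metis
  then obtain r where r: "\<And>x. f x \<noteq> 0 \<Longrightarrow> norm x \<le> r" by (auto simp: bounded_iff)
  define m where "m = (\<Sum>i\<in>UNIV. norm (u i) * \<bar>r\<bar> + of_int \<bar>c i\<bar>)"
  define \<rho> where "\<rho> = nat \<lfloor>m\<rfloor> + 1"
  have m: "norm (u i) * \<bar>r\<bar> + of_int \<bar>c i\<bar> \<le> m" for i
    unfolding m_def by (rule member_le_sum) auto
  have \<rho>: "m < real \<rho>" unfolding \<rho>_def by linarith
  have cb: "\<bar>c i\<bar> \<le> int \<rho>" for i
  proof -
    have "0 \<le> norm (u i) * \<bar>r\<bar>" by simp
    then have "of_int \<bar>c i\<bar> < real \<rho>" using m[of i] \<rho> by linarith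
    then show ?thesis by linarith
  qed
  interpret wedge_coordinates u v c \<rho>
    by unfold_locales (use assms(1) cb in auto)
  have "supported f"
    unfolding supported_def
  proof (intro conjI allI impI)
    fix x i assume x: "real \<rho> \<le> \<bar>u i \<bullet> x\<bar>"
    show "f x = 0"
    proof (rule ccontr)
      assume "f x \<noteq> 0"
      then have "norm x \<le> \<bar>r\<bar>" using r by force
      then have "\<bar>u i \<bullet> x\<bar> \<le> norm (u i) * \<bar>r\<bar>"
        using Cauchy_Schwarz_ineq2[of "u i" x] mult_left_mono[of "norm x" "\<bar>r\<bar>" "norm (u i)"] by simp
      moreover have "(0 :: real) \<le> of_int \<bar>c i\<bar>" by simp
      ultimately show False using m[of i] \<rho> x by linarith
    qed
  qed (rule assms(2))
  then show ?thesis using that wedge_coordinates_axioms by blast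
qed

theorem wedge_asymptotics:
  fixes u v :: "'n::finite \<Rightarrow> real ^ 'n"
  assumes "regular_integer_wedge u" "dual_basis u v" "smooth_compact_support f"
  shows "asymptotic_expansion (riemann_sum f (wedge u c))
     (\<lambda>q. \<Sum>\<alpha> \<in> {\<alpha> :: 'n \<Rightarrow> nat. (\<Sum>i\<in>UNIV. \<alpha> i) = q}.
        wedge_const v \<alpha> * face_integral (wedge_face u c \<alpha>)
          (differential f (multi_tuple v (\<lambda>i. \<alpha> i - supp_index \<alpha> i))))"
proof -
  have f: "smooth f" "compact (closure {x. f x \<noteq> 0})"
    using assms(3) by (auto simp: smooth_compact_support_def smooth_def)
  obtain \<rho> where "wedge_coordinates u v c \<rho>" and s: "wedge_coordinates.supported u \<rho> f"
    using wedge_coordinates_exists[OF assms(2) smooth_continuous[OF f(1)] f(2)] by blast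
  interpret wedge_coordinates u v c \<rho> by fact
  show ?thesis
    using wedge_expansion[OF assms(1) f(1) s] unfolding wedge_coefficient_eq[OF f(1) s] .
qed

section \<open>Constant-coefficient operators\<close>

text \<open>
  A finite linear combination of iterated directional derivatives of order \<open>k\<close> along vectors of \<open>S\<close>.
\<close>

definition constant_coefficient_operator ::
  "nat \<Rightarrow> 'a set \<Rightarrow> (('a::euclidean_space \<Rightarrow> real) \<Rightarrow> 'a \<Rightarrow> real) \<Rightarrow> bool" where
  "constant_coefficient_operator k S P \<longleftrightarrow> (\<exists>T coef. finite T \<and> (\<forall>as\<in>T. length as = k \<and> set as \<subseteq> S) \<and>
     P = (\<lambda>f x. \<Sum>as\<in>T. coef as * differential f as x))"

lemma cco_zero: "constant_coefficient_operator k S (\<lambda>f x. 0)"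
  unfolding constant_coefficient_operator_def by (intro exI[of _ "{}"]) auto

lemma cco_differential:
  "length as = k \<Longrightarrow> set as \<subseteq> S \<Longrightarrow> constant_coefficient_operator k S (\<lambda>f. differential f as)"
  unfolding constant_coefficient_operator_def by (intro exI[of _ "{as}"] exI[of _ "\<lambda>_. 1"]) auto

lemma cco_scale:
  assumes "constant_coefficient_operator k S P"
  shows "constant_coefficient_operator k S (\<lambda>f x. a * P f x)"
proof -
  obtain T coef where T: "finite T" "\<forall>as\<in>T. length as = k \<and> set as \<subseteq> S"
    "P = (\<lambda>f x. \<Sum>as\<in>T. coef as * differential f as x)"
    using assms by (auto simp: constant_coefficient_operator_def)
  then show ?thesis unfolding constant_coefficient_operator_def
    by (intro exI[of _ T] exI[of _ "\<lambda>as. a * coef as"]) (auto simp: sum_distrib_left mult.assoc)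
qed

lemma cco_add:
  assumes "constant_coefficient_operator k S P" "constant_coefficient_operator k S P'"
  shows "constant_coefficient_operator k S (\<lambda>f x. P f x + P' f x)"
proof -
  obtain T coef where T: "finite T" "\<forall>as\<in>T. length as = k \<and> set as \<subseteq> S"
    "P = (\<lambda>f x. \<Sum>as\<in>T. coef as * differential f as x)"
    using assms(1) by (auto simp: constant_coefficient_operator_def)
  obtain T' coef' where T': "finite T'" "\<forall>as\<in>T'. length as = k \<and> set as \<subseteq> S"
    "P' = (\<lambda>f x. \<Sum>as\<in>T'. coef' as * differential f as x)"
    using assms(2) by (auto simp: constant_coefficient_operator_def)
  define cf where "cf as = (if as \<in> T then coef as else 0) + (if as \<in> T' then coef' as else 0)" for as
  have "P f x = (\<Sum>as\<in>T \<union> T'. (if as \<in> T then coef as else 0) * differential f as x)"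
    "P' f x = (\<Sum>as\<in>T \<union> T'. (if as \<in> T' then coef' as else 0) * differential f as x)" for f x
    unfolding T(3) T'(3) using T(1) T'(1) by (intro sum.mono_neutral_cong_left; auto)+
  then have "(\<lambda>f x. P f x + P' f x) = (\<lambda>f x. \<Sum>as\<in>T \<union> T'. cf as * differential f as x)"
    by (simp add: cf_def distrib_right sum.distrib fun_eq_iff)
  then show ?thesis unfolding constant_coefficient_operator_def
    using T(1,2) T'(1,2) by (intro exI[of _ "T \<union> T'"] exI[of _ cf]) auto
qed

lemma cco_sum:
  "(\<And>i. i \<in> I \<Longrightarrow> constant_coefficient_operator k S (P i)) \<Longrightarrow>
    constant_coefficient_operator k S (\<lambda>f x. \<Sum>i\<in>I. P i f x)"
  by (induction I rule: infinite_finite_induct) (auto intro: cco_zero cco_add)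

lemma cco_linear:
  assumes "constant_coefficient_operator k S P" "finite I" "\<And>i. i \<in> I \<Longrightarrow> smooth (f i)"
  shows "P (\<lambda>x. \<Sum>i\<in>I. f i x) y = (\<Sum>i\<in>I. P (f i) y)"
proof -
  obtain T coef where T: "P = (\<lambda>f x. \<Sum>as\<in>T. coef as * differential f as x)"
    using assms(1) by (auto simp: constant_coefficient_operator_def)
  have "differential (\<lambda>x. \<Sum>i\<in>I. f i x) as = (\<lambda>x. \<Sum>i\<in>I. differential (f i) as x)" for as
    by (intro differential_sum assms)
  then show ?thesis unfolding T by (simp add: sum_distrib_left) (rule sum.swap)
qed

lemma cco_local:
  assumes "constant_coefficient_operator k S P" "open A" "\<And>x. x \<in> A \<Longrightarrow> f x = g x" "smooth f" "x \<in> A"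
  shows "P f x = P g x"
proof -
  obtain T coef where T: "P = (\<lambda>f x. \<Sum>as\<in>T. coef as * differential f as x)"
    using assms(1) by (auto simp: constant_coefficient_operator_def)
  show ?thesis unfolding T using differential_local[OF assms(2-5)] by simp
qed

lemma cco_zero_on_closure:
  assumes "constant_coefficient_operator k S P" "open A" "\<And>x. x \<in> A \<Longrightarrow> f x = 0" "smooth f" "x \<in> closure A"
  shows "P f x = 0"
proof -
  obtain T coef where T: "P = (\<lambda>f x. \<Sum>as\<in>T. coef as * differential f as x)"
    using assms(1) by (auto simp: constant_coefficient_operator_def)
  show ?thesis unfolding T using differential_zero_on_closure[OF assms(2-5)] by simp
qed

lemma cco_continuous:
  assumes "constant_coefficient_operator k S P" "smooth f"
  shows "continuous_on A (P f)"
proof -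
  obtain T coef where T: "P = (\<lambda>f x. \<Sum>as\<in>T. coef as * differential f as x)"
    using assms(1) by (auto simp: constant_coefficient_operator_def)
  show ?thesis unfolding T
    by (intro continuous_intros smooth_continuous smooth_differential assms)
qed

section \<open>Moving tangential derivatives to smaller faces\<close>

text \<open>
  The orthogonal projection to the span of \<open>J\<close>. Defined through the inner products with \<open>J\<close>, it
  is evidently determined by them (\<open>normal_part_cong\<close>).
\<close>

definition normal_part :: "'a::euclidean_space set \<Rightarrow> 'a \<Rightarrow> 'a" where
  "normal_part J a = (SOME y. y \<in> span J \<and> (\<forall>w\<in>J. w \<bullet> (a - y) = 0))"

lemma normal_part: "normal_part J a \<in> span J" "w \<in> J \<Longrightarrow> w \<bullet> (a - normal_part J a) = 0"
proof -
  obtain y z where "y \<in> span J" "\<And>w. w \<in> span J \<Longrightarrow> orthogonal z w" "a = y + z"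
    using orthogonal_subspace_decomp_exists[of J a] by metis
  then have "y \<in> span J \<and> (\<forall>w\<in>J. w \<bullet> (a - y) = 0)"
    by (auto simp: orthogonal_def inner_commute span_base)
  from someI[of "\<lambda>y. y \<in> span J \<and> (\<forall>w\<in>J. w \<bullet> (a - y) = 0)", OF this]
  show "normal_part J a \<in> span J" "w \<in> J \<Longrightarrow> w \<bullet> (a - normal_part J a) = 0"
    unfolding normal_part_def by blast+
qed

lemma normal_part_cong: "(\<And>w. w \<in> J \<Longrightarrow> w \<bullet> a = w \<bullet> b) \<Longrightarrow> normal_part J a = normal_part J b"
  unfolding normal_part_def by (simp add: inner_diff_right cong: ball_cong)

text \<open>
  \<open>J\<close> is the set of normals of the face presently integrated over, \<open>ds\<close> are directions already
  normal to it, \<open>as\<close> those still to be treated. The head \<open>a\<close> of the latter either contributes its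
  normal part or, through its tangential part, leads to a smaller face, which has one more
  normal \<open>w\<close>; there all directions have to be treated again. The value is the operator that
  arrives at the face with the set of normals \<open>U\<close>.
\<close>

function reduce :: "'a::euclidean_space set \<Rightarrow> 'a set \<Rightarrow> 'a list \<Rightarrow> 'a list \<Rightarrow> ('a \<Rightarrow> real) \<Rightarrow> 'a \<Rightarrow> real" where
  "reduce U J ds [] f x = (if J = U then differential f ds x else 0)"
| "reduce U J ds (a # as) f x = reduce U J (normal_part J a # ds) as f x +
     (\<Sum>w\<in>U - J. (w \<bullet> (a - normal_part J a)) * reduce U (insert w J) [] (as @ ds) f x)"
  by pat_completeness auto
termination
  by (relation "measures [\<lambda>(U, J, ds, as, f, x). length ds + length as, \<lambda>(U, J, ds, as, f, x). length as]") auto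

lemma reduce_not_subset: "\<not> J \<subseteq> U \<Longrightarrow> reduce U J ds as f x = 0"
  by (induction U J ds as f x rule: reduce.induct) auto

text \<open>
  Every step to a smaller face uses up one derivative.
\<close>

lemma reduce_too_short:
  "finite U \<Longrightarrow> J \<subseteq> U \<Longrightarrow> length ds + length as + card J < card U \<Longrightarrow> reduce U J ds as f x = 0"
proof (induction U J ds as f x rule: reduce.induct)
  case (2 U J ds a as f x)
  have "reduce U (insert w J) [] (as @ ds) f x = 0" if "w \<in> U - J" for w
    using that 2 finite_subset[of J U] by (intro "2.IH"(2)) auto
  then show ?case using 2 by simp
qed auto

text \<open>
  Each step to a smaller face removes one derivative and adds one normal, which keeps the sum in
  the last assumption constant.
\<close>

lemma reduce_cco:
  assumes "finite U" "J \<subseteq> U" "set ds \<subseteq> span U" "k + card U = length ds + length as + card J"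
  shows "constant_coefficient_operator k (span U) (reduce U J ds as)"
proof -
  have "constant_coefficient_operator k (span U) (reduce U J ds as)"
    if "J \<subseteq> U" "set ds \<subseteq> span U" "k + card U = length ds + length as + card J"
    for J ds as and f :: "'a \<Rightarrow> real" and x :: 'a
    using assms(1) that
  proof (induction U J ds as f x rule: reduce.induct)
    case (1 U J ds f x)
    have "reduce U J ds [] = (if J = U then \<lambda>f. differential f ds else (\<lambda>f x. 0))"
      by (auto simp: fun_eq_iff)
    then show ?case using 1 by (auto intro: cco_zero cco_differential)
  next
    case (2 U J ds a as f x)
    have "normal_part J a \<in> span U"
      using normal_part(1) span_mono[OF "2.prems"(2)] by blast
    then have c1: "constant_coefficient_operator k (span U) (reduce U J (normal_part J a # ds) as)"
      using 2 by (intro "2.IH"(1)) auto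
    have c2: "constant_coefficient_operator k (span U) (reduce U (insert w J) [] (as @ ds))" if "w \<in> U - J" for w
      using that 2 finite_subset[of J U] by (intro "2.IH"(2)) auto
    have "reduce U J ds (a # as) = (\<lambda>f x. reduce U J (normal_part J a # ds) as f x +
     (\<Sum>w\<in>U - J. (w \<bullet> (a - normal_part J a)) * reduce U (insert w J) [] (as @ ds) f x))"
      by (simp add: fun_eq_iff)
    then show ?case using c1 c2 by (auto intro!: cco_add cco_sum cco_scale)
  qed
  then show ?thesis using assms by blast
qed

text \<open>
  All that enters the computation of the operator on the face with normals \<open>U\<close> are projections to
  spans of subsets of \<open>U\<close> and inner products with elements of \<open>U\<close>.
\<close>

lemma reduce_cong:
  assumes "J \<subseteq> U" "list_all2 (\<lambda>a b. \<forall>w\<in>U. w \<bullet> a = w \<bullet> b) as bs"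
  shows "reduce U J ds as f x = reduce U J ds bs f x"
  using assms
proof (induction U J ds as f x arbitrary: bs rule: reduce.induct)
  case (2 U J ds a as f x)
  then obtain b cs where bs: "bs = b # cs" and ab: "\<forall>w\<in>U. w \<bullet> a = w \<bullet> b"
    and cs: "list_all2 (\<lambda>a b. \<forall>w\<in>U. w \<bullet> a = w \<bullet> b) as cs"
    by (auto simp: list_all2_Cons1)
  have np: "normal_part J a = normal_part J b"
    using ab "2.prems"(1) by (intro normal_part_cong) auto
  have "reduce U (insert w J) [] (as @ ds) f x = reduce U (insert w J) [] (cs @ ds) f x" if "w \<in> U - J" for w
    using that "2.prems"(1) cs by (intro "2.IH"(2)) (auto intro!: list_all2_appendI list_all2_refl)
  moreover have "w \<bullet> (a - normal_part J b) = w \<bullet> (b - normal_part J b)" if "w \<in> U - J" for w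
    using ab that by (simp add: inner_diff_right)
  ultimately show ?case
    unfolding bs using "2.IH"(1)[OF "2.prems"(1) cs] by (auto simp: np intro!: sum.cong)
qed auto

context wedge_coordinates begin

lemma supported_zero: "supported (\<lambda>x. 0)"
  and supported_add: "supported f \<Longrightarrow> supported g \<Longrightarrow> supported (\<lambda>x. f x + g x)"
  and supported_scale: "supported f \<Longrightarrow> supported (\<lambda>x. a * f x)"
  unfolding supported_def by (auto intro!: continuous_intros)

lemma supported_sum: "(\<And>i. i \<in> I \<Longrightarrow> supported (f i)) \<Longrightarrow> supported (\<lambda>x. \<Sum>i\<in>I. f i x)"
  by (induction I rule: infinite_finite_induct) (auto intro: supported_zero supported_add)

lemma supported_cco:
  assumes "constant_coefficient_operator k S P" "smooth f" "supported f"
  shows "supported (P f)"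
proof -
  obtain T coef where T: "P = (\<lambda>f x. \<Sum>as\<in>T. coef as * differential f as x)"
    using assms(1) by (auto simp: constant_coefficient_operator_def)
  show ?thesis unfolding T
    by (intro supported_sum supported_scale supported_differential assms)
qed

lemma supported_reduce:
  assumes "smooth f" "supported f"
  shows "supported (reduce U J ds as f)"
proof -
  have "supported (reduce U J ds as f)" for x :: "real ^ 'n"
    using assms
  proof (induction U J ds as f x rule: reduce.induct)
    case (1 U J ds f x)
    have "reduce U J ds [] f = (if J = U then differential f ds else (\<lambda>x. 0))"
      by (auto simp: fun_eq_iff)
    then show ?case using 1 by (auto intro: supported_zero supported_differential)
  next
    case (2 U J ds a as f x)
    have "reduce U J ds (a # as) f = (\<lambda>x. reduce U J (normal_part J a # ds) as f x +
     (\<Sum>w\<in>U - J. (w \<bullet> (a - normal_part J a)) * reduce U (insert w J) [] (as @ ds) f x))"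
      by (simp add: fun_eq_iff)
    then show ?case using 2 by (auto intro!: supported_add supported_sum supported_scale)
  qed
  then show ?thesis .
qed

lemma inj_u: "inj u"
proof (rule injI)
  fix i j assume "u i = u j"
  then have "u i \<bullet> v i = u j \<bullet> v i" by simp
  then show "i = j" by (auto simp: u_v split: if_splits)
qed

lemma differential_tangential:
  assumes f: "smooth f" and b: "\<And>i. i \<in> J \<Longrightarrow> u i \<bullet> b = 0"
  shows "differential f (b # as) x = (\<Sum>j\<in>- J. (u j \<bullet> b) * differential f (v j # as) x)"
proof -
  interpret linear "\<lambda>a. differential f (a # as) x" by (rule differential_linear[OF f])
  have "b = (\<Sum>j\<in>UNIV. (u j \<bullet> b) *\<^sub>R v j)" by (simp add: dual_basis_expand[OF dual])
  also have "\<dots> = (\<Sum>j\<in>- J. (u j \<bullet> b) *\<^sub>R v j)"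
    using b by (intro sum.mono_neutral_right) auto
  finally have "differential f (b # as) x = differential f ((\<Sum>j\<in>- J. (u j \<bullet> b) *\<^sub>R v j) # as) x" by simp
  then show ?thesis using sum[of "\<lambda>j. (u j \<bullet> b) *\<^sub>R v j" "- J"] scale by simp
qed

text \<open>
  One step of \<open>reduce\<close> is integration by parts applied to the tangential part of a direction. The
  sum over all faces collects what arrives at each of them.
\<close>

lemma coord_integral_reduce:
  assumes "smooth f" "supported f"
  shows "coord_integral J (differential f (ds @ as))
    = (\<Sum>J'\<in>UNIV. coord_integral J' (reduce (u ` J') (u ` J) ds as f))"
proof -
  have "coord_integral J (differential f (ds @ as))
    = (\<Sum>J'\<in>UNIV. coord_integral J' (reduce (u ` J') (u ` J) ds as f))"
    if "I = u ` J" "U = range u" for U I ds as J and x :: "real ^ 'n"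
    using that assms
  proof (induction U I ds as f x arbitrary: J rule: reduce.induct)
    case (1 U I ds f x)
    have "coord_integral J' (reduce (u ` J') (u ` J) ds [] f)
        = (if J' = J then coord_integral J (differential f ds) else 0)" for J'
    proof -
      have "u ` J = u ` J' \<longleftrightarrow> J' = J" using inj_image_eq_iff[OF inj_u] by blast
      then have "reduce (u ` J') (u ` J) ds [] f = (if J' = J then differential f ds else (\<lambda>_. 0))"
        by (auto simp: fun_eq_iff)
      then show ?thesis by (simp add: coord_integral_def)
    qed
    then show ?case by (simp del: reduce.simps)
  next
    case (2 U I ds a as f x)
    note f = "2.prems"(3,4)
    define p where "p = normal_part (u ` J) a"
    define b where "b = a - p"
    have b0: "u i \<bullet> b = 0" if "i \<in> J" for i
      unfolding b_def p_def using that by (intro normal_part(2)) auto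
    have "coord_integral J (differential f (ds @ a # as))
        = coord_integral J (\<lambda>y. differential f ((p # ds) @ as) y + (\<Sum>j\<in>- J. (u j \<bullet> b) * differential f (v j # as @ ds) y))"
    proof -
      have "differential f (ds @ a # as) y
          = differential f ((p # ds) @ as) y + (\<Sum>j\<in>- J. (u j \<bullet> b) * differential f (v j # as @ ds) y)" for y
      proof -
        have "differential f (ds @ a # as) y = differential f ((p + b) # ds @ as) y"
          using differential_perm[OF f(1), of "ds @ a # as" "a # ds @ as"] by (simp add: b_def del: differential.simps)
        also have "\<dots> = differential f (p # ds @ as) y + differential f (b # ds @ as) y"
          by (rule linear_add[OF differential_linear[OF f(1)]])
        also have "differential f (b # ds @ as) = differential f (b # as @ ds)"
          by (rule differential_perm[OF f(1)]) simp
        finally show ?thesis using differential_tangential[OF f(1) b0, where as = "as @ ds" and x = y] by simp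
      qed
      then show ?thesis by presburger
    qed
    also have "\<dots> = coord_integral J (differential f ((p # ds) @ as))
        + (\<Sum>j\<in>- J. (u j \<bullet> b) * coord_integral J (differential f (v j # as @ ds)))"
      by (subst coord_integral_add)
        (simp_all add: coord_integral_sum coord_integral_scale supported_sum supported_scale
          supported_differential[OF f] del: differential.simps)
    also have "(\<Sum>j\<in>- J. (u j \<bullet> b) * coord_integral J (differential f (v j # as @ ds)))
        = (\<Sum>j\<in>- J. (u j \<bullet> b) * (\<Sum>J'\<in>UNIV. coord_integral J' (reduce (u ` J') (u ` insert j J) [] (as @ ds) f)))"
    proof (rule sum.cong[OF refl])
      fix j assume j: "j \<in> - J"
      have "u j \<in> U - I" using j 2 inj_u by (auto simp: inj_def)
      moreover have "insert (u j) I = u ` insert j J" using 2 by auto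
      ultimately have "coord_integral (insert j J) (differential f ([] @ as @ ds))
          = (\<Sum>J'\<in>UNIV. coord_integral J' (reduce (u ` J') (u ` insert j J) [] (as @ ds) f))"
        using "2.IH"(2)[of "u j" "insert j J"] "2.prems"(2) f by simp
      then show "(u j \<bullet> b) * coord_integral J (differential f (v j # as @ ds))
          = (u j \<bullet> b) * (\<Sum>J'\<in>UNIV. coord_integral J' (reduce (u ` J') (u ` insert j J) [] (as @ ds) f))"
        using coord_integral_by_parts[OF f, where j = j and J = J and as = "as @ ds"] j by simp
    qed
    also have "\<dots> = (\<Sum>J'\<in>UNIV. \<Sum>j\<in>- J. (u j \<bullet> b) * coord_integral J' (reduce (u ` J') (u ` insert j J) [] (as @ ds) f))"
      unfolding sum_distrib_left by (rule sum.swap)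
    also have "coord_integral J (differential f ((p # ds) @ as))
        = (\<Sum>J'\<in>UNIV. coord_integral J' (reduce (u ` J') (u ` J) (p # ds) as f))"
      using "2.IH"(1)[OF "2.prems"] by (simp add: p_def "2.prems"(1))
    also have "\<dots> + (\<Sum>J'\<in>UNIV. \<Sum>j\<in>- J. (u j \<bullet> b) * coord_integral J' (reduce (u ` J') (u ` insert j J) [] (as @ ds) f))
        = (\<Sum>J'\<in>UNIV. coord_integral J' (reduce (u ` J') (u ` J) ds (a # as) f))"
      unfolding sum.distrib[symmetric]
    proof (rule sum.cong[OF refl])
      fix J' :: "'n set"
      have r: "reduce (u ` J') (u ` J) ds (a # as) f = (\<lambda>y. reduce (u ` J') (u ` J) (p # ds) as f y +
          (\<Sum>j\<in>- J. (u j \<bullet> b) * reduce (u ` J') (u ` insert j J) [] (as @ ds) f y))"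
      proof
        fix y
        have "(\<Sum>w\<in>u ` J' - u ` J. (w \<bullet> b) * reduce (u ` J') (insert w (u ` J)) [] (as @ ds) f y)
            = (\<Sum>w\<in>u ` (J' - J). (w \<bullet> b) * reduce (u ` J') (insert w (u ` J)) [] (as @ ds) f y)"
          by (simp add: image_set_diff[OF inj_u])
        also have "\<dots> = (\<Sum>j\<in>J' - J. (u j \<bullet> b) * reduce (u ` J') (u ` insert j J) [] (as @ ds) f y)"
          by (subst sum.reindex) (auto intro: inj_on_subset[OF inj_u])
        also have "\<dots> = (\<Sum>j\<in>- J. (u j \<bullet> b) * reduce (u ` J') (u ` insert j J) [] (as @ ds) f y)"
        proof (rule sum.mono_neutral_left)
          show "\<forall>j\<in>- J - (J' - J). (u j \<bullet> b) * reduce (u ` J') (u ` insert j J) [] (as @ ds) f y = 0"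
            using inj_image_subset_iff[OF inj_u] by (auto intro!: reduce_not_subset simp del: image_insert)
        qed auto
        finally show "reduce (u ` J') (u ` J) ds (a # as) f y = reduce (u ` J') (u ` J) (p # ds) as f y +
          (\<Sum>j\<in>- J. (u j \<bullet> b) * reduce (u ` J') (u ` insert j J) [] (as @ ds) f y)"
          by (simp add: p_def b_def)
      qed
      show "coord_integral J' (reduce (u ` J') (u ` J) (p # ds) as f) +
          (\<Sum>j\<in>- J. (u j \<bullet> b) * coord_integral J' (reduce (u ` J') (u ` insert j J) [] (as @ ds) f))
          = coord_integral J' (reduce (u ` J') (u ` J) ds (a # as) f)"
        unfolding r using f
        by (subst coord_integral_add)
          (auto simp: coord_integral_sum coord_integral_scale supported_scale supported_reduce
            intro!: supported_sum)
    qed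
    finally show ?case .
  qed
  then show ?thesis by blast
qed

end

section \<open>The operator attached to a set of normals\<close>

text \<open>
  A family dual to \<open>U\<close>, depending on the set \<open>U\<close> only. At a vertex it replaces the vectors \<open>v\<^sub>i\<close>,
  which have the same inner products with \<open>U\<close>.
\<close>

definition local_dual :: "'a::euclidean_space set \<Rightarrow> 'a \<Rightarrow> 'a" where
  "local_dual U = (SOME v. \<forall>w\<in>U. \<forall>w'\<in>U. w \<bullet> v w' = (if w = w' then 1 else 0))"

definition enumeration :: "'a set \<Rightarrow> 'a list" where
  "enumeration S = (SOME xs. distinct xs \<and> set xs = S)"

lemma enumeration: "finite S \<Longrightarrow> distinct (enumeration S)" "finite S \<Longrightarrow> set (enumeration S) = S"
proof -
  assume "finite S"
  then have "\<exists>xs. distinct xs \<and> set xs = S" using finite_distinct_list by metis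
  from someI_ex[OF this] show "distinct (enumeration S)" "set (enumeration S) = S"
    unfolding enumeration_def by blast+
qed

definition tuple_on :: "'i set \<Rightarrow> ('i \<Rightarrow> 'a) \<Rightarrow> ('i \<Rightarrow> nat) \<Rightarrow> 'a list" where
  "tuple_on S v \<alpha> = concat (map (\<lambda>i. replicate (\<alpha> i - 1) (v i)) (enumeration S))"

definition support :: "('i \<Rightarrow> nat) \<Rightarrow> 'i set" where
  "support \<alpha> = {i. \<alpha> i > 0}"

definition multi_indices :: "'i set \<Rightarrow> nat \<Rightarrow> ('i \<Rightarrow> nat) set" where
  "multi_indices U q = {\<alpha>. support \<alpha> \<subseteq> U \<and> (\<Sum>w\<in>U. \<alpha> w) = q}"

text \<open>
  The contributions of all faces containing the given one: a term of the wedge expansion with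
  multi-index \<open>\<alpha>\<close> lives on the face whose normals form the support of \<open>\<alpha>\<close>.
\<close>

definition normal_operator :: "nat \<Rightarrow> 'a::euclidean_space set \<Rightarrow> ('a \<Rightarrow> real) \<Rightarrow> 'a \<Rightarrow> real" where
  "normal_operator q U f x = (\<Sum>\<alpha>\<in>multi_indices U q. (\<Prod>w\<in>U. bern (\<alpha> w) / fact (\<alpha> w)) *
     reduce U (support \<alpha>) [] (tuple_on (support \<alpha>) (local_dual U) \<alpha>) f x)"

lemma length_tuple_on:
  assumes "finite U" "\<alpha> \<in> multi_indices U q"
  shows "length (tuple_on (support \<alpha>) v \<alpha>) + card (support \<alpha>) = q"
proof -
  have S: "support \<alpha> \<subseteq> U" "(\<Sum>w\<in>U. \<alpha> w) = q" using assms(2) by (auto simp: multi_indices_def)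
  then have fin: "finite (support \<alpha>)" using assms(1) finite_subset by blast
  have "length (tuple_on (support \<alpha>) v \<alpha>) = (\<Sum>i\<in>support \<alpha>. \<alpha> i - 1)"
    using enumeration[OF fin]
    by (simp add: tuple_on_def length_concat o_def sum_list_distinct_conv_sum_set)
  then have "length (tuple_on (support \<alpha>) v \<alpha>) + card (support \<alpha>) = (\<Sum>i\<in>support \<alpha>. (\<alpha> i - 1) + 1)"
    by (simp add: sum_Suc)
  also have "\<dots> = (\<Sum>i\<in>support \<alpha>. \<alpha> i)"
    by (intro sum.cong) (auto simp: support_def)
  also have "\<dots> = (\<Sum>i\<in>U. \<alpha> i)"
    using S assms(1) by (intro sum.mono_neutral_left) (auto simp: support_def)
  finally show ?thesis using S(2) by simp
qed

lemma normal_operator_cco: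
  assumes "finite U" "card U \<le> q"
  shows "constant_coefficient_operator (q - card U) (span U) (normal_operator q U)"
proof -
  have "constant_coefficient_operator (q - card U) (span U)
     (reduce U (support \<alpha>) [] (tuple_on (support \<alpha>) (local_dual U) \<alpha>))" if "\<alpha> \<in> multi_indices U q" for \<alpha>
    using length_tuple_on[OF assms(1) that, of "local_dual U"] assms that
    by (intro reduce_cco) (auto simp: multi_indices_def)
  moreover have "normal_operator q U = (\<lambda>f x. \<Sum>\<alpha>\<in>multi_indices U q. (\<Prod>w\<in>U. bern (\<alpha> w) / fact (\<alpha> w)) *
     reduce U (support \<alpha>) [] (tuple_on (support \<alpha>) (local_dual U) \<alpha>) f x)"
    by (simp add: fun_eq_iff normal_operator_def)
  ultimately show ?thesis by (auto intro!: cco_sum cco_scale)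
qed

lemma normal_operator_zero:
  assumes "finite U" "q < card U"
  shows "normal_operator q U f x = 0"
proof -
  have "reduce U (support \<alpha>) [] (tuple_on (support \<alpha>) (local_dual U) \<alpha>) f x = 0" if "\<alpha> \<in> multi_indices U q" for \<alpha>
    using length_tuple_on[OF assms(1) that, of "local_dual U"] assms that
    by (intro reduce_too_short) (auto simp: multi_indices_def)
  then show ?thesis by (simp add: normal_operator_def)
qed

lemma mset_concat_enumeration:
  assumes "distinct xs" "set xs = S"
  shows "mset (concat (map g xs)) = (\<Sum>i\<in>S. mset (g i))"
  using assms by (simp add: mset_concat o_def sum_list_distinct_conv_sum_set)

context wedge_coordinates begin

text \<open>
  Multi-indices over the facets of a wedge, regarded as multi-indices over the normals.
\<close>

definition push :: "('n \<Rightarrow> nat) \<Rightarrow> real ^ 'n \<Rightarrow> nat" where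
  "push \<alpha> w = (if w \<in> range u then \<alpha> (inv u w) else 0)"

lemma push_u [simp]: "push \<alpha> (u i) = \<alpha> i"
  by (simp add: push_def inv_f_f[OF inj_u])

lemma support_push: "support (push \<alpha>) = u ` support \<alpha>"
  by (auto simp: support_def push_def inv_f_f[OF inj_u] inj_eq[OF inj_u] split: if_splits)

lemma local_dual_u:
  assumes "i \<in> J" "j \<in> J"
  shows "u i \<bullet> local_dual (u ` J) (u j) = (if i = j then 1 else 0)"
proof -
  have "\<forall>w\<in>u ` J. \<forall>w'\<in>u ` J. w \<bullet> v (inv u w') = (if w = w' then 1 else 0)"
    by (auto simp: inv_f_f[OF inj_u] u_v inj_eq[OF inj_u])
  then have "\<exists>v. \<forall>w\<in>u ` J. \<forall>w'\<in>u ` J. w \<bullet> v w' = (if w = w' then 1 else 0)"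
    by (rule exI[of _ "\<lambda>w'. v (inv u w')"])
  from someI_ex[OF this]
  have "\<forall>w\<in>u ` J. \<forall>w'\<in>u ` J. w \<bullet> local_dual (u ` J) w' = (if w = w' then 1 else 0)"
    unfolding local_dual_def .
  then show ?thesis using assms by (simp add: inj_eq[OF inj_u])
qed

definition face_tuple :: "('n \<Rightarrow> nat) \<Rightarrow> (real ^ 'n) list" where
  "face_tuple \<alpha> = tuple_on (u ` support \<alpha>) (\<lambda>w. v (inv u w)) (push \<alpha>)"

text \<open>
  The order of the directions is immaterial, but \<open>index_list\<close> and \<open>enumeration\<close> may order the
  facets differently.
\<close>

lemma mset_face_tuple: "mset (face_tuple \<alpha>) = mset (multi_tuple v (\<lambda>i. \<alpha> i - supp_index \<alpha> i))"
proof -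
  have "mset (face_tuple \<alpha>) = (\<Sum>w\<in>u ` support \<alpha>. mset (replicate (push \<alpha> w - 1) (v (inv u w))))"
    unfolding face_tuple_def tuple_on_def by (intro mset_concat_enumeration enumeration) auto
  also have "\<dots> = (\<Sum>i\<in>support \<alpha>. mset (replicate (\<alpha> i - 1) (v i)))"
    by (subst sum.reindex) (auto intro: inj_on_subset[OF inj_u] simp: inv_f_f[OF inj_u])
  also have "\<dots> = (\<Sum>i\<in>UNIV. mset (replicate (\<alpha> i - 1) (v i)))"
    by (intro sum.mono_neutral_left) (auto simp: support_def)
  also have "\<dots> = (\<Sum>i\<in>UNIV. mset (replicate (\<alpha> i - supp_index \<alpha> i) (v i)))"
    by (intro sum.cong) (auto simp: supp_index_def)
  also have "\<dots> = mset (multi_tuple v (\<lambda>i. \<alpha> i - supp_index \<alpha> i))"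
    unfolding multi_tuple_def by (intro mset_concat_enumeration[symmetric] index_list)
  finally show ?thesis .
qed

lemma reduce_face_tuple:
  assumes "support \<alpha> \<subseteq> J"
  shows "reduce (u ` J) (u ` support \<alpha>) [] (face_tuple \<alpha>) f x
    = reduce (u ` J) (support (push \<alpha>)) [] (tuple_on (support (push \<alpha>)) (local_dual (u ` J)) (push \<alpha>)) f x"
  unfolding support_push
proof (rule reduce_cong)
  define xs where "xs = enumeration (u ` support \<alpha>)"
  have xs: "set xs \<subseteq> u ` J" using enumeration(2)[of "u ` support \<alpha>"] assms by (auto simp: xs_def)
  have "list_all2 (\<lambda>a b. \<forall>w\<in>u ` J. w \<bullet> a = w \<bullet> b)
      (concat (map (\<lambda>i. replicate (push \<alpha> i - 1) (v (inv u i))) xs))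
      (concat (map (\<lambda>i. replicate (push \<alpha> i - 1) (local_dual (u ` J) i)) xs))"
    using xs
  proof (induction xs)
    case (Cons y xs)
    then obtain j where j: "j \<in> J" "y = u j" by auto
    have "\<forall>w\<in>u ` J. w \<bullet> v (inv u y) = w \<bullet> local_dual (u ` J) y"
      using j local_dual_u[OF _ j(1)] by (auto simp: inv_f_f[OF inj_u] u_v)
    then have "list_all2 (\<lambda>a b. \<forall>w\<in>u ` J. w \<bullet> a = w \<bullet> b)
        (replicate m (v (inv u y))) (replicate m (local_dual (u ` J) y))" for m
      by (simp add: list_all2_conv_all_nth)
    from list_all2_appendI[OF this Cons.IH] Cons.prems show ?case by simp
  qed simp
  then show "list_all2 (\<lambda>a b. \<forall>w\<in>u ` J. w \<bullet> a = w \<bullet> b) (face_tuple \<alpha>)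
      (tuple_on (u ` support \<alpha>) (local_dual (u ` J)) (push \<alpha>))"
    unfolding face_tuple_def tuple_on_def xs_def .
qed (use assms in auto)

lemma bern_prod_push:
  assumes "support \<alpha> \<subseteq> J"
  shows "(\<Prod>w\<in>u ` J. bern (push \<alpha> w) / fact (push \<alpha> w)) = (\<Prod>i\<in>UNIV. bern (\<alpha> i) / fact (\<alpha> i))"
proof -
  have "(\<Prod>w\<in>u ` J. bern (push \<alpha> w) / fact (push \<alpha> w)) = (\<Prod>i\<in>J. bern (\<alpha> i) / fact (\<alpha> i))"
    by (subst prod.reindex) (auto intro: inj_on_subset[OF inj_u])
  also have "\<dots> = (\<Prod>i\<in>UNIV. bern (\<alpha> i) / fact (\<alpha> i))"
  proof (rule prod.mono_neutral_left)
    have "\<alpha> i = 0" if "i \<notin> J" for i using assms that by (auto simp: support_def)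
    then show "\<forall>i\<in>UNIV - J. bern (\<alpha> i) / fact (\<alpha> i) = 1" by (simp add: bern_0)
  qed auto
  finally show ?thesis .
qed

lemma sum_multi_indices_push:
  "(\<Sum>\<alpha>\<in>multi_indices (u ` J) q. F \<alpha>) = (\<Sum>\<alpha>\<in>{\<alpha> \<in> multi_indices UNIV q. support \<alpha> \<subseteq> J}. F (push \<alpha>))"
proof (rule sum.reindex_bij_witness[where i = push and j = "\<lambda>\<beta>. \<beta> \<circ> u"])
  fix \<beta> assume \<beta>: "\<beta> \<in> multi_indices (u ` J) q"
  then have sup: "\<And>w. \<beta> w > 0 \<Longrightarrow> w \<in> u ` J" and sum: "(\<Sum>w\<in>u ` J. \<beta> w) = q"
    by (auto simp: multi_indices_def support_def)
  show push: "push (\<beta> \<circ> u) = \<beta>"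
    using sup by (fastforce simp: push_def fun_eq_iff inv_f_f[OF inj_u])
  then show "F (push (\<beta> \<circ> u)) = F \<beta>" by simp
  have sJ: "support (\<beta> \<circ> u) \<subseteq> J" using sup inj_image_mem_iff[OF inj_u] by (auto simp: support_def)
  have "(\<Sum>w\<in>u ` J. \<beta> w) = (\<Sum>i\<in>J. (\<beta> \<circ> u) i)"
    by (subst sum.reindex) (auto intro: inj_on_subset[OF inj_u])
  also have "\<dots> = (\<Sum>i\<in>UNIV. (\<beta> \<circ> u) i)"
    using sJ by (intro sum.mono_neutral_left) (auto simp: support_def)
  finally show "\<beta> \<circ> u \<in> {\<alpha> \<in> multi_indices UNIV q. support \<alpha> \<subseteq> J}"
    using sJ sum by (simp add: multi_indices_def)
next
  fix \<alpha> assume \<alpha>: "\<alpha> \<in> {\<alpha> \<in> multi_indices UNIV q. support \<alpha> \<subseteq> J}"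
  show "push \<alpha> \<circ> u = \<alpha>" by (simp add: fun_eq_iff)
  have "(\<Sum>w\<in>u ` J. push \<alpha> w) = (\<Sum>i\<in>J. \<alpha> i)"
    by (subst sum.reindex) (auto intro: inj_on_subset[OF inj_u])
  also have "\<dots> = (\<Sum>i\<in>UNIV. \<alpha> i)"
    using \<alpha> by (intro sum.mono_neutral_left) (auto simp: support_def)
  finally show "push \<alpha> \<in> multi_indices (u ` J) q"
    using \<alpha> by (auto simp: multi_indices_def support_push)
qed

text \<open>
  The coefficient of the wedge expansion, rewritten with normal derivatives on all faces.
\<close>

lemma coord_expansion_normal:
  assumes f: "smooth f" "supported f"
  shows "(\<Sum>\<alpha>\<in>{\<alpha>. (\<Sum>i\<in>UNIV. \<alpha> i) = q}. coord_coefficient f \<alpha>)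
    = (\<Sum>J\<in>UNIV. coord_integral J (normal_operator q (u ` J) f))"
proof -
  define k where "k \<alpha> = (\<Prod>i\<in>UNIV. bern (\<alpha> i) / fact (\<alpha> i))" for \<alpha> :: "'n \<Rightarrow> nat"
  define A where "A = {\<alpha> :: 'n \<Rightarrow> nat. (\<Sum>i\<in>UNIV. \<alpha> i) = q}"
  have A: "A = multi_indices UNIV q" by (simp add: A_def multi_indices_def)
  have fin: "finite A" unfolding A_def by (rule finite_multi_indices)
  let ?r = "\<lambda>J \<alpha>. reduce (u ` J) (u ` support \<alpha>) [] (face_tuple \<alpha>) f"
  have "coord_coefficient f \<alpha> = k \<alpha> * (\<Sum>J\<in>UNIV. coord_integral J (?r J \<alpha>))" for \<alpha>
  proof -
    have "coord_integral (support \<alpha>) (differential f (multi_tuple v (\<lambda>i. \<alpha> i - supp_index \<alpha> i)))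
        = coord_integral (support \<alpha>) (differential f ([] @ face_tuple \<alpha>))"
      using differential_perm[OF f(1) mset_face_tuple] by simp
    also have "\<dots> = (\<Sum>J\<in>UNIV. coord_integral J (?r J \<alpha>))"
      by (rule coord_integral_reduce[OF f])
    finally show ?thesis unfolding coord_coefficient_def k_def support_def by simp
  qed
  then have "(\<Sum>\<alpha>\<in>A. coord_coefficient f \<alpha>) = (\<Sum>J\<in>UNIV. \<Sum>\<alpha>\<in>A. k \<alpha> * coord_integral J (?r J \<alpha>))"
    by (simp add: sum_distrib_left sum.swap[of _ UNIV A])
  also have "\<dots> = (\<Sum>J\<in>UNIV. coord_integral J (normal_operator q (u ` J) f))"
  proof (rule sum.cong[OF refl])
    fix J :: "'n set"
    have "(\<Sum>\<alpha>\<in>A. k \<alpha> * coord_integral J (?r J \<alpha>)) = (\<Sum>\<alpha>\<in>{\<alpha> \<in> A. support \<alpha> \<subseteq> J}. k \<alpha> * coord_integral J (?r J \<alpha>))"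
    proof (rule sum.mono_neutral_right[OF fin])
      show "\<forall>\<alpha>\<in>A - {\<alpha> \<in> A. support \<alpha> \<subseteq> J}. k \<alpha> * coord_integral J (?r J \<alpha>) = 0"
      proof
        fix \<alpha> assume "\<alpha> \<in> A - {\<alpha> \<in> A. support \<alpha> \<subseteq> J}"
        then have "\<not> u ` support \<alpha> \<subseteq> u ` J" using inj_image_subset_iff[OF inj_u] by blast
        then have "?r J \<alpha> = (\<lambda>_. 0)" by (simp add: fun_eq_iff reduce_not_subset)
        then show "k \<alpha> * coord_integral J (?r J \<alpha>) = 0" by (simp add: coord_integral_def)
      qed
    qed auto
    also have "\<dots> = coord_integral J (\<lambda>x. \<Sum>\<alpha>\<in>{\<alpha> \<in> A. support \<alpha> \<subseteq> J}. k \<alpha> * ?r J \<alpha> x)"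
      by (simp add: coord_integral_sum coord_integral_scale supported_scale supported_reduce[OF f])
    also have "(\<lambda>x. \<Sum>\<alpha>\<in>{\<alpha> \<in> A. support \<alpha> \<subseteq> J}. k \<alpha> * ?r J \<alpha> x) = normal_operator q (u ` J) f"
      unfolding fun_eq_iff normal_operator_def sum_multi_indices_push A k_def
      by (auto intro!: sum.cong simp: reduce_face_tuple bern_prod_push)
    finally show "(\<Sum>\<alpha>\<in>A. k \<alpha> * coord_integral J (?r J \<alpha>)) = coord_integral J (normal_operator q (u ` J) f)" .
  qed
  finally show ?thesis unfolding A_def .
qed

end

section \<open>The tangent cone of a polytope at a vertex\<close>

lemma polytope_hull_extreme_points:
  "polytope P \<Longrightarrow> P = convex hull {x. x extreme_point_of P}"
  for P :: "'a::euclidean_space set"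
  using Krein_Milman_Minkowski polytope_imp_compact polytope_imp_convex by blast

lemma aff_dim_nonneg: "x \<in> S \<Longrightarrow> aff_dim S \<ge> 0"
  for S :: "'a::euclidean_space set"
  using aff_dim_subset[of "{x}" S] by simp

text \<open>
  A face of minimal dimension containing \<open>w\<close>: a point of its relative boundary would lie on one of
  its facets.
\<close>

lemma minimal_face_rel_interior:
  fixes P :: "'a::euclidean_space set"
  assumes "polytope P" "w \<in> P"
  obtains F where "F face_of P" "w \<in> rel_interior F"
proof -
  define d where "d F = nat (aff_dim F + 1)" for F :: "'a set"
  have "P face_of P \<and> w \<in> P" using assms polytope_imp_convex face_of_refl by blast
  then obtain F where F: "F face_of P" "w \<in> F" and min: "\<And>G. G face_of P \<and> w \<in> G \<Longrightarrow> d F \<le> d G"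
    using ex_has_least_nat[of "\<lambda>F. F face_of P \<and> w \<in> F" P d] by blast
  have pF: "polytope F" using assms(1) F(1) face_of_polytope_polytope by blast
  have "w \<in> rel_interior F"
  proof (rule ccontr)
    assume "w \<notin> rel_interior F"
    then have "w \<in> rel_frontier F" using F(2) closure_subset by (auto simp: rel_frontier_def)
    then obtain G where G: "G facet_of F" "w \<in> G"
      using rel_frontier_of_polyhedron[OF polytope_imp_polyhedron[OF pF]] by auto
    then have "G face_of P" using F(1) face_of_trans facet_of_imp_face_of by blast
    then have "d F \<le> d G" using min G(2) by blast
    moreover have "aff_dim G = aff_dim F - 1" "aff_dim G \<ge> 0"
      using G aff_dim_nonneg[OF G(2)] by (auto simp: facet_of_def)
    ultimately show False by (simp add: d_def)
  qed
  then show ?thesis using that F(1) by blast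
qed

lemma direction_in_hyperplane:
  fixes L :: "'a::euclidean_space set"
  assumes "subspace L" "dim L \<ge> 2"
  obtains d where "d \<in> L" "d \<noteq> 0" "h \<bullet> d = 0"
proof -
  obtain B where B: "B \<subseteq> L" "independent B" "card B = dim L"
    using basis_exists[of L] by metis
  then obtain x y where xy: "x \<in> B" "y \<in> B" "x \<noteq> y"
    using assms(2) card_le_Suc0_iff_eq[of B] independent_imp_finite[OF B(2)] by force
  show ?thesis
  proof (cases "h \<bullet> x = 0")
    case True
    then show ?thesis using that[of x] xy B dependent_zero by blast
  next
    case False
    define d where "d = y - ((h \<bullet> y) / (h \<bullet> x)) *\<^sub>R x"
    have "d \<noteq> 0"
    proof
      assume "d = 0"
      then have "y \<in> span {x}" by (simp add: d_def span_singleton)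
      moreover have "{x} \<subseteq> B - {y}" using xy by auto
      ultimately have "y \<in> span (B - {y})" using span_mono by blast
      then show False using B(2) xy(2) dependent_def by blast
    qed
    moreover have "d \<in> L" unfolding d_def using xy B(1) assms(1)
      by (intro subspace_diff subspace_mul) auto
    moreover have "h \<bullet> d = 0" using False by (simp add: d_def inner_diff_right)
    ultimately show ?thesis using that by blast
  qed
qed

text \<open>
  In the smallest face containing \<open>w\<close>, a direction parallel to the slicing hyperplane could be used
  to move \<open>w\<close> both ways inside the slice. So this face has dimension at most one.
\<close>

lemma extreme_point_of_slice_on_edge:
  fixes P :: "'a::euclidean_space set"
  assumes P: "polytope P" and w: "w extreme_point_of (P \<inter> {x. h \<bullet> x = b})" "\<not> w extreme_point_of P"
  obtains e where "e edge_of P" "w \<in> e"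
proof -
  have wP: "w \<in> P" "h \<bullet> w = b" using w(1) by (auto simp: extreme_point_of_def)
  obtain F where F: "F face_of P" "w \<in> rel_interior F"
    by (rule minimal_face_rel_interior[OF P wP(1)])
  have wF: "w \<in> F" using F(2) rel_interior_subset by blast
  have "aff_dim F \<le> 1"
  proof (rule ccontr)
    assume "\<not> aff_dim F \<le> 1"
    define L where "L = span ((\<lambda>x. - w + x) ` F)"
    have "aff_dim F = int (dim L)"
      using aff_dim_eq_dim[of w F] wF hull_subset[of F affine] by (auto simp: L_def)
    then have "dim L \<ge> 2" using \<open>\<not> aff_dim F \<le> 1\<close> by linarith
    then obtain d where d: "d \<in> L" "d \<noteq> 0" "h \<bullet> d = 0"
      using direction_in_hyperplane[of L h] by (auto simp: L_def)
    have aff: "w + t *\<^sub>R d \<in> affine hull F" for t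
    proof -
      have "t *\<^sub>R d \<in> span ((\<lambda>x. - w + x) ` F)" using d(1) by (simp add: L_def span_scale)
      then show ?thesis using affine_hull_span_gen[OF hull_inc[OF wF]] by auto
    qed
    obtain e where e: "e > 0" "cball w e \<inter> affine hull F \<subseteq> F"
      using F(2) mem_rel_interior_cball by blast
    define t where "t = e / norm d"
    have t: "t > 0" using e(1) d(2) by (simp add: t_def)
    have "w + s *\<^sub>R d \<in> P \<inter> {x. h \<bullet> x = b}" if "\<bar>s\<bar> = t" for s
    proof -
      have "w + s *\<^sub>R d \<in> cball w e" using that d(2) e(1) by (simp add: dist_norm t_def)
      then show ?thesis
        using e(2) aff face_of_imp_subset[OF F(1)] wP d(3) by (auto simp: inner_right_distrib)
    qed
    from this[of t] this[of "- t"] t have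
      "w + t *\<^sub>R d \<in> P \<inter> {x. h \<bullet> x = b}" "w - t *\<^sub>R d \<in> P \<inter> {x. h \<bullet> x = b}" by auto
    moreover have "w \<in> open_segment (w + t *\<^sub>R d) (w - t *\<^sub>R d)"
    proof -
      have "w + t *\<^sub>R d \<noteq> w - t *\<^sub>R d"
        using t d(2) by (metis add_cancel_right_right add_diff_cancel_left' diff_add_cancel
            eq_neg_iff_add_eq_0 less_irrefl minus_diff_eq scaleR_eq_0_iff scaleR_2 zero_neq_numeral)
      moreover have "midpoint (w + t *\<^sub>R d) (w - t *\<^sub>R d) = w"
        by (simp add: midpoint_def flip: scaleR_2)
      ultimately show ?thesis using midpoint_in_open_segment by metis
    qed
    ultimately show False using w(1) by (auto simp: extreme_point_of_def)
  qed
  moreover have "aff_dim F \<ge> 0" using wF by (rule aff_dim_nonneg)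
  moreover have "aff_dim F \<noteq> 0"
  proof
    assume "aff_dim F = 0"
    then have "F = {w}" using wF by (auto simp: aff_dim_eq_0)
    then show False using F(1) w(2) face_of_singleton by auto
  qed
  ultimately have "F edge_of P" using F(1) by (simp add: edge_of_def)
  then show ?thesis using wF that by blast
qed

definition cone_at :: "'a::euclidean_space \<Rightarrow> 'a set \<Rightarrow> 'a set" where
  "cone_at p A = {p + (\<Sum>a\<in>A. s a *\<^sub>R a) | s. \<forall>a\<in>A. 0 \<le> s a}"

lemma convex_cone_at: "convex (cone_at p A)"
proof (rule convexI)
  fix x y and r t :: real
  assume "x \<in> cone_at p A" "y \<in> cone_at p A" and rt: "0 \<le> r" "0 \<le> t" "r + t = 1"
  then obtain f g where f: "x = p + (\<Sum>a\<in>A. f a *\<^sub>R a)" "\<forall>a\<in>A. 0 \<le> f a"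
    and g: "y = p + (\<Sum>a\<in>A. g a *\<^sub>R a)" "\<forall>a\<in>A. 0 \<le> g a" by (auto simp: cone_at_def)
  have "r *\<^sub>R x + t *\<^sub>R y = (r + t) *\<^sub>R p + (\<Sum>a\<in>A. (r * f a + t * g a) *\<^sub>R a)"
    unfolding f g by (simp add: algebra_simps scaleR_sum_right sum.distrib)
  then show "r *\<^sub>R x + t *\<^sub>R y \<in> cone_at p A"
    unfolding cone_at_def using rt f(2) g(2) by (auto intro!: exI[of _ "\<lambda>a. r * f a + t * g a"])
qed

lemma cone_at_scale:
  assumes "x \<in> cone_at p A" "r \<ge> 0"
  shows "p + r *\<^sub>R (x - p) \<in> cone_at p A"
proof -
  obtain f where f: "x = p + (\<Sum>a\<in>A. f a *\<^sub>R a)" "\<forall>a\<in>A. 0 \<le> f a" using assms(1) by (auto simp: cone_at_def)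
  then show ?thesis unfolding cone_at_def using assms(2)
    by (auto intro!: exI[of _ "\<lambda>a. r * f a"] simp: scaleR_sum_right)
qed

text \<open>
  The vertex figure: a hyperplane separating \<open>p\<close> from all other vertices meets the polytope in the
  convex hull of points on edges through \<open>p\<close>. Every segment from \<open>p\<close> to another vertex crosses
  this slice.
\<close>

lemma polytope_in_cone_at_vertex:
  fixes P :: "'a::euclidean_space set"
  assumes P: "polytope P" and p: "p extreme_point_of P" and A: "finite A"
    and edges: "\<And>e. e edge_of P \<Longrightarrow> p \<in> e \<Longrightarrow> \<exists>a\<in>A. e \<subseteq> {p + t *\<^sub>R a | t. 0 \<le> t}"
  shows "P \<subseteq> cone_at p A"
proof -
  define V where "V = {q. q extreme_point_of P}"
  have fV: "finite V" unfolding V_def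
    using finite_polyhedron_extreme_points polytope_imp_polyhedron[OF P] by blast
  have hull: "P = convex hull V" unfolding V_def by (rule polytope_hull_extreme_points[OF P])
  have VP: "V \<subseteq> P" by (auto simp: V_def extreme_point_of_def)
  have pP: "p \<in> P" using p by (simp add: extreme_point_of_def)
  have "{p} face_of P" using p by (simp add: face_of_singleton)
  then have "{p} exposed_face_of P" using exposed_face_of_polyhedron polytope_imp_polyhedron[OF P] by blast
  then obtain h b where hb: "P \<subseteq> {x. h \<bullet> x \<le> b}" "{p} = P \<inter> {x. h \<bullet> x = b}"
    by (auto simp: exposed_face_of_def)
  have hp: "h \<bullet> p = b" using hb(2) by auto
  have less: "h \<bullet> x < b" if "x \<in> P" "x \<noteq> p" for x
    using hb that by (metis (mono_tags, lifting) IntI mem_Collect_eq order_le_imp_less_or_eq singletonD subsetD)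
  have ray: "e \<subseteq> cone_at p A" if e: "e edge_of P" "p \<in> e" for e
  proof -
    obtain a where a: "a \<in> A" "e \<subseteq> {p + t *\<^sub>R a | t. 0 \<le> t}" using edges[OF e] by blast
    have "p + t *\<^sub>R a \<in> cone_at p A" if "0 \<le> t" for t
    proof -
      have "(\<Sum>x\<in>A. (if x = a then t else 0) *\<^sub>R x) = (\<Sum>x\<in>A. if x = a then t *\<^sub>R a else 0)"
        by (intro sum.cong) auto
      also have "\<dots> = t *\<^sub>R a" using A a(1) by simp
      finally show ?thesis unfolding cone_at_def using that
        by (auto intro!: exI[of _ "\<lambda>x. if x = a then t else 0"])
    qed
    then show ?thesis using a(2) by auto
  qed
  have "q \<in> cone_at p A" if q: "q \<in> V" for q
  proof (cases "q = p")
    case True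
    then show ?thesis unfolding cone_at_def by (auto intro!: exI[of _ "\<lambda>_. 0"])
  next
    case False
    define m where "m = Max ((\<lambda>q. h \<bullet> q) ` (V - {p}))"
    have mle: "h \<bullet> q' \<le> m" if "q' \<in> V" "q' \<noteq> p" for q'
      unfolding m_def using fV that by (intro Max_ge) auto
    have "m \<in> (\<lambda>q. h \<bullet> q) ` (V - {p})" unfolding m_def using fV q False by (intro Max_in) auto
    then have mb: "m < b" using less VP by auto
    \<comment> \<open>A level strictly between \<open>p\<close> and all other vertices.\<close>
    define l where "l = (m + b) / 2"
    have l: "m < l" "l < b" using mb by (auto simp: l_def)
    let ?S = "P \<inter> {x. h \<bullet> x = l}"
    have pS: "polytope ?S" by (rule polytope_Int_polyhedron[OF P polyhedron_hyperplane])
    have "w \<in> cone_at p A" if w: "w extreme_point_of ?S" for w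
    proof -
      have hw: "h \<bullet> w = l" "w \<in> P" using w by (auto simp: extreme_point_of_def)
      have "\<not> w extreme_point_of P"
      proof
        assume "w extreme_point_of P"
        then have "w \<in> V" by (simp add: V_def)
        then show False using mle[of w] hw l hp by (cases "w = p") auto
      qed
      then obtain e where e: "e edge_of P" "w \<in> e"
        using extreme_point_of_slice_on_edge[OF P w] by blast
      have eP: "e face_of P" using e(1) by (simp add: edge_of_def)
      have "p \<in> e"
      proof (rule ccontr)
        assume "p \<notin> e"
        have "e = convex hull {x. x extreme_point_of e}"
          using polytope_hull_extreme_points face_of_polytope_polytope[OF P eP] by blast
        also have "\<dots> \<subseteq> convex hull (V - {p})"
          using \<open>p \<notin> e\<close> extreme_point_of_face[OF eP] by (intro hull_mono) (auto simp: V_def)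
        also have "\<dots> \<subseteq> {x. h \<bullet> x \<le> m}"
          using mle by (intro hull_minimal) (auto simp: convex_halfspace_le)
        finally show False using e(2) hw l by auto
      qed
      then show ?thesis using ray e by blast
    qed
    then have S: "?S \<subseteq> cone_at p A"
      using polytope_hull_extreme_points[OF pS] hull_minimal[of "{w. w extreme_point_of ?S}" "cone_at p A" convex]
        convex_cone_at by blast
    define r where "r = (b - l) / (b - h \<bullet> q)"
    have hq: "h \<bullet> q < l" using mle[OF q False] l by simp
    have r: "0 < r" "r < 1" using hq l by (auto simp: r_def field_simps)
    define z where "z = p + r *\<^sub>R (q - p)"
    have "z = (1 - r) *\<^sub>R p + r *\<^sub>R q" by (simp add: z_def algebra_simps)
    then have "z \<in> P" using r pP q VP polytope_imp_convex[OF P] by (auto simp: convex_alt)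
    moreover have "h \<bullet> z = b - r * (b - h \<bullet> q)"
      by (simp add: z_def inner_right_distrib inner_diff_right hp algebra_simps)
    then have "h \<bullet> z = l" using hq l by (simp add: r_def)
    ultimately have "z \<in> cone_at p A" using S by blast
    from cone_at_scale[OF this, of "1 / r"] show ?thesis using r by (simp add: z_def)
  qed
  then show ?thesis
    unfolding hull by (intro hull_minimal) (auto simp: convex_cone_at)
qed

lemma edge_contains_ray_point:
  assumes "e edge_of P" "p \<in> e" "e \<subseteq> {p + t *\<^sub>R a | t. 0 \<le> t}"
  obtains t where "t > 0" "p + t *\<^sub>R a \<in> e"
proof -
  have "e \<noteq> {p}" using assms(1) by (auto simp: edge_of_def)
  then obtain x where x: "x \<in> e" "x \<noteq> p" using assms(2) by blast
  then obtain t where t: "x = p + t *\<^sub>R a" "0 \<le> t" using assms(3) by blast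
  then have "t > 0" using x(2) by (cases "t = 0") auto
  then show ?thesis using that x(1) t(1) by blast
qed

text \<open>
  Two such edges share a segment, and a face of an edge that has positive length is the whole
  edge.
\<close>

lemma edges_on_same_ray:
  fixes P :: "'a::euclidean_space set"
  assumes "polytope P" "e edge_of P" "e' edge_of P" "p \<in> e" "p \<in> e'"
    and "e \<subseteq> {p + t *\<^sub>R a | t. 0 \<le> t}" "e' \<subseteq> {p + t *\<^sub>R a | t. 0 \<le> t}"
  shows "e = e'"
proof -
  obtain t where t: "t > 0" "p + t *\<^sub>R a \<in> e" by (rule edge_contains_ray_point[OF assms(2,4,6)])
  obtain t' where t': "t' > 0" "p + t' *\<^sub>R a \<in> e'" by (rule edge_contains_ray_point[OF assms(3,5,7)])
  have f: "e face_of P" "e' face_of P" "aff_dim e = 1" "aff_dim e' = 1"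
    using assms(2,3) by (auto simp: edge_of_def)
  have c: "convex e" "convex e'" using f face_of_imp_convex by blast+
  define s where "s = min t t'"
  have s: "0 < s" "s \<le> t" "s \<le> t'" using t t' by (auto simp: s_def)
  have shorter: "p + s *\<^sub>R a \<in> E" if "convex E" "p \<in> E" "p + r *\<^sub>R a \<in> E" "s \<le> r" for E r
  proof -
    have "p + s *\<^sub>R a = (1 - s / r) *\<^sub>R p + (s / r) *\<^sub>R (p + r *\<^sub>R a)"
      using s that(4) by (simp add: algebra_simps)
    moreover have "0 \<le> s / r" "s / r \<le> 1" using s that(4) by auto
    ultimately show ?thesis using that convexD_alt[of E p "p + r *\<^sub>R a" "s / r"] by simp
  qed
  have x: "p + s *\<^sub>R a \<in> e \<inter> e'" using shorter c assms(4,5) t t' s by blast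
  have a: "a \<noteq> 0"
  proof
    assume "a = 0"
    then have "e = {p}" using assms(4,6) by auto
    then show False using f(3) by simp
  qed
  have I: "e \<inter> e' face_of P" using f face_of_Int by blast
  have ne: "aff_dim (e \<inter> e') \<ge> 1"
  proof -
    have "aff_dim {p, p + s *\<^sub>R a} = 1" using a s by (simp add: aff_dim_2)
    moreover have "aff_dim {p, p + s *\<^sub>R a} \<le> aff_dim (e \<inter> e')"
      using x assms(4,5) by (intro aff_dim_subset) auto
    ultimately show ?thesis by simp
  qed
  have "e \<inter> e' = E" if "E face_of P" "aff_dim E = 1" "e \<inter> e' \<subseteq> E" for E
  proof (rule ccontr)
    assume "e \<inter> e' \<noteq> E"
    moreover have "e \<inter> e' face_of E" using I that(1,3) face_of_face by blast
    ultimately have "aff_dim (e \<inter> e') < aff_dim E"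
      using face_of_aff_dim_lt face_of_imp_convex that(1) by blast
    then show False using ne that(2) by simp
  qed
  then show ?thesis using f by blast
qed

section \<open>Vertices of Delzant polytopes\<close>

lemma dual_family_independent:
  assumes "dual_family I w d"
  shows "independent (w ` I)"
proof (rule real_vector.independent_if_scalars_zero)
  show "finite (w ` I)" using assms by (simp add: dual_family_def)
  fix f x assume s: "(\<Sum>x\<in>w ` I. f x *\<^sub>R x) = 0" and "x \<in> w ` I"
  then obtain i where i: "i \<in> I" "x = w i" by blast
  have "(\<Sum>j\<in>I. f (w j) *\<^sub>R w j) = 0"
    using s dual_family_inj_on[OF assms] by (simp add: sum.reindex)
  then have "d i \<bullet> (\<Sum>j\<in>I. f (w j) *\<^sub>R w j) = 0" by simp
  then show "f x = 0" using dual_family_coordinate[OF assms i(1), of "\<lambda>j. f (w j)"] i(2) by simp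
qed

lemma lattice_basis_image:
  assumes "dual_family I w d"
  shows "lattice_basis (w ` I) (lattice_of I w)"
proof -
  note inj = dual_family_inj_on[OF assms]
  have "lattice_of I w = range (\<lambda>a. \<Sum>v\<in>w ` I. of_int (a v) *\<^sub>R v)"
  proof
    show "lattice_of I w \<subseteq> range (\<lambda>a. \<Sum>v\<in>w ` I. of_int (a v) *\<^sub>R v)"
    proof
      fix x assume "x \<in> lattice_of I w"
      then obtain a where a: "x = (\<Sum>i\<in>I. of_int (a i) *\<^sub>R w i)" by (auto simp: lattice_of_def)
      have "x = (\<Sum>v\<in>w ` I. of_int (a (the_inv_into I w v)) *\<^sub>R v)"
        using inj by (simp add: a sum.reindex the_inv_into_f_f)
      then show "x \<in> range (\<lambda>a. \<Sum>v\<in>w ` I. of_int (a v) *\<^sub>R v)"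
        by (rule range_eqI[of _ _ "\<lambda>v. a (the_inv_into I w v)"])
    qed
    show "range (\<lambda>a. \<Sum>v\<in>w ` I. of_int (a v) *\<^sub>R v) \<subseteq> lattice_of I w"
    proof
      fix x assume "x \<in> range (\<lambda>a. \<Sum>v\<in>w ` I. of_int (a v) *\<^sub>R v)"
      then obtain a where "x = (\<Sum>v\<in>w ` I. of_int (a v) *\<^sub>R v)" by blast
      then have "x = (\<Sum>i\<in>I. of_int (a (w i)) *\<^sub>R w i)" using inj by (simp add: sum.reindex)
      then show "x \<in> lattice_of I w"
        unfolding lattice_of_def by (rule range_eqI[of _ _ "\<lambda>i. a (w i)"])
    qed
  qed
  then show ?thesis using dual_family_independent[OF assms] by (simp add: lattice_basis_def)
qed

lemma dual_basis_sym: "dual_basis u v \<Longrightarrow> dual_basis v u"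
  unfolding dual_basis_def by (metis inner_commute)

lemma dual_basis_dual_family: "dual_basis u v \<Longrightarrow> dual_family I v u"
  for I :: "'n::finite set"
  by (simp add: dual_family_def dual_basis_def)

lemma lattice_basis_int_vecs_span:
  assumes "lattice_basis A (int_vecs :: (real ^ 'n) set)"
  shows "span A = UNIV" "finite A" "card A = CARD('n)"
proof -
  show fin: "finite A" using assms independent_imp_finite by (auto simp: lattice_basis_def)
  have "lattice_of A (\<lambda>a. a) \<subseteq> span A" using lattice_of_span[of A "\<lambda>a. a"] by simp
  then have "int_vecs \<subseteq> span A" using assms by (simp add: lattice_basis_def lattice_of_def)
  then have "Basis \<subseteq> span A" using axis_int_vecs by (auto simp: Basis_vec_def)
  then show sp: "span A = UNIV" using span_Basis span_minimal subspace_span by (metis top.extremum_uniqueI)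
  show "card A = CARD('n)"
    using assms sp dim_eq_card[of A UNIV] by (simp add: lattice_basis_def)
qed

text \<open>
  The data of the wedge at a vertex \<open>p\<close> of the polytope. The last condition says that the polytope
  contains an initial piece of each edge of the wedge.
\<close>

definition vertex_chart ::
  "(real ^ 'n) set \<Rightarrow> ('n::finite \<Rightarrow> real ^ 'n) \<Rightarrow> ('n \<Rightarrow> real ^ 'n) \<Rightarrow> ('n \<Rightarrow> int) \<Rightarrow> real ^ 'n \<Rightarrow> bool" where
  "vertex_chart \<Delta> u v c p \<longleftrightarrow> regular_integer_wedge u \<and> dual_basis u v \<and> (\<forall>i. u i \<bullet> p = of_int (c i)) \<and>
     p \<in> \<Delta> \<and> \<Delta> \<subseteq> wedge u c \<and> (\<forall>i. \<exists>t>0. p - t *\<^sub>R v i \<in> \<Delta>)"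

text \<open>
  The dual of a lattice basis is a lattice basis, and its members are primitive since
  \<open>\<langle>u\<^sub>i, v\<^sub>i\<rangle> = 1\<close>.
\<close>

lemma regular_wedge_of_dual_lattice_basis:
  fixes u v :: "'n::finite \<Rightarrow> real ^ 'n"
  assumes d: "dual_basis u v" and v: "\<And>i. v i \<in> int_vecs"
    and gen: "\<And>x. x \<in> int_vecs \<Longrightarrow> \<exists>a :: 'n \<Rightarrow> int. x = (\<Sum>i\<in>UNIV. of_int (a i) *\<^sub>R v i)"
  shows "regular_integer_wedge u"
proof -
  have u: "u i \<in> int_vecs" for i
  proof -
    have "u i \<bullet> axis k 1 \<in> \<int>" for k
    proof -
      obtain a :: "'n \<Rightarrow> int" where a: "axis k 1 = (\<Sum>i\<in>UNIV. of_int (a i) *\<^sub>R v i)"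
        using gen[OF axis_int_vecs] by blast
      show ?thesis unfolding a using dual_family_coordinate[OF dual_basis_dual_family[OF d], of i UNIV "\<lambda>i. of_int (a i)"]
        by simp
    qed
    then show ?thesis by (simp add: int_vecs_def inner_axis)
  qed
  have prim: "primitive_vec (u i)" for i
    unfolding primitive_vec_def
  proof (intro conjI allI impI u)
    fix k :: int and w assume w: "w \<in> int_vecs \<and> u i = of_int k *\<^sub>R w"
    then have "u i \<bullet> v i = of_int k * (w \<bullet> v i)" by simp
    then have one: "of_int k * (w \<bullet> v i) = 1" using d by (simp add: dual_basis_def)
    obtain m where m: "w \<bullet> v i = of_int m" using int_vecs_inner w v by (metis Ints_cases)
    have "of_int (k * m) = (of_int 1 :: real)" using one by (simp add: m)
    then have "k * m = 1" by (simp only: of_int_eq_iff)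
    then show "\<bar>k\<bar> = 1" by (metis zmult_eq_1_iff abs_1 abs_minus_cancel)
  qed
  have "int_vecs = lattice_of UNIV u"
  proof
    show "int_vecs \<subseteq> lattice_of UNIV u"
    proof
      fix x :: "real ^ 'n" assume x: "x \<in> int_vecs"
      have z: "v i \<bullet> x \<in> \<int>" for i using int_vecs_inner v x by blast
      have "x = (\<Sum>i\<in>UNIV. (v i \<bullet> x) *\<^sub>R u i)" using dual_basis_expand[OF dual_basis_sym[OF d]] by metis
      also have "\<dots> = (\<Sum>i\<in>UNIV. of_int \<lfloor>v i \<bullet> x\<rfloor> *\<^sub>R u i)" using z by (intro sum.cong) auto
      finally show "x \<in> lattice_of UNIV u"
        unfolding lattice_of_def by (rule range_eqI[of _ _ "\<lambda>i. \<lfloor>v i \<bullet> x\<rfloor>"])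
    qed
    show "lattice_of UNIV u \<subseteq> int_vecs"
      using u by (auto simp: lattice_of_def intro!: int_vecs_sum int_vecs_scale)
  qed
  then show ?thesis
    using prim lattice_basis_image[OF dual_basis_dual_family[OF dual_basis_sym[OF d], of UNIV]]
    by (simp add: regular_integer_wedge_def)
qed

text \<open>
  The edges at \<open>p\<close> lie on distinct rays, so the \<open>n\<close> edges exhaust the \<open>n\<close> vectors of the lattice
  basis. These are the \<open>-v\<^sub>i\<close>.
\<close>

lemma delzant_vertex_chart:
  fixes \<Delta> :: "(real ^ 'n::finite) set"
  assumes D: "integral_delzant \<Delta>" and p: "p extreme_point_of \<Delta>"
  obtains u v c where "vertex_chart \<Delta> u v c p"
proof -
  have P: "polytope \<Delta>" and pi: "p \<in> int_vecs" using D p by (auto simp: integral_delzant_def delzant_def)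
  define E where "E = {e. e edge_of \<Delta> \<and> p \<in> e}"
  have "card E = CARD('n) \<and> (\<exists>A. lattice_basis A int_vecs \<and>
      (\<forall>e. e edge_of \<Delta> \<and> p \<in> e \<longrightarrow> (\<exists>a\<in>A. e \<subseteq> {p + t *\<^sub>R a | t. 0 \<le> t})))"
    using D p by (simp add: integral_delzant_def delzant_def E_def)
  then obtain A where cE: "card E = CARD('n)" and A: "lattice_basis A int_vecs"
    and ex: "\<forall>e. e edge_of \<Delta> \<and> p \<in> e \<longrightarrow> (\<exists>a\<in>A. e \<subseteq> {p + t *\<^sub>R a | t. 0 \<le> t})"
    by (elim conjE exE)
  have edges: "\<exists>a\<in>A. e \<subseteq> {p + t *\<^sub>R a | t. 0 \<le> t}" if "e \<in> E" for e
    using ex[rule_format, of e] that by (simp add: E_def)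
  note A' = lattice_basis_int_vecs_span[OF A]
  have "\<forall>e\<in>E. \<exists>a. a \<in> A \<and> e \<subseteq> {p + t *\<^sub>R a | t. 0 \<le> t}" using edges by blast
  from bchoice[OF this] obtain \<alpha> where \<alpha>: "\<And>e. e \<in> E \<Longrightarrow> \<alpha> e \<in> A \<and> e \<subseteq> {p + t *\<^sub>R \<alpha> e | t. 0 \<le> t}" by blast
  have "inj_on \<alpha> E"
  proof (rule inj_onI)
    fix e e' assume e: "e \<in> E" "e' \<in> E" "\<alpha> e = \<alpha> e'"
    show "e = e'"
      by (rule edges_on_same_ray[OF P, of _ _ p "\<alpha> e"]) (use e \<alpha>[OF e(1)] \<alpha>[OF e(2)] in \<open>auto simp: E_def\<close>)
  qed
  then have "card (\<alpha> ` E) = card A" using card_image cE A'(3) by metis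
  then have surj: "\<alpha> ` E = A" using \<alpha> A'(2) by (intro card_subset_eq) auto
  have ray: "\<exists>t>0. p + t *\<^sub>R a \<in> \<Delta>" if "a \<in> A" for a
  proof -
    from that surj obtain e where e: "e \<in> E" "a = \<alpha> e" by blast
    then have ed: "e edge_of \<Delta>" "p \<in> e" by (auto simp: E_def)
    have "e \<subseteq> {p + t *\<^sub>R a | t. 0 \<le> t}" using \<alpha>[OF e(1)] e(2) by simp
    from edge_contains_ray_point[OF ed this] obtain t where "t > 0" "p + t *\<^sub>R a \<in> e" .
    then show ?thesis using edge_of_imp_subset[OF ed(1)] by blast
  qed
  have cone: "\<Delta> \<subseteq> cone_at p A"
    by (rule polytope_in_cone_at_vertex[OF P p A'(2)]) (use edges in \<open>auto simp: E_def\<close>)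
  obtain d where d: "dual_family A (\<lambda>a. a) d"
    using independent_dual_family A by (auto simp: lattice_basis_def)
  obtain g where g: "bij_betw g (UNIV :: 'n set) A"
    using finite_same_card_bij[of "UNIV :: 'n set" A] A'(2,3) by auto
  have gA: "g i \<in> A" for i using g by (auto simp: bij_betw_def)
  define v where "v i = - g i" for i
  define u where "u i = - d (g i)" for i
  have dg: "d (g i) \<bullet> g j = (if i = j then 1 else 0)" for i j
  proof -
    have "g i = g j \<longleftrightarrow> i = j" using g by (auto simp: bij_betw_def inj_def)
    then show ?thesis using d gA[of i] gA[of j] unfolding dual_family_def by simp
  qed
  have dual: "dual_basis u v" by (simp add: dual_basis_def u_def v_def dg)
  have Aint: "a \<in> int_vecs" if "a \<in> A" for a
    using lattice_of_base[OF d that] A by (simp add: lattice_basis_def lattice_of_def)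
  have reg: "regular_integer_wedge u"
  proof (rule regular_wedge_of_dual_lattice_basis[OF dual])
    show "v i \<in> int_vecs" for i
      using int_vecs_scale[OF Aint[OF gA], of "- 1" i] by (simp add: v_def)
    fix x :: "real ^ 'n" assume "x \<in> int_vecs"
    then obtain a :: "real ^ 'n \<Rightarrow> int" where "x = (\<Sum>w\<in>A. of_int (a w) *\<^sub>R w)" using A by (auto simp: lattice_basis_def)
    also have "\<dots> = (\<Sum>i\<in>UNIV. of_int (a (g i)) *\<^sub>R g i)" by (rule sum.reindex_bij_betw[OF g, symmetric])
    also have "\<dots> = (\<Sum>i\<in>UNIV. of_int (- a (g i)) *\<^sub>R v i)" by (simp add: v_def)
    finally show "\<exists>a :: 'n \<Rightarrow> int. x = (\<Sum>i\<in>UNIV. of_int (a i) *\<^sub>R v i)"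
      by (rule exI[of _ "\<lambda>i. - a (g i)"])
  qed
  define c where "c i = \<lfloor>u i \<bullet> p\<rfloor>" for i
  have "u i \<bullet> p \<in> \<int>" for i
    using reg pi int_vecs_inner unfolding regular_integer_wedge_def primitive_vec_def by blast
  then have c: "u i \<bullet> p = of_int (c i)" for i by (simp add: c_def)
  have "\<Delta> \<subseteq> wedge u c"
  proof
    fix x assume "x \<in> \<Delta>"
    then obtain s where s: "x = p + (\<Sum>a\<in>A. s a *\<^sub>R a)" "\<forall>a\<in>A. 0 \<le> s a" using cone by (auto simp: cone_at_def)
    have "u i \<bullet> (\<Sum>a\<in>A. s a *\<^sub>R a) = - s (g i)" for i
      using dual_family_coordinate[OF d gA, of i s] by (simp add: u_def)
    then have "u i \<bullet> x = of_int (c i) - s (g i)" for i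
      by (simp add: s(1) inner_right_distrib c)
    then show "x \<in> wedge u c" using s(2) gA by (simp add: wedge_def)
  qed
  moreover have "\<exists>t>0. p - t *\<^sub>R v i \<in> \<Delta>" for i using ray[OF gA[of i]] by (simp add: v_def)
  moreover have "p \<in> \<Delta>" using p by (simp add: extreme_point_of_def)
  ultimately have "vertex_chart \<Delta> u v c p" using reg dual c by (simp add: vertex_chart_def)
  then show ?thesis by (rule that)
qed

section \<open>Faces at a vertex\<close>

lemma polytope_halfspaces:
  fixes \<Delta> :: "'a::euclidean_space set"
  assumes "polytope \<Delta>"
  obtains H where "finite H" "\<Delta> = {x. \<forall>(a, b)\<in>H. a \<bullet> x \<le> b}"
proof -
  obtain \<H> where \<H>: "finite \<H>" "\<Delta> = \<Inter>\<H>" "\<forall>h\<in>\<H>. \<exists>a b. a \<noteq> 0 \<and> h = {x. a \<bullet> x \<le> b}"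
    using polytope_imp_polyhedron[OF assms] unfolding polyhedron_def by blast
  from \<H>(3) have "\<forall>h\<in>\<H>. \<exists>z. h = {x. fst z \<bullet> x \<le> snd z}" by fastforce
  from bchoice[OF this] obtain z where z: "\<forall>h\<in>\<H>. h = {x. fst (z h) \<bullet> x \<le> snd (z h)}" ..
  have "x \<in> \<Delta> \<longleftrightarrow> (\<forall>h\<in>\<H>. fst (z h) \<bullet> x \<le> snd (z h))" for x
    unfolding \<H>(2) using z by blast
  then have "\<Delta> = {x. \<forall>(a, b)\<in>z ` \<H>. a \<bullet> x \<le> b}" by (auto simp: case_prod_unfold)
  then show ?thesis using that \<H>(1) by blast
qed

text \<open>
  A segment of \<open>S\<close> that can be prolonged beyond its end point \<open>m\<close> in \<open>F\<close> lies in \<open>F\<close>.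
\<close>

lemma face_of_extend:
  assumes F: "F face_of S" and m: "m \<in> F" and x: "x \<in> S" and y: "m + r *\<^sub>R (m - x) \<in> S" and r: "r > 0"
  shows "x \<in> F"
proof (cases "x = m")
  case False
  define y where "y = m + r *\<^sub>R (m - x)"
  have "m = (1 - 1 / (1 + r)) *\<^sub>R x + (1 / (1 + r)) *\<^sub>R y"
  proof (rule scaleR_left_imp_eq)
    show "1 + r \<noteq> 0" using r by simp
    have "(1 + r) *\<^sub>R ((1 - 1 / (1 + r)) *\<^sub>R x + (1 / (1 + r)) *\<^sub>R y) = r *\<^sub>R x + y"
      using r by (simp add: scaleR_add_right field_simps)
    then show "(1 + r) *\<^sub>R m = (1 + r) *\<^sub>R ((1 - 1 / (1 + r)) *\<^sub>R x + (1 / (1 + r)) *\<^sub>R y)"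
      by (simp add: y_def algebra_simps)
  qed
  moreover have "x \<noteq> y"
  proof
    assume "x = y"
    then have "(1 + r) *\<^sub>R (m - x) = 0" by (simp add: y_def algebra_simps)
    then show False using r False by simp
  qed
  moreover have "0 < 1 / (1 + r)" "1 / (1 + r) < 1" using r by auto
  ultimately have "m \<in> open_segment x y" unfolding in_segment by blast
  then show ?thesis using face_ofD[OF F _ x y[folded y_def] m] by blast
qed (use m in simp)

text \<open>
  Off the hyperplanes from \<open>H\<close> that miss \<open>p\<close>, on the side of \<open>p\<close>. There the polytope cut out by \<open>H\<close>
  agrees with its tangent cone at the vertex \<open>p\<close>.
\<close>

definition region :: "('a::euclidean_space \<times> real) set \<Rightarrow> 'a \<Rightarrow> 'a set" where
  "region H p = {x. \<forall>(a, b)\<in>H. a \<bullet> p < b \<longrightarrow> a \<bullet> x < b}"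

lemma open_region: "finite H \<Longrightarrow> open (region H p)"
proof -
  assume "finite H"
  have "region H p = (\<Inter>h\<in>{h \<in> H. fst h \<bullet> p < snd h}. {x. fst h \<bullet> x < snd h})"
    by (auto simp: region_def)
  then show ?thesis using \<open>finite H\<close> by (auto intro!: open_INT simp: open_halfspace_lt)
qed

locale polytope_vertex = wedge_coordinates u v c \<rho> for u v :: "'n::finite \<Rightarrow> real ^ 'n" and c \<rho> +
  fixes \<Delta> p
  assumes polytope: "polytope \<Delta>" and chart: "vertex_chart \<Delta> u v c p"
begin

lemma regular: "regular_integer_wedge u"
  and u_p: "u i \<bullet> p = of_int (c i)"
  and p_in: "p \<in> \<Delta>"
  and subset_wedge: "\<Delta> \<subseteq> wedge u c"
  and ray: "\<exists>t>0. p - t *\<^sub>R v i \<in> \<Delta>"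
  using chart by (auto simp: vertex_chart_def)

lemma u_le: "x \<in> \<Delta> \<Longrightarrow> u i \<bullet> x \<le> of_int (c i)"
  using subset_wedge by (auto simp: wedge_def)

definition vface :: "'n set \<Rightarrow> (real ^ 'n) set" where
  "vface J = {x \<in> \<Delta>. \<forall>i\<in>J. u i \<bullet> x = of_int (c i)}"

lemma vface_eq: "vface J = \<Delta> \<inter> coordinate_face u c J"
  using subset_wedge by (auto simp: vface_def coordinate_face_def)

lemma p_in_vface: "p \<in> vface J"
  by (simp add: vface_def p_in u_p)

lemma ray_in_vface: "p - t *\<^sub>R v i \<in> \<Delta> \<Longrightarrow> t > 0 \<Longrightarrow> p - t *\<^sub>R v i \<in> vface J \<longleftrightarrow> i \<notin> J"
  by (auto simp: vface_def inner_diff_right u_p u_v)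

lemma vface_subset_iff: "vface J \<subseteq> vface J' \<longleftrightarrow> J' \<subseteq> J"
proof
  assume s: "vface J \<subseteq> vface J'"
  show "J' \<subseteq> J"
  proof
    fix i assume "i \<in> J'"
    obtain t where t: "t > 0" "p - t *\<^sub>R v i \<in> \<Delta>" using ray by blast
    show "i \<in> J" using ray_in_vface[OF t(2,1)] s \<open>i \<in> J'\<close> by blast
  qed
qed (auto simp: vface_def)

lemma inj_vface: "inj vface"
  by (rule injI) (metis order_antisym order_refl vface_subset_iff)

lemma vface_face_of: "vface J face_of \<Delta>"
proof -
  have "vface J = \<Inter> (insert \<Delta> ((\<lambda>i. \<Delta> \<inter> {x. u i \<bullet> x = of_int (c i)}) ` J))"
    by (auto simp: vface_def)
  also have "\<dots> face_of \<Delta>"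
    using polytope_imp_convex[OF polytope] u_le
    by (intro face_of_Inter) (auto simp: face_of_refl intro: face_of_Int_supporting_hyperplane_le)
  finally show ?thesis .
qed

lemma direction_space_vface: "direction_space (vface J) = span (v ` (- J))"
proof
  show "direction_space (vface J) \<subseteq> span (v ` (- J))"
    unfolding direction_space_def
    by (rule span_minimal) (auto simp: in_span_v_iff vface_def inner_diff_right)
  have "v i \<in> direction_space (vface J)" if "i \<in> - J" for i
  proof -
    obtain t where t: "t > 0" "p - t *\<^sub>R v i \<in> \<Delta>" using ray by blast
    then have "p - t *\<^sub>R v i \<in> vface J" using ray_in_vface that by simp
    from direction_space_subset[OF p_in_vface this]
    have "t *\<^sub>R v i \<in> direction_space (vface J)" by simp
    then have "(1 / t) *\<^sub>R (t *\<^sub>R v i) \<in> direction_space (vface J)"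
      unfolding direction_space_def by (rule span_scale)
    then show ?thesis using t(1) by simp
  qed
  then show "span (v ` (- J)) \<subseteq> direction_space (vface J)"
    unfolding direction_space_def by (intro span_minimal) auto
qed

lemma aff_dim_vface: "aff_dim (vface J) = int CARD('n) - int (card J)"
proof -
  have "span ((+) (- p) ` vface J) = span (v ` (- J))"
  proof
    show "span ((+) (- p) ` vface J) \<subseteq> span (v ` (- J))"
      by (rule span_minimal) (auto simp: in_span_v_iff vface_def inner_diff_right u_p)
    have "v i \<in> span ((+) (- p) ` vface J)" if "i \<in> - J" for i
    proof -
      obtain t where t: "t > 0" "p - t *\<^sub>R v i \<in> \<Delta>" using ray by blast
      then have "- p + (p - t *\<^sub>R v i) \<in> (+) (- p) ` vface J" using ray_in_vface that by blast
      then have "(- 1 / t) *\<^sub>R (- p + (p - t *\<^sub>R v i)) \<in> span ((+) (- p) ` vface J)"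
        by (intro span_scale span_base)
      then show ?thesis using t(1) by simp
    qed
    then show "span (v ` (- J)) \<subseteq> span ((+) (- p) ` vface J)" by (intro span_minimal) auto
  qed
  then have "dim ((+) (- p) ` vface J) = dim (v ` (- J))" by (metis dim_span)
  also have "\<dots> = card (- J)"
    using dim_eq_card_independent[OF dual_family_independent[OF dual_family_v]]
      card_image[OF dual_family_inj_on[OF dual_family_v]] by metis
  finally have "aff_dim (vface J) = int (card (- J))"
    using aff_dim_eq_dim[OF hull_inc[OF p_in_vface]] by simp
  moreover have "card (- J) = CARD('n) - card J" by (simp add: Compl_eq_Diff_UNIV card_Diff_subset)
  moreover have "card J \<le> CARD('n)" by (rule card_mono) auto
  ultimately show ?thesis by simp
qed

lemma aff_dim_\<Delta>: "aff_dim \<Delta> = int CARD('n)"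
  using aff_dim_vface[of "{}"] by (simp add: vface_def)

text \<open>
  Constraints that are not active at \<open>p\<close> hold by the definition of the region. An active one holds
  along the edges at \<open>p\<close>, hence on the cone they span.
\<close>

lemma wedge_region:
  assumes H: "\<Delta> = {x. \<forall>(a, b)\<in>H. a \<bullet> x \<le> b}" and x: "x \<in> wedge u c" "x \<in> region H p"
  shows "x \<in> \<Delta>"
proof -
  have "a \<bullet> x \<le> b" if ab: "(a, b) \<in> H" for a b
  proof (cases "a \<bullet> p < b")
    case True
    then show ?thesis using x(2) ab by (force simp: region_def)
  next
    case False
    moreover have "a \<bullet> p \<le> b" using p_in ab H by auto
    ultimately have ap: "a \<bullet> p = b" by simp
    have av: "0 \<le> a \<bullet> v i" for i
    proof -
      obtain t where t: "t > 0" "p - t *\<^sub>R v i \<in> \<Delta>" using ray by blast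
      then have "a \<bullet> (p - t *\<^sub>R v i) \<le> b" using ab H by auto
      then have "0 \<le> t * (a \<bullet> v i)" by (simp add: inner_diff_right ap)
      then show ?thesis using t(1) by (simp add: zero_le_mult_iff)
    qed
    have "p - x = (\<Sum>i\<in>UNIV. (u i \<bullet> (p - x)) *\<^sub>R v i)" by (simp add: dual_basis_expand[OF dual])
    then have "a \<bullet> (p - x) = (\<Sum>i\<in>UNIV. (u i \<bullet> (p - x)) * (a \<bullet> v i))"
      by (metis (no_types, lifting) inner_scaleR_right inner_sum_right sum.cong)
    moreover have "\<dots> \<ge> 0"
      using x(1) av by (intro sum_nonneg mult_nonneg_nonneg) (auto simp: wedge_def inner_diff_right u_p)
    ultimately show ?thesis using ap by (simp add: inner_diff_right)
  qed
  then show ?thesis using H by auto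
qed

text \<open>
  A face through \<open>p\<close> is determined by the facets of the wedge that contain it. Given a point \<open>z\<close>
  on these facets, one finds a point of the face beyond which the segment from \<open>z\<close> can be
  prolonged within the polytope.
\<close>

lemma face_eq_vface:
  assumes F: "F face_of \<Delta>" "p \<in> F"
  shows "F = vface {i. \<forall>x\<in>F. u i \<bullet> x = of_int (c i)}" (is "F = vface ?J")
proof
  have sub: "F \<subseteq> \<Delta>" by (rule face_of_imp_subset[OF F(1)])
  have conv: "convex F" by (rule face_of_imp_convex[OF F(1)])
  obtain H where H: "finite H" "\<Delta> = {x. \<forall>(a, b)\<in>H. a \<bullet> x \<le> b}" by (rule polytope_halfspaces[OF polytope])
  show "F \<subseteq> vface ?J" using sub by (auto simp: vface_def)
  show "vface ?J \<subseteq> F"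
  proof
    fix z assume z: "z \<in> vface ?J"
    \<comment> \<open>A point of \<open>F\<close> at which only the constraints in \<open>?J\<close> are active.\<close>
    have "\<forall>i. \<exists>x. x \<in> F \<and> (i \<notin> ?J \<longrightarrow> u i \<bullet> x < of_int (c i))"
    proof
      fix i
      show "\<exists>x. x \<in> F \<and> (i \<notin> ?J \<longrightarrow> u i \<bullet> x < of_int (c i))"
      proof (cases "i \<in> ?J")
        case False
        then obtain x where "x \<in> F" "u i \<bullet> x \<noteq> of_int (c i)" by auto
        then show ?thesis using u_le[of x i] sub by (intro exI[of _ x]) auto
      qed (use F(2) in auto)
    qed
    from choice[OF this] obtain X where X: "\<And>i. X i \<in> F" "\<And>i. i \<notin> ?J \<Longrightarrow> u i \<bullet> X i < of_int (c i)" by blast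
    define y where "y = (\<Sum>i\<in>UNIV. (1 / real CARD('n)) *\<^sub>R X i)"
    have yF: "y \<in> F" unfolding y_def
      by (rule convex_sum[OF _ conv]) (use X in auto)
    have uy: "u i \<bullet> y < of_int (c i)" if i: "i \<notin> ?J" for i
    proof -
      have "u i \<bullet> y = (\<Sum>j\<in>UNIV. (1 / real CARD('n)) * (u i \<bullet> X j))" by (simp add: y_def inner_sum_right)
      also have "\<dots> < (\<Sum>j\<in>(UNIV :: 'n set). (1 / real CARD('n)) * of_int (c i))"
      proof (rule sum_strict_mono_ex1)
        show "\<forall>j\<in>UNIV. (1 / real CARD('n)) * (u i \<bullet> X j) \<le> (1 / real CARD('n)) * of_int (c i)"
          using u_le X(1) sub by (auto intro!: divide_right_mono)
        show "\<exists>j\<in>UNIV. (1 / real CARD('n)) * (u i \<bullet> X j) < (1 / real CARD('n)) * of_int (c i)"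
          using X(2)[OF i] by (intro bexI[of _ i] mult_strict_left_mono) auto
      qed simp
      finally show ?thesis by simp
    qed
    \<comment> \<open>Pull \<open>y\<close> towards \<open>p\<close> to \<open>m t\<close>, then continue past \<open>m t\<close>, away from \<open>z\<close>, by the
      second-order amount \<open>t\<^sup>2\<close>: for small \<open>t\<close> the result is still in \<open>\<Delta>\<close>.\<close>
    define m where "m t = p + t *\<^sub>R (y - p)" for t :: real
    define w where "w t = m t + t\<^sup>2 *\<^sub>R (m t - z)" for t :: real
    have "(w \<longlongrightarrow> p + 0 *\<^sub>R (y - p) + 0\<^sup>2 *\<^sub>R (p + 0 *\<^sub>R (y - p) - z)) (at_right 0)"
      unfolding w_def m_def by (intro tendsto_intros)
    then have "eventually (\<lambda>t. w t \<in> region H p) (at_right 0)"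
      by (intro topological_tendstoD[OF _ open_region[OF H(1)]]) (auto simp: region_def)
    moreover have "eventually (\<lambda>t. t * (of_int (c i) - u i \<bullet> z) < of_int (c i) - u i \<bullet> y) (at_right 0)" if "i \<in> - ?J" for i
    proof -
      have "((\<lambda>t. t * (of_int (c i) - u i \<bullet> z)) \<longlongrightarrow> 0 * (of_int (c i) - u i \<bullet> z)) (at_right 0)"
        by (intro tendsto_intros)
      then show ?thesis using uy[of i] that by (intro order_tendstoD) auto
    qed
    then have "eventually (\<lambda>t. \<forall>i\<in>- ?J. t * (of_int (c i) - u i \<bullet> z) < of_int (c i) - u i \<bullet> y) (at_right 0)"
      by (intro eventually_ball_finite) auto
    moreover have "eventually (\<lambda>t. t < 1) (at_right (0::real))"
      by (rule order_tendstoD(2)[of "\<lambda>t. t" 0]) (auto intro: tendsto_intros)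
    moreover have "eventually (\<lambda>t. t > 0) (at_right (0::real))" by (rule eventually_at_right_less)
    ultimately have "eventually (\<lambda>t. w t \<in> region H p \<and> 0 < t \<and> t < 1 \<and>
        (\<forall>i\<in>- ?J. t * (of_int (c i) - u i \<bullet> z) < of_int (c i) - u i \<bullet> y)) (at_right 0)"
      by eventually_elim blast
    from eventually_happens'[OF trivial_limit_at_right_real this] obtain t where t: "w t \<in> region H p" "0 < t" "t < 1"
      and tJ: "\<And>i. i \<notin> ?J \<Longrightarrow> t * (of_int (c i) - u i \<bullet> z) < of_int (c i) - u i \<bullet> y"
      by blast
    have "m t = (1 - t) *\<^sub>R p + t *\<^sub>R y" by (simp add: m_def algebra_simps)
    then have mF: "m t \<in> F" using convexD_alt[OF conv F(2) yF, of t] t by simp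
    have "u i \<bullet> w t \<le> of_int (c i)" for i
    proof (cases "i \<in> ?J")
      case True
      then have "u i \<bullet> m t = of_int (c i)" "u i \<bullet> z = of_int (c i)" using mF z by (auto simp: vface_def)
      then show ?thesis by (simp add: w_def inner_add_right inner_diff_right)
    next
      case False
      have um: "u i \<bullet> m t = of_int (c i) - t * (of_int (c i) - u i \<bullet> y)"
        by (simp add: m_def inner_add_right inner_diff_right u_p algebra_simps)
      have "u i \<bullet> w t = u i \<bullet> m t + t\<^sup>2 * (u i \<bullet> m t - u i \<bullet> z)"
        by (simp add: w_def inner_add_right inner_diff_right)
      also have "\<dots> \<le> u i \<bullet> m t + t\<^sup>2 * (of_int (c i) - u i \<bullet> z)"
        using u_le mF sub by (auto intro!: mult_left_mono)
      also have "\<dots> = of_int (c i) - t * ((of_int (c i) - u i \<bullet> y) - t * (of_int (c i) - u i \<bullet> z))"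
        unfolding um by (simp add: algebra_simps power2_eq_square)
      also have "\<dots> \<le> of_int (c i)" using t(2) tJ[OF False] by simp
      finally show ?thesis .
    qed
    then have "w t \<in> \<Delta>" using wedge_region[OF H(2) _ t(1)] by (simp add: wedge_def)
    then show "z \<in> F"
      using face_of_extend[OF F(1) mF _ _ , of z "t\<^sup>2"] z t(2) by (simp add: vface_def w_def)
  qed
qed

lemma codim_faces_at_vertex: "{F \<in> codim_faces m \<Delta>. p \<in> F} = vface ` {J. card J = m}"
proof
  show "vface ` {J. card J = m} \<subseteq> {F \<in> codim_faces m \<Delta>. p \<in> F}"
    using vface_face_of p_in_vface aff_dim_vface by (auto simp: codim_faces_def)
  show "{F \<in> codim_faces m \<Delta>. p \<in> F} \<subseteq> vface ` {J. card J = m}"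
  proof
    fix F assume F: "F \<in> {F \<in> codim_faces m \<Delta>. p \<in> F}"
    then obtain J where J: "F = vface J" using face_eq_vface by (auto simp: codim_faces_def)
    then have "card J = m" using F aff_dim_vface[of J] by (simp add: codim_faces_def)
    then show "F \<in> vface ` {J. card J = m}" using J by blast
  qed
qed

end

section \<open>The expansion near a vertex\<close>

text \<open>
  Taking the normals from \<open>facet_pairs\<close> makes it evident that only the facets containing the face
  matter.
\<close>

definition face_operator ::
  "nat \<Rightarrow> (real ^ 'n::finite) set \<Rightarrow> (real ^ 'n) set \<Rightarrow> (real ^ 'n \<Rightarrow> real) \<Rightarrow> real ^ 'n \<Rightarrow> real" where
  "face_operator q \<Delta> F = normal_operator q (fst ` facet_pairs \<Delta> F)"

lemma normal_diff_operator_iff: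
  "normal_diff_operator k F P \<longleftrightarrow> constant_coefficient_operator k (orthogonal_comp (direction_space F)) P"
  unfolding normal_diff_operator_def constant_coefficient_operator_def ..

text \<open>
  A point off the region is a limit of points of an open half-space on which \<open>f\<close> vanishes.
\<close>

lemma operator_zero_off_region:
  assumes P: "constant_coefficient_operator k S P" and f: "smooth f"
    and off: "\<And>x. x \<notin> region H p \<Longrightarrow> f x = 0" and x: "x \<notin> region H p"
  shows "P f x = 0"
proof -
  have "\<exists>h\<in>H. fst h \<bullet> p < snd h \<and> snd h \<le> fst h \<bullet> x"
    using x by (force simp: region_def not_less)
  then obtain a b where ab: "(a, b) \<in> H" "a \<bullet> p < b" "a \<bullet> x \<ge> b" by auto
  have "a \<noteq> 0" using ab by auto
  show ?thesis
  proof (rule cco_zero_on_closure[OF P _ _ f])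
    show "open {y. b < a \<bullet> y}" by (rule open_halfspace_gt)
    show "f y = 0" if "y \<in> {y. b < a \<bullet> y}" for y
      using that ab by (intro off) (force simp: region_def)
    show "x \<in> closure {y. b < a \<bullet> y}"
      using closure_halfspace_gt[OF \<open>a \<noteq> 0\<close>, of b] ab(3) by simp
  qed
qed

text \<open>
  At a point of the region no facet missing \<open>p\<close> is active, so the segment from \<open>p\<close> to it can be
  prolonged.
\<close>

lemma face_meets_region:
  assumes H: "finite H" "\<Delta> = {x. \<forall>(a, b)\<in>H. a \<bullet> x \<le> b}" and G: "G face_of \<Delta>"
    and x: "x \<in> G" "x \<in> region H p" and p: "p \<in> \<Delta>"
  shows "p \<in> G"
proof -
  have xD: "x \<in> \<Delta>" using x(1) face_of_imp_subset[OF G] by blast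
  have ev: "eventually (\<lambda>t. a \<bullet> (x + t *\<^sub>R (x - p)) \<le> b) (at_right 0)" if "(a, b) \<in> H" for a b
  proof (cases "a \<bullet> x < b")
    case True
    have "((\<lambda>t. a \<bullet> (x + t *\<^sub>R (x - p))) \<longlongrightarrow> a \<bullet> (x + 0 *\<^sub>R (x - p))) (at_right 0)"
      by (intro tendsto_intros)
    then have "eventually (\<lambda>t. a \<bullet> (x + t *\<^sub>R (x - p)) < b) (at_right 0)"
      using True by (intro order_tendstoD) auto
    then show ?thesis by (rule eventually_mono) simp
  next
    case False
    moreover have "a \<bullet> x \<le> b" "a \<bullet> p \<le> b" using xD p that H(2) by auto
    moreover have "\<not> a \<bullet> p < b" using x(2) that False by (auto simp: region_def)
    ultimately have "a \<bullet> x = b" "a \<bullet> p = b" by auto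
    then show ?thesis by (simp add: inner_right_distrib inner_diff_right)
  qed
  then have "eventually (\<lambda>t. \<forall>h\<in>H. fst h \<bullet> (x + t *\<^sub>R (x - p)) \<le> snd h) (at_right (0::real))"
    using H(1) by (intro eventually_ball_finite) auto
  moreover have "eventually (\<lambda>t. t > 0) (at_right (0::real))" by (rule eventually_at_right_less)
  ultimately have "eventually (\<lambda>t. t > 0 \<and> (\<forall>h\<in>H. fst h \<bullet> (x + t *\<^sub>R (x - p)) \<le> snd h)) (at_right (0::real))"
    by eventually_elim auto
  then obtain t where t: "t > 0" "\<forall>h\<in>H. fst h \<bullet> (x + t *\<^sub>R (x - p)) \<le> snd h"
    using eventually_happens[of _ "at_right (0::real)"] by auto
  have "x + t *\<^sub>R (x - p) \<in> \<Delta>" using t(2) H(2) by auto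
  then show ?thesis using face_of_extend[OF G x(1) p _ t(1)] by blast
qed

text \<open>
  Take an extreme point of the face cut out by all constraints active at \<open>x\<close>.
\<close>

lemma region_cover:
  assumes H: "finite H" "\<Delta> = {x. \<forall>(a, b)\<in>H. a \<bullet> x \<le> b}" and P: "polytope \<Delta>" and x: "x \<in> \<Delta>"
  obtains p where "p extreme_point_of \<Delta>" "x \<in> region H p"
proof -
  define T where "T = {h \<in> H. fst h \<bullet> x = snd h}"
  define F where "F = \<Inter> (insert \<Delta> ((\<lambda>h. \<Delta> \<inter> {y. fst h \<bullet> y = snd h}) ` T))"
  have F: "F face_of \<Delta>" unfolding F_def
    using polytope_imp_convex[OF P] H(2)
    by (intro face_of_Inter)
      (auto simp: face_of_refl T_def split: prod.splits intro!: face_of_Int_supporting_hyperplane_le)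
  have "x \<in> F" using x by (auto simp: F_def T_def)
  moreover have "compact F" "convex F"
    using face_of_polytope_polytope[OF P F] polytope_imp_compact polytope_imp_convex by auto
  ultimately obtain p where p: "p extreme_point_of F" using extreme_point_exists_convex by blast
  then have pD: "p extreme_point_of \<Delta>" and pF: "p \<in> F" using extreme_point_of_face[OF F] by auto
  have "x \<in> region H p"
    unfolding region_def
  proof clarify
    fix a b assume ab: "(a, b) \<in> H" "a \<bullet> p < b"
    have "p \<in> \<Delta> \<inter> {y. fst (a, b) \<bullet> y = snd (a, b)}" if "(a, b) \<in> T"
      using pF that unfolding F_def by blast
    then have "(a, b) \<notin> T" using ab(2) by auto
    then have "a \<bullet> x \<noteq> b" using ab(1) by (simp add: T_def)
    then show "a \<bullet> x < b" using x ab(1) H(2) by fastforce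
  qed
  then show ?thesis using that pD by blast
qed

context polytope_vertex begin

text \<open>
  A facet containing \<open>p\<close> lies on one of the hyperplanes \<open>y\<^sub>i = c\<^sub>i\<close>. Its normal is then an integral
  multiple of \<open>u\<^sub>i\<close>; being primitive and pointing outwards, it is \<open>u\<^sub>i\<close>.
\<close>

lemma facet_pairs_vface: "facet_pairs \<Delta> (vface J) = (\<lambda>i. (u i, of_int (c i))) ` J"
proof
  show "(\<lambda>i. (u i, of_int (c i))) ` J \<subseteq> facet_pairs \<Delta> (vface J)"
  proof clarify
    fix i assume i: "i \<in> J"
    have "vface {i} facet_of \<Delta>"
      using vface_face_of[of "{i}"] p_in_vface[of "{i}"] aff_dim_vface[of "{i}"] aff_dim_\<Delta>
      by (auto simp: facet_of_def)
    moreover have "vface {i} = \<Delta> \<inter> {x. u i \<bullet> x = of_int (c i)}" by (auto simp: vface_def)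
    moreover have "vface J \<subseteq> vface {i}" using i vface_subset_iff by simp
    moreover have "primitive_vec (u i)" using regular by (simp add: regular_integer_wedge_def)
    moreover have "\<Delta> \<subseteq> {x. u i \<bullet> x \<le> of_int (c i)}" using u_le by blast
    ultimately show "(u i, of_int (c i)) \<in> facet_pairs \<Delta> (vface J)"
      unfolding facet_pairs_def by blast
  qed
  show "facet_pairs \<Delta> (vface J) \<subseteq> (\<lambda>i. (u i, of_int (c i))) ` J"
  proof clarify
    fix w b assume "(w, b) \<in> facet_pairs \<Delta> (vface J)"
    then obtain G where w: "primitive_vec w" "\<Delta> \<subseteq> {x. w \<bullet> x \<le> b}"
      and G: "G facet_of \<Delta>" "vface J \<subseteq> G" "G = \<Delta> \<inter> {x. w \<bullet> x = b}"
      unfolding facet_pairs_def by blast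
    have pG: "p \<in> G" using G(2) p_in_vface by blast
    obtain J' where J': "G = vface J'" using face_eq_vface[OF facet_of_imp_face_of[OF G(1)] pG] by blast
    have "card J' = 1" using G(1) aff_dim_vface[of J'] aff_dim_\<Delta> by (simp add: J' facet_of_def)
    then obtain i where i: "J' = {i}" by (auto simp: card_1_singleton_iff)
    have iJ: "i \<in> J" using G(2) vface_subset_iff[of J "{i}"] J' i by simp
    have wp: "w \<bullet> p = b" using pG G(3) by blast
    have wv: "w \<bullet> v j = 0" if "j \<noteq> i" for j
    proof -
      obtain t where t: "t > 0" "p - t *\<^sub>R v j \<in> \<Delta>" using ray by blast
      then have "p - t *\<^sub>R v j \<in> G" using ray_in_vface[OF t(2,1)] that J' i by simp
      then show ?thesis using G(3) wp t(1) by (simp add: inner_diff_right)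
    qed
    have "w = (\<Sum>j\<in>UNIV. (v j \<bullet> w) *\<^sub>R u j)" using dual_basis_expand[OF dual_basis_sym[OF dual]] by metis
    also have "\<dots> = (\<Sum>j\<in>UNIV. if j = i then (v i \<bullet> w) *\<^sub>R u i else 0)"
      using wv by (intro sum.cong) (auto simp: inner_commute)
    finally have w_eq: "w = (v i \<bullet> w) *\<^sub>R u i" by simp
    have "w \<in> int_vecs" using w(1) by (simp add: primitive_vec_def)
    then obtain k where k: "v i \<bullet> w = of_int k"
      using int_vecs_inner dual_basis_int_vecs[OF regular dual] by (metis Ints_cases)
    have "u i \<in> int_vecs" using regular by (simp add: regular_integer_wedge_def primitive_vec_def)
    then have "\<bar>k\<bar> = 1" using w(1) w_eq unfolding k primitive_vec_def by blast
    moreover have "k \<ge> 0"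
    proof -
      obtain t where t: "t > 0" "p - t *\<^sub>R v i \<in> \<Delta>" using ray by blast
      then have "w \<bullet> (p - t *\<^sub>R v i) \<le> b" using w(2) by blast
      then have "0 \<le> t * (w \<bullet> v i)" by (simp add: inner_diff_right wp)
      then have "0 \<le> v i \<bullet> w" using t(1) by (simp add: zero_le_mult_iff inner_commute)
      then show ?thesis using k by simp
    qed
    ultimately have "w = u i" using w_eq k by simp
    moreover have "b = of_int (c i)" using wp u_p calculation by simp
    ultimately show "(w, b) \<in> (\<lambda>i. (u i, of_int (c i))) ` J" using iJ by blast
  qed
qed

lemma face_operator_vface: "face_operator q \<Delta> (vface J) = normal_operator q (u ` J)"
  unfolding face_operator_def facet_pairs_vface by (simp add: image_image)

lemma orthogonal_comp_vface: "orthogonal_comp (direction_space (vface J)) = span (u ` J)"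
proof -
  interpret S: wedge_coordinates v u c \<rho>
    by unfold_locales (use dual_basis_sym[OF dual] c_bound in auto)
  have "x \<in> orthogonal_comp (direction_space (vface J)) \<longleftrightarrow> (\<forall>i. i \<notin> J \<longrightarrow> v i \<bullet> x = 0)" for x
  proof
    assume "x \<in> orthogonal_comp (direction_space (vface J))"
    then show "\<forall>i. i \<notin> J \<longrightarrow> v i \<bullet> x = 0"
      unfolding direction_space_vface orthogonal_comp_def orthogonal_def by (auto intro: span_base)
  next
    assume x: "\<forall>i. i \<notin> J \<longrightarrow> v i \<bullet> x = 0"
    have "y \<bullet> x = 0" if "y \<in> span (v ` (- J))" for y
    proof -
      obtain s where "y = (\<Sum>i\<in>- J. s i *\<^sub>R v i)" using span_image_combination[OF finite \<open>y \<in> _\<close>] by blast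
      then show ?thesis using x by (simp add: inner_sum_left)
    qed
    then show "x \<in> orthogonal_comp (direction_space (vface J))"
      unfolding direction_space_vface orthogonal_comp_def orthogonal_def by blast
  qed
  then show ?thesis using S.in_span_v_iff by blast
qed

lemma card_u_image: "card (u ` J) = card J"
  by (rule card_image) (rule inj_on_subset[OF inj_u subset_UNIV])

lemma normal_diff_operator_vface:
  assumes "card J \<le> q"
  shows "normal_diff_operator (q - card J) (vface J) (face_operator q \<Delta> (vface J))"
  unfolding normal_diff_operator_iff orthogonal_comp_vface face_operator_vface
  using normal_operator_cco[of "u ` J" q] assms by (simp add: card_u_image)

lemma face_const_vface: "face_const (vface J) = 1 / parallelotope_volume (v ` (- J))"
proof -
  let ?L = "direction_space (vface J) \<inter> int_vecs"
  define V where "V = (SOME V. lattice_basis V ?L)"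
  have L: "lattice_of (- J) v = ?L" using lattice_of_v[OF regular] direction_space_vface by simp
  have "lattice_basis (v ` (- J)) ?L"
    using lattice_basis_image[OF dual_family_v] L by metis
  then have "lattice_basis V ?L" unfolding V_def by (rule someI)
  then obtain d where d: "dual_family V (\<lambda>v. v) d" "lattice_of V (\<lambda>v. v) = ?L"
    by (rule lattice_basis_dual_family)
  have "parallelotope_volume ((\<lambda>v. v) ` V) = parallelotope_volume (v ` (- J))"
    by (rule parallelotope_volume_lattice_eq[OF d(1) dual_family_v]) (simp add: d(2) L)
  then show ?thesis by (simp add: face_const_def V_def)
qed

text \<open>
  A function vanishing where the wedge leaves the polytope does not distinguish the face of the
  polytope from the face of the wedge.
\<close>

lemma face_integral_star_vface:
  assumes g: "supported g" and sub: "\<And>x. x \<in> wedge u c \<Longrightarrow> g x \<noteq> 0 \<Longrightarrow> x \<in> \<Delta>"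
  shows "face_integral_star (vface J) g = coord_integral J g"
proof -
  have pc: "p \<in> coordinate_face u c J" using p_in_vface vface_eq by blast
  have z: "0 \<in> direction_space S" for S :: "(real ^ 'n) set" by (simp add: direction_space_def span_zero)
  have "affine_lborel (vface J) = affine_lborel (coordinate_face u c J)"
    using affine_lborel_eq[OF p_in_vface, of p] affine_lborel_eq[OF pc, of p]
    by (simp add: z direction_space_vface direction_space_coordinate_face span_zero)
  moreover have "(\<lambda>x. indicator (vface J) x *\<^sub>R g x) = (\<lambda>x. indicator (coordinate_face u c J) x *\<^sub>R g x)"
  proof
    show "indicator (vface J) x *\<^sub>R g x = indicator (coordinate_face u c J) x *\<^sub>R g x" for x
      using sub[of x] by (cases "g x = 0") (auto simp: vface_eq indicator_def coordinate_face_def)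
  qed
  ultimately have "face_integral (vface J) g = face_integral (coordinate_face u c J) g"
    unfolding face_integral_def set_lebesgue_integral_def by (simp only:)
  then show ?thesis
    using face_integral_coord_integral[OF g, of J] by (simp add: face_integral_star_def face_const_vface)
qed

text \<open>
  The face of codimension zero only receives the leading term.
\<close>

lemma normal_operator_empty:
  "normal_operator q {} f = (if q = 0 then f else (\<lambda>_. 0))" for f :: "real ^ 'n \<Rightarrow> real"
proof -
  have m: "multi_indices ({} :: (real ^ 'n) set) q = (if q = 0 then {\<lambda>_. 0} else {})"
    by (auto simp: multi_indices_def support_def)
  have s: "support (\<lambda>_. 0) = ({} :: (real ^ 'n) set)" by (simp add: support_def)
  have e: "enumeration {} = ([] :: (real ^ 'n) list)" using enumeration(2)[of "{} :: (real ^ 'n) set"] by simp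
  show ?thesis by (rule ext) (simp add: normal_operator_def m s tuple_on_def e)
qed

text \<open>
  The wedge expansion at \<open>p\<close>, with its terms regrouped by the faces of the polytope. Faces that do
  not contain \<open>p\<close> miss the region, so the function and its derivatives vanish on them.
\<close>

lemma vertex_expansion:
  assumes H: "finite H" "\<Delta> = {x. \<forall>(a, b)\<in>H. a \<bullet> x \<le> b}" and f: "smooth f" "supported f"
    and off: "\<And>x. x \<notin> region H p \<Longrightarrow> f x = 0"
    and normal: "\<And>q m F. F \<in> codim_faces m \<Delta> \<Longrightarrow> m \<le> q \<Longrightarrow> normal_diff_operator (q - m) F (face_operator q \<Delta> F)"
  shows "asymptotic_expansion (riemann_sum f \<Delta>)
    (\<lambda>q. if q = 0 then (LINT x:\<Delta>|lborel. f x)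
         else (\<Sum>m = 1..q. \<Sum>F\<in>codim_faces m \<Delta>. face_integral_star F (face_operator q \<Delta> F f)))"
proof -
  have sub: "x \<in> \<Delta>" if "x \<in> wedge u c" "f x \<noteq> 0" for x
    using wedge_region[OF H(2) that(1)] off that(2) by blast
  have riemann: "riemann_sum f \<Delta> N = riemann_sum f (wedge u c) N" if N: "N > 0" for N
  proof -
    have "(\<Sum>\<^sub>\<infinity>k\<in>int_vecs \<inter> (\<lambda>x. real N *\<^sub>R x) ` \<Delta>. f (k /\<^sub>R real N))
        = (\<Sum>\<^sub>\<infinity>k\<in>int_vecs \<inter> (\<lambda>x. real N *\<^sub>R x) ` wedge u c. f (k /\<^sub>R real N))"
    proof (rule infsum_cong_neutral)
      fix k assume k: "k \<in> int_vecs \<inter> (\<lambda>x. real N *\<^sub>R x) ` wedge u c - int_vecs \<inter> (\<lambda>x. real N *\<^sub>R x) ` \<Delta>"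
      then obtain x where "x \<in> wedge u c" "k = real N *\<^sub>R x" "x \<notin> \<Delta>" by blast
      then show "f (k /\<^sub>R real N) = 0" using sub N by auto
    qed (use subset_wedge in auto)
    then show ?thesis by (simp add: riemann_sum_def)
  qed
  have int0: "coord_integral {} f = (LINT x:\<Delta>|lborel. f x)"
  proof -
    have "(\<lambda>x. indicator (wedge u c) x *\<^sub>R f x) = (\<lambda>x. indicator \<Delta> x *\<^sub>R f x)"
    proof
      show "indicator (wedge u c) x *\<^sub>R f x = indicator \<Delta> x *\<^sub>R f x" for x
        using sub[of x] subset_wedge by (cases "f x = 0") (auto simp: indicator_def)
    qed
    then show ?thesis
      using coord_integral_empty[OF regular f(2)] unfolding set_lebesgue_integral_def by (simp only:)
  qed
  have star: "(\<Sum>F\<in>codim_faces m \<Delta>. face_integral_star F (face_operator q \<Delta> F f))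
      = (\<Sum>J\<in>{J. card J = m}. coord_integral J (normal_operator q (u ` J) f))" if mq: "1 \<le> m" "m \<le> q" for m q
  proof -
    have fin: "finite (codim_faces m \<Delta>)"
      by (rule finite_subset[OF _ finite_polytope_faces[OF polytope]]) (auto simp: codim_faces_def)
    have "(\<Sum>F\<in>codim_faces m \<Delta>. face_integral_star F (face_operator q \<Delta> F f))
        = (\<Sum>F\<in>{F \<in> codim_faces m \<Delta>. p \<in> F}. face_integral_star F (face_operator q \<Delta> F f))"
    proof (rule sum.mono_neutral_right[OF fin])
      show "\<forall>F\<in>codim_faces m \<Delta> - {F \<in> codim_faces m \<Delta>. p \<in> F}. face_integral_star F (face_operator q \<Delta> F f) = 0"
      proof
        fix F assume "F \<in> codim_faces m \<Delta> - {F \<in> codim_faces m \<Delta>. p \<in> F}"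
        then have F: "F face_of \<Delta>" "F \<noteq> {}" "aff_dim F = int CARD('n) - int m" "p \<notin> F"
          by (auto simp: codim_faces_def)
        have zero: "face_operator q \<Delta> F f x = 0" if "x \<in> F" for x
        proof -
          have x: "x \<notin> region H p" using face_meets_region[OF H F(1) that _ p_in] F(4) by blast
          have "F \<in> codim_faces m \<Delta>" using F by (simp add: codim_faces_def)
          then show ?thesis
            using operator_zero_off_region[OF normal[unfolded normal_diff_operator_iff] f(1) off x] mq by blast
        qed
        then have "(\<lambda>x. indicator F x *\<^sub>R face_operator q \<Delta> F f x) = (\<lambda>_. 0)"
          by (auto simp: indicator_def)
        then show "face_integral_star F (face_operator q \<Delta> F f) = 0"
          by (simp add: face_integral_star_def face_integral_def set_lebesgue_integral_def)
      qed
    qed auto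
    also have "\<dots> = (\<Sum>J\<in>{J. card J = m}. face_integral_star (vface J) (face_operator q \<Delta> (vface J) f))"
      unfolding codim_faces_at_vertex by (rule sum.reindex[OF inj_on_subset[OF inj_vface], simplified o_def]) auto
    also have "\<dots> = (\<Sum>J\<in>{J. card J = m}. coord_integral J (normal_operator q (u ` J) f))"
    proof (rule sum.cong[OF refl])
      fix J :: "'n set" assume "J \<in> {J. card J = m}"
      then have op: "constant_coefficient_operator (q - card (u ` J)) (span (u ` J)) (normal_operator q (u ` J))"
        using mq by (intro normal_operator_cco) (auto simp: card_u_image)
      show "face_integral_star (vface J) (face_operator q \<Delta> (vface J) f) = coord_integral J (normal_operator q (u ` J) f)"
        unfolding face_operator_vface
      proof (rule face_integral_star_vface[OF supported_cco[OF op f]])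
        fix x assume "x \<in> wedge u c" "normal_operator q (u ` J) f x \<noteq> 0"
        then show "x \<in> \<Delta>"
          using wedge_region[OF H(2)] operator_zero_off_region[OF op f(1) off] by blast
      qed
    qed
    finally show ?thesis .
  qed
  have coeff: "(\<Sum>\<alpha>\<in>{\<alpha>. (\<Sum>i\<in>UNIV. \<alpha> i) = q}. coord_coefficient f \<alpha>)
      = (if q = 0 then (LINT x:\<Delta>|lborel. f x)
         else (\<Sum>m = 1..q. \<Sum>F\<in>codim_faces m \<Delta>. face_integral_star F (face_operator q \<Delta> F f)))" for q
  proof -
    let ?t = "\<lambda>J. coord_integral J (normal_operator q (u ` J) f)"
    have big: "?t J = 0" if "q < card J" for J
    proof -
      have "normal_operator q (u ` J) f = (\<lambda>_. 0)"
        using that by (intro ext normal_operator_zero) (auto simp: card_u_image)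
      then show ?thesis by (simp add: coord_integral_def)
    qed
    show ?thesis
    proof (cases "q = 0")
      case True
      have "(\<Sum>J\<in>UNIV. ?t J) = (\<Sum>J\<in>{{}}. ?t J)"
        using big True by (intro sum.mono_neutral_right) (auto simp: card_gt_0_iff)
      then show ?thesis
        using True int0 unfolding coord_expansion_normal[OF f] by (simp add: normal_operator_empty)
    next
      case False
      have "(\<Sum>J\<in>UNIV. ?t J) = (\<Sum>J\<in>{J. 1 \<le> card J \<and> card J \<le> q}. ?t J)"
      proof (rule sum.mono_neutral_right)
        show "\<forall>J\<in>UNIV - {J. 1 \<le> card J \<and> card J \<le> q}. ?t J = 0"
        proof
          fix J :: "'n set" assume J: "J \<in> UNIV - {J. 1 \<le> card J \<and> card J \<le> q}"
          show "?t J = 0"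
          proof (cases "q < card J")
            case True then show ?thesis by (rule big)
          next
            case False
            then have "card J = 0" using J by (simp add: not_le)
            then have "J = {}" by simp
            then show ?thesis using \<open>q \<noteq> 0\<close> by (simp add: normal_operator_empty coord_integral_def)
          qed
        qed
      qed auto
      also have "\<dots> = (\<Sum>m = 1..q. \<Sum>J\<in>{J \<in> {J. 1 \<le> card J \<and> card J \<le> q}. card J = m}. ?t J)"
        by (rule sum.group[symmetric]) auto
      also have "\<dots> = (\<Sum>m = 1..q. \<Sum>F\<in>codim_faces m \<Delta>. face_integral_star F (face_operator q \<Delta> F f))"
        by (intro sum.cong refl) (auto simp: star intro!: sum.cong)
      finally show ?thesis using False unfolding coord_expansion_normal[OF f] by simp
    qed
  qed
  show ?thesis
    using wedge_expansion[OF regular f] unfolding coeff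
    using asymptotic_expansion_cong[OF riemann] by simp
qed

end

section \<open>A partition of unity\<close>

text \<open>
  The functions \<open>p(1/t) e\<^sup>-\<^sup>1\<^sup>/\<^sup>t\<close>, extended by zero. This class is closed under differentiation, which
  proves the smoothness of \<open>e\<^sup>-\<^sup>1\<^sup>/\<^sup>t\<close>.
\<close>

definition flat_exp :: "real poly \<Rightarrow> real \<Rightarrow> real" where
  "flat_exp p t = (if t > 0 then poly p (1 / t) * exp (- (1 / t)) else 0)"

lemma poly_times_exp_minus_tendsto_0: "((\<lambda>s. poly p s * exp (- s)) \<longlongrightarrow> 0) at_top"
  for p :: "real poly"
proof -
  have "((\<lambda>s. \<Sum>i\<le>degree p. coeff p i * (s ^ i / exp s)) \<longlongrightarrow> (\<Sum>i\<le>degree p. coeff p i * 0)) at_top"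
    by (intro tendsto_intros tendsto_power_div_exp_0)
  moreover have "(\<lambda>s. \<Sum>i\<le>degree p. coeff p i * (s ^ i / exp s)) = (\<lambda>s. poly p s * exp (- s))"
    by (simp add: poly_altdef exp_minus sum_distrib_right divide_inverse mult.assoc)
  ultimately show ?thesis by simp
qed

lemma flat_exp_tendsto_0: "(flat_exp p \<longlongrightarrow> 0) (at_right 0)"
proof -
  have "((\<lambda>t. poly p (inverse t) * exp (- inverse t)) \<longlongrightarrow> 0) (at_right 0)"
    by (rule filterlim_compose[OF poly_times_exp_minus_tendsto_0 filterlim_inverse_at_top_right])
  moreover have "eventually (\<lambda>t. poly p (inverse t) * exp (- inverse t) = flat_exp p t) (at_right 0)"
    by (rule eventually_mono[OF eventually_at_right_less]) (simp add: flat_exp_def inverse_eq_divide)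
  ultimately show ?thesis by (rule Lim_transform_eventually)
qed

lemma flat_exp_derivative:
  "(flat_exp p has_real_derivative flat_exp ([:0, 0, 1:] * (p - pderiv p)) t) (at t)"
proof (cases t "0 :: real" rule: linorder_cases)
  case greater
  have "((\<lambda>t. poly p (1 / t) * exp (- (1 / t))) has_real_derivative
      flat_exp ([:0, 0, 1:] * (p - pderiv p)) t) (at t)"
    using greater by (auto intro!: derivative_eq_intros DERIV_chain2[of "poly p"] poly_DERIV
        simp: flat_exp_def field_simps power2_eq_square)
  then show ?thesis
    by (rule has_field_derivative_transform_within_open[of _ _ _ "{0<..}"])
      (use greater in \<open>auto simp: flat_exp_def\<close>)
next
  case less
  have "((\<lambda>t. 0) has_real_derivative 0) (at t)" by simp
  then have "(flat_exp p has_real_derivative 0) (at t)"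
    by (rule has_field_derivative_transform_within_open[of _ _ _ "{..<0}"])
      (use less in \<open>auto simp: flat_exp_def\<close>)
  then show ?thesis using less by (simp add: flat_exp_def)
next
  case equal
  have "((\<lambda>h. (flat_exp p (0 + h) - flat_exp p 0) / h) \<longlongrightarrow> 0) (at 0)"
  proof (rule filterlim_split_at)
    have "eventually (\<lambda>h. 0 = (flat_exp p (0 + h) - flat_exp p 0) / h) (at_left 0)"
      by (auto simp: eventually_at_filter flat_exp_def intro!: always_eventually)
    then show "((\<lambda>h. (flat_exp p (0 + h) - flat_exp p 0) / h) \<longlongrightarrow> 0) (at_left 0)"
      by (rule Lim_transform_eventually[OF tendsto_const])
    have "eventually (\<lambda>h. flat_exp (pCons 0 p) h = (flat_exp p (0 + h) - flat_exp p 0) / h) (at_right 0)"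
      by (rule eventually_mono[OF eventually_at_right_less]) (simp add: flat_exp_def)
    then show "((\<lambda>h. (flat_exp p (0 + h) - flat_exp p 0) / h) \<longlongrightarrow> 0) (at_right 0)"
      by (rule Lim_transform_eventually[OF flat_exp_tendsto_0])
  qed
  then have "(flat_exp p has_real_derivative 0) (at 0)" by (simp add: DERIV_def)
  then show ?thesis using equal by (simp add: flat_exp_def)
qed

lemma smooth_flat_exp: "smooth (flat_exp p)"
proof -
  have "C_k k (flat_exp p)" for k
  proof (induction k arbitrary: p)
    case 0
    then show ?case
      using flat_exp_derivative by (auto intro!: continuous_at_imp_continuous_on DERIV_isCont)
  next
    case (Suc k)
    let ?q = "[:0, 0, 1:] * (p - pderiv p)"
    have d: "(flat_exp p has_derivative (\<lambda>a. flat_exp ?q t * a)) (at t)" for t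
      using flat_exp_derivative[of p t] by (simp add: has_field_derivative_def)
    have "C_k k (\<lambda>t. flat_exp ?q t * a)" for a
      by (intro C_k_mult C_k_const Suc.IH)
    then show ?case
      using d frechet_derivative_eqI[OF d] by (auto simp: differentiable_def simp del: mult_pCons_left)
  qed
  then show ?thesis by (simp add: smooth_def)
qed

abbreviation bump :: "real \<Rightarrow> real" where
  "bump \<equiv> flat_exp 1"

lemma bump_nonneg: "0 \<le> bump t" and bump_pos_iff: "0 < bump t \<longleftrightarrow> 0 < t"
  by (simp_all add: flat_exp_def)

text \<open>
  A product of bump functions in the linear forms of \<open>H\<close> is positive exactly on a region. On \<open>\<Delta>\<close> the
  sum of these products is bounded below by a positive constant, so one can divide by it.
\<close>

lemma smooth_partition:
  fixes \<Delta> :: "'a::euclidean_space set"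
  assumes "compact \<Delta>" "finite H" "finite V" and cover: "\<And>x. x \<in> \<Delta> \<Longrightarrow> \<exists>p\<in>V. x \<in> region H p"
  obtains \<eta> U where "\<And>p. smooth (\<eta> p)" "\<And>p x. x \<notin> region H p \<Longrightarrow> \<eta> p x = 0"
    "open U" "\<Delta> \<subseteq> U" "\<And>x. x \<in> U \<Longrightarrow> (\<Sum>p\<in>V. \<eta> p x) = 1"
proof -
  define A where "A p = {h \<in> H. fst h \<bullet> p < snd h}" for p
  define \<phi> where "\<phi> p x = (\<Prod>h\<in>A p. bump (snd h - fst h \<bullet> x))" for p x
  define \<Phi> where "\<Phi> x = (\<Sum>p\<in>V. \<phi> p x)" for x
  have fA: "finite (A p)" for p using assms(2) by (simp add: A_def)
  have s\<phi>: "smooth (\<phi> p)" for p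
    unfolding \<phi>_def by (intro smooth_prod smooth_compose[OF smooth_flat_exp] smooth_affine)
  have s\<Phi>: "smooth \<Phi>" unfolding \<Phi>_def by (intro smooth_sum s\<phi>)
  have \<phi>0: "0 \<le> \<phi> p x" for p x unfolding \<phi>_def by (intro prod_nonneg) (simp add: bump_nonneg)
  have \<phi>1: "0 < \<phi> p x" if "x \<in> region H p" for p x
    unfolding \<phi>_def using that by (intro prod_pos) (auto simp: bump_pos_iff A_def region_def)
  have \<phi>2: "\<phi> p x = 0" if "x \<notin> region H p" for p x
  proof -
    have "\<exists>h\<in>H. fst h \<bullet> p < snd h \<and> snd h \<le> fst h \<bullet> x"
      using that by (force simp: region_def not_less)
    then obtain h where h: "h \<in> A p" "snd h \<le> fst h \<bullet> x" by (auto simp: A_def)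
    have "\<exists>h\<in>A p. bump (snd h - fst h \<bullet> x) = 0"
      by (rule bexI[OF _ h(1)]) (use h(2) in \<open>simp add: flat_exp_def\<close>)
    then show ?thesis unfolding \<phi>_def using fA by (intro prod_zero) auto
  qed
  have \<Phi>0: "0 \<le> \<Phi> x" for x unfolding \<Phi>_def by (intro sum_nonneg \<phi>0)
  have \<Phi>1: "0 < \<Phi> x" if x: "x \<in> \<Delta>" for x
  proof -
    obtain p where p: "p \<in> V" "x \<in> region H p" using cover[OF x] by blast
    then have "0 < \<phi> p x" by (intro \<phi>1)
    also have "\<phi> p x \<le> \<Phi> x" unfolding \<Phi>_def using p(1) assms(3) \<phi>0 by (intro member_le_sum) auto
    finally show ?thesis .
  qed
  have "\<exists>m>0. \<forall>x\<in>\<Delta>. m \<le> \<Phi> x"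
  proof (cases "\<Delta> = {}")
    case False
    then obtain y where "y \<in> \<Delta>" "\<forall>x\<in>\<Delta>. \<Phi> y \<le> \<Phi> x"
      using continuous_attains_inf[OF assms(1) False smooth_continuous[OF s\<Phi>]] by blast
    then show ?thesis using \<Phi>1 by blast
  qed (auto intro: exI[of _ 1])
  then obtain m where m: "m > 0" "\<And>x. x \<in> \<Delta> \<Longrightarrow> m \<le> \<Phi> x" by blast
  \<comment> \<open>The correction term makes the denominator positive everywhere and vanishes near \<open>\<Delta>\<close>.\<close>
  define D where "D x = \<Phi> x + bump (m / 2 - 1 * \<Phi> x)" for x
  have D: "D x \<noteq> 0" for x
  proof -
    have "0 < D x"
    proof (cases "\<Phi> x = 0")
      case True
      then show ?thesis using m(1) by (simp add: D_def bump_pos_iff)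
    next
      case False
      then have "0 < \<Phi> x" using \<Phi>0[of x] by simp
      then show ?thesis using bump_nonneg[of "m / 2 - 1 * \<Phi> x"] by (simp add: D_def)
    qed
    then show ?thesis by simp
  qed
  have sD: "smooth D"
  proof -
    have "smooth (\<lambda>x. m / 2 + (- 1) * \<Phi> x)" by (intro smooth_add smooth_const smooth_mult s\<Phi>)
    then have "smooth (\<lambda>x. bump (m / 2 - 1 * \<Phi> x))"
      using smooth_compose[OF smooth_flat_exp] by fastforce
    then show ?thesis unfolding D_def by (intro smooth_add s\<Phi>)
  qed
  show ?thesis
  proof (rule that[of "\<lambda>p x. \<phi> p x * inverse (D x)" "{x. m / 2 < \<Phi> x}"])
    show "smooth (\<lambda>x. \<phi> p x * inverse (D x))" for p
      by (intro smooth_mult s\<phi> smooth_inverse D sD)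
    show "\<phi> p x * inverse (D x) = 0" if "x \<notin> region H p" for p x using \<phi>2[OF that] by simp
    show "open {x. m / 2 < \<Phi> x}"
      by (intro open_Collect_less continuous_on_const smooth_continuous s\<Phi>)
    show "\<Delta> \<subseteq> {x. m / 2 < \<Phi> x}" using m by force
    show "(\<Sum>p\<in>V. \<phi> p x * inverse (D x)) = 1" if "x \<in> {x. m / 2 < \<Phi> x}" for x
    proof -
      have "D x = \<Phi> x" using that by (simp add: D_def flat_exp_def)
      moreover have "\<Phi> x \<noteq> 0" using that m(1) by auto
      ultimately show ?thesis by (simp add: \<Phi>_def flip: sum_distrib_right)
    qed
  qed
qed

section \<open>The expansion on a Delzant polytope\<close>

lemma finite_int_vecs_bounded:
  assumes "bounded (S :: (real ^ 'n) set)"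
  shows "finite (int_vecs \<inter> S)"
proof -
  obtain M where M: "\<And>x. x \<in> S \<Longrightarrow> norm x \<le> M" using assms by (auto simp: bounded_iff)
  have "int_vecs \<inter> S \<subseteq> (\<lambda>g. \<chi> i. of_int (g i)) ` (PiE UNIV (\<lambda>_::'n. {- \<lceil>M\<rceil>..\<lceil>M\<rceil>}))"
  proof
    fix x assume x: "x \<in> int_vecs \<inter> S"
    have i: "of_int \<lfloor>x $ i\<rfloor> = x $ i" for i using x by (simp add: int_vecs_def)
    have b: "\<bar>x $ i\<bar> \<le> M" for i using component_le_norm_cart[of x i] M[of x] x by simp
    show "x \<in> (\<lambda>g. \<chi> i. of_int (g i)) ` (PiE UNIV (\<lambda>_::'n. {- \<lceil>M\<rceil>..\<lceil>M\<rceil>}))"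
    proof (rule image_eqI)
      show "x = (\<chi> i. of_int \<lfloor>x $ i\<rfloor>)" by (simp add: vec_eq_iff i)
      show "(\<lambda>i. \<lfloor>x $ i\<rfloor>) \<in> PiE UNIV (\<lambda>_::'n. {- \<lceil>M\<rceil>..\<lceil>M\<rceil>})"
      proof -
        have "\<lfloor>x $ i\<rfloor> \<in> {- \<lceil>M\<rceil>..\<lceil>M\<rceil>}" for i using b[of i] by simp linarith
        then show ?thesis by (simp add: PiE_UNIV_domain)
      qed
    qed
  qed
  then show ?thesis by (rule finite_subset) (intro finite_imageI finite_PiE, auto)
qed

lemma riemann_sum_bounded:
  fixes f :: "real ^ 'n \<Rightarrow> real"
  assumes "bounded S"
  shows "riemann_sum f S N = 1 / real N ^ CARD('n) *
     (\<Sum>k \<in> int_vecs \<inter> (\<lambda>x. real N *\<^sub>R x) ` S. f (k /\<^sub>R real N))"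
  unfolding riemann_sum_def using finite_int_vecs_bounded[OF bounded_scaling[OF assms, of "real N"]]
  by (simp add: infsum_finite)

lemma asymptotic_expansion_sum:
  assumes "\<And>i. i \<in> I \<Longrightarrow> asymptotic_expansion (S i) (a i)"
  shows "asymptotic_expansion (\<lambda>N. \<Sum>i\<in>I. S i N) (\<lambda>q. \<Sum>i\<in>I. a i q)"
  unfolding asymptotic_expansion_def
proof
  fix Q
  have "(\<lambda>N. \<Sum>i\<in>I. S i N - (\<Sum>q\<le>Q. a i q / real N ^ q)) \<in> O(\<lambda>N. 1 / real N ^ (Q + 1))"
    using assms by (intro big_sum_in_bigo) (auto simp: asymptotic_expansion_def)
  moreover have "(\<Sum>i\<in>I. S i N - (\<Sum>q\<le>Q. a i q / real N ^ q))
      = (\<Sum>i\<in>I. S i N) - (\<Sum>q\<le>Q. (\<Sum>i\<in>I. a i q) / real N ^ q)" for N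
    unfolding sum_subtractf sum_divide_distrib by (subst sum.swap) simp
  ultimately show "(\<lambda>N. (\<Sum>i\<in>I. S i N) - (\<Sum>q\<le>Q. (\<Sum>i\<in>I. a i q) / real N ^ q)) \<in> O(\<lambda>N. 1 / real N ^ (Q + 1))"
    by simp
qed

lemma emeasure_affine_lborel_bounded:
  assumes "F \<noteq> {}" "compact F"
  shows "emeasure (affine_lborel F) F < \<infinity>"
proof -
  obtain p where p: "p \<in> F" using assms(1) by blast
  define B where "B = (SOME B. orthonormal_basis B (direction_space F))"
  have d: "dual_family B (\<lambda>b. b) (\<lambda>b. b)"
    unfolding B_def
    by (rule orthonormal_basis_dual_family[OF some_orthonormal_basis]) (simp add: direction_space_def)
  have Bn: "norm b = 1" if "b \<in> B" for b
    using some_orthonormal_basis[of "direction_space F"] that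
    by (auto simp: B_def orthonormal_basis_def direction_space_def)
  have "bounded ((\<lambda>x. x - p) ` F)" using compact_imp_bounded[OF assms(2)] bounded_translation_minus by blast
  then obtain M where M: "\<And>x. x \<in> F \<Longrightarrow> norm (x - p) \<le> M" by (auto simp: bounded_iff)
  define A where "A = {x. \<forall>b\<in>B. - M \<le> b \<bullet> x \<and> b \<bullet> x \<le> M}"
  have Am: "A \<in> sets borel"
  proof -
    have "finite B" using d by (simp add: dual_family_def)
    then show ?thesis unfolding A_def by measurable
  qed
  have Fm: "F \<in> sets borel" using assms(2) by (simp add: borel_compact)
  have "emeasure (affine_lborel F) F = emeasure (span_measure B (\<lambda>b. b)) ((\<lambda>x. p + x) -` F)"
    using affine_lborel_eq[OF p, of p] Fm
    by (simp add: direction_space_def span_zero emeasure_distr subspace_measure_def B_def)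
  also have "\<dots> \<le> emeasure (span_measure B (\<lambda>b. b)) A"
  proof (rule emeasure_mono)
    show "(\<lambda>x. p + x) -` F \<subseteq> A"
    proof
      fix x assume "x \<in> (\<lambda>x. p + x) -` F"
      then have "norm x \<le> M" using M[of "p + x"] by simp
      then have "\<bar>b \<bullet> x\<bar> \<le> M" if "b \<in> B" for b
        using Cauchy_Schwarz_ineq2[of b x] Bn[OF that] by simp
      then show "x \<in> A" by (auto simp: A_def abs_le_iff) (metis minus_le_iff)
    qed
  qed (use Am in simp)
  also have "\<dots> = (\<Prod>b\<in>B. emeasure lborel {- M..M})"
    by (rule emeasure_span_measure_box[OF d Am]) (auto simp: A_def dual_family_coordinate[OF d])
  also have "\<dots> < \<infinity>"
    using M[OF p] by (simp add: ennreal_power less_top)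
  finally show ?thesis .
qed

lemma face_integrable:
  assumes "F \<noteq> {}" "compact F" "continuous_on UNIV g"
  shows "integrable (affine_lborel F) (\<lambda>x. indicator F x *\<^sub>R (g x :: real))"
proof -
  have "compact (g ` F)" using assms continuous_on_subset by (intro compact_continuous_image) auto
  then obtain C where C: "\<And>x. x \<in> F \<Longrightarrow> norm (g x) \<le> C"
    using compact_imp_bounded bounded_iff by (metis imageI)
  have s: "sets (affine_lborel F) = sets borel" by (simp add: affine_lborel_def Let_def)
  show ?thesis
  proof (rule integrableI_bounded_set_indicator[where B = C])
    show "F \<in> sets (affine_lborel F)" using assms(2) s by (simp add: borel_compact)
    show "g \<in> borel_measurable (affine_lborel F)"
      using borel_measurable_continuous_onI[OF assms(3)] measurable_cong_sets[OF s refl] by blast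
    show "emeasure (affine_lborel F) F < \<infinity>" by (rule emeasure_affine_lborel_bounded[OF assms(1,2)])
  qed (use C in auto)
qed

lemma face_integral_star_sum:
  assumes "F \<noteq> {}" "compact F" "\<And>i. i \<in> I \<Longrightarrow> continuous_on UNIV (g i)"
    and "\<And>x. x \<in> F \<Longrightarrow> h x = (\<Sum>i\<in>I. g i x)"
  shows "face_integral_star F h = (\<Sum>i\<in>I. face_integral_star F (g i))"
proof -
  have "(\<lambda>x. indicator F x *\<^sub>R h x) = (\<lambda>x. \<Sum>i\<in>I. indicator F x *\<^sub>R g i x)"
    using assms(4) by (auto simp: indicator_def fun_eq_iff)
  then have "face_integral F h = (\<integral>x. (\<Sum>i\<in>I. indicator F x *\<^sub>R g i x) \<partial>affine_lborel F)"
    unfolding face_integral_def set_lebesgue_integral_def by (simp only:)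
  also have "\<dots> = (\<Sum>i\<in>I. face_integral F (g i))"
    unfolding face_integral_def set_lebesgue_integral_def
    by (rule Bochner_Integration.integral_sum) (rule face_integrable[OF assms(1,2,3)])
  finally show ?thesis by (simp add: face_integral_star_def sum_distrib_left)
qed

lemma set_integral_lborel_sum:
  fixes g :: "'i \<Rightarrow> 'a::euclidean_space \<Rightarrow> real"
  assumes "compact S" "\<And>i. i \<in> I \<Longrightarrow> continuous_on UNIV (g i)" "\<And>x. x \<in> S \<Longrightarrow> h x = (\<Sum>i\<in>I. g i x)"
  shows "(LINT x:S|lborel. h x) = (\<Sum>i\<in>I. LINT x:S|lborel. g i x)"
proof -
  have "(\<lambda>x. indicator S x *\<^sub>R h x) = (\<lambda>x. \<Sum>i\<in>I. indicator S x *\<^sub>R g i x)"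
    using assms(3) by (auto simp: indicator_def fun_eq_iff)
  moreover have "integrable lborel (\<lambda>x. indicator S x *\<^sub>R g i x)" if "i \<in> I" for i
    using assms(1,2) that by (intro borel_integrable_compact) (auto intro: continuous_on_subset)
  ultimately show ?thesis
    unfolding set_lebesgue_integral_def by (simp only: Bochner_Integration.integral_sum)
qed

lemma polytope_vertex_exists:
  fixes \<Delta> :: "(real ^ 'n::finite) set"
  assumes D: "integral_delzant \<Delta>" and p: "p extreme_point_of \<Delta>"
    and f: "continuous_on UNIV f" "compact (closure {x. f x \<noteq> 0})"
  obtains u v c \<rho> where "polytope_vertex u v c \<rho> \<Delta> p" "wedge_coordinates.supported u \<rho> f"
proof -
  obtain u v c where ch: "vertex_chart \<Delta> u v c p" by (rule delzant_vertex_chart[OF D p])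
  then have "dual_basis u v" by (simp add: vertex_chart_def)
  then obtain \<rho> where \<rho>: "wedge_coordinates u v c \<rho>" "wedge_coordinates.supported u \<rho> f"
    using wedge_coordinates_exists[OF _ f] by blast
  have "polytope_vertex u v c \<rho> \<Delta> p"
    using \<rho>(1) ch D by (simp add: polytope_vertex_def polytope_vertex_axioms_def integral_delzant_def delzant_def)
  then show ?thesis using that \<rho>(2) by blast
qed

text \<open>
  Any vertex of \<open>F\<close> serves to identify the operator.
\<close>

lemma face_operator_normal:
  fixes \<Delta> :: "(real ^ 'n::finite) set"
  assumes D: "integral_delzant \<Delta>" and F: "F \<in> codim_faces m \<Delta>" and "m \<le> q"
  shows "normal_diff_operator (q - m) F (face_operator q \<Delta> F)"
proof -
  have P: "polytope \<Delta>" using D by (simp add: integral_delzant_def delzant_def)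
  have FD: "F face_of \<Delta>" "F \<noteq> {}" using F by (auto simp: codim_faces_def)
  have "compact F" "convex F"
    using face_of_polytope_polytope[OF P FD(1)] polytope_imp_compact polytope_imp_convex by auto
  then obtain p where "p extreme_point_of F" using extreme_point_exists_convex FD(2) by blast
  then have p: "p extreme_point_of \<Delta>" "p \<in> F" using extreme_point_of_face[OF FD(1)] by auto
  obtain u v c \<rho> where "polytope_vertex u v c \<rho> \<Delta> p" "wedge_coordinates.supported u \<rho> (\<lambda>_. 0)"
    by (rule polytope_vertex_exists[OF D p(1), of "\<lambda>_. 0"]) auto
  interpret polytope_vertex u v c \<rho> \<Delta> p by fact
  obtain J where J: "F = vface J" "card J = m"
    using F p(2) codim_faces_at_vertex[of m] by blast
  show ?thesis using normal_diff_operator_vface[of J q] J \<open>m \<le> q\<close> by simp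
qed

text \<open>
  Both sides are additive in \<open>f\<close>, and on a neighbourhood of \<open>\<Delta>\<close> the function \<open>f\<close> is the sum of its
  pieces. The operators do not depend on the piece, so the coefficients add up on each face.
\<close>

theorem delzant_asymptotics:
  fixes \<Delta> :: "(real ^ 'n::finite) set"
  assumes D: "integral_delzant \<Delta>" and f: "smooth_compact_support f"
  shows "asymptotic_expansion (riemann_sum f \<Delta>)
    (\<lambda>q. if q = 0 then (LINT x:\<Delta>|lborel. f x)
         else (\<Sum>m = 1..q. \<Sum>F\<in>codim_faces m \<Delta>. face_integral_star F (face_operator q \<Delta> F f)))"
proof -
  have P: "polytope \<Delta>" using D by (simp add: integral_delzant_def delzant_def)
  have sf: "smooth f" and cf: "compact (closure {x. f x \<noteq> 0})"
    using f by (auto simp: smooth_compact_support_def smooth_def)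
  obtain H where H: "finite H" "\<Delta> = {x. \<forall>(a, b)\<in>H. a \<bullet> x \<le> b}" by (rule polytope_halfspaces[OF P])
  define V where "V = {p. p extreme_point_of \<Delta>}"
  have fV: "finite V" unfolding V_def using finite_polyhedron_extreme_points polytope_imp_polyhedron[OF P] by blast
  have cover: "\<exists>p\<in>V. x \<in> region H p" if "x \<in> \<Delta>" for x
    using region_cover[OF H P that] by (auto simp: V_def)
  obtain \<eta> U where \<eta>: "\<And>p. smooth (\<eta> p)" "\<And>p x. x \<notin> region H p \<Longrightarrow> \<eta> p x = 0"
    and U: "open U" "\<Delta> \<subseteq> U" "\<And>x. x \<in> U \<Longrightarrow> (\<Sum>p\<in>V. \<eta> p x) = 1"
    using smooth_partition[OF polytope_imp_compact[OF P] H(1) fV cover] by blast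
  define g where "g p x = \<eta> p x * f x" for p x
  have sg: "smooth (g p)" for p unfolding g_def by (intro smooth_mult \<eta> sf)
  have cg: "compact (closure {x. g p x \<noteq> 0})" for p
  proof -
    have "closure {x. g p x \<noteq> 0} \<subseteq> closure {x. f x \<noteq> 0}"
      by (intro closure_mono) (auto simp: g_def)
    then show ?thesis using cf closed_closure compact_Int_closed[OF cf closed_closure]
      by (metis Int_absorb1)
  qed
  have fg: "f x = (\<Sum>p\<in>V. g p x)" if "x \<in> U" for x
    using U(3)[OF that] by (simp add: g_def flip: sum_distrib_right)
  let ?a = "\<lambda>f q. if q = 0 then (LINT x:\<Delta>|lborel. f x)
         else (\<Sum>m = 1..q. \<Sum>F\<in>codim_faces m \<Delta>. face_integral_star F (face_operator q \<Delta> F f))"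
  have piece: "asymptotic_expansion (riemann_sum (g p) \<Delta>) (?a (g p))" if "p \<in> V" for p
  proof -
    have p: "p extreme_point_of \<Delta>" using that by (simp add: V_def)
    obtain u v c \<rho> where "polytope_vertex u v c \<rho> \<Delta> p" and sup: "wedge_coordinates.supported u \<rho> (g p)"
      by (rule polytope_vertex_exists[OF D p smooth_continuous[OF sg] cg])
    interpret polytope_vertex u v c \<rho> \<Delta> p by fact
    show ?thesis
      by (rule vertex_expansion[OF H sg sup]) (auto simp: g_def \<eta>(2) intro: face_operator_normal[OF D])
  qed
  have sums: "(\<Sum>p\<in>V. riemann_sum (g p) \<Delta> N) = riemann_sum f \<Delta> N" if N: "N > 0" for N
  proof -
    have "f (k /\<^sub>R real N) = (\<Sum>p\<in>V. g p (k /\<^sub>R real N))" if "k \<in> (\<lambda>x. real N *\<^sub>R x) ` \<Delta>" for k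
    proof -
      have "k /\<^sub>R real N \<in> U" using that N U(2) by auto
      then show ?thesis by (rule fg)
    qed
    then have eq: "(\<Sum>k \<in> int_vecs \<inter> (\<lambda>x. real N *\<^sub>R x) ` \<Delta>. f (k /\<^sub>R real N))
        = (\<Sum>k \<in> int_vecs \<inter> (\<lambda>x. real N *\<^sub>R x) ` \<Delta>. \<Sum>p\<in>V. g p (k /\<^sub>R real N))"
      by (intro sum.cong) auto
    show ?thesis
      unfolding riemann_sum_bounded[OF polytope_imp_bounded[OF P]] sum_distrib_left[symmetric] eq
      by (subst sum.swap) (rule refl)
  qed
  have coeffs: "(\<Sum>p\<in>V. ?a (g p) q) = ?a f q" for q
  proof (cases "q = 0")
    case True
    have "(LINT x:\<Delta>|lborel. f x) = (\<Sum>p\<in>V. LINT x:\<Delta>|lborel. g p x)"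
      using U(2) fg by (intro set_integral_lborel_sum polytope_imp_compact[OF P] smooth_continuous sg) auto
    then show ?thesis using True by simp
  next
    case False
    have "face_integral_star F (face_operator q \<Delta> F f) = (\<Sum>p\<in>V. face_integral_star F (face_operator q \<Delta> F (g p)))"
      if mF: "m \<le> q" "F \<in> codim_faces m \<Delta>" for m F
    proof -
      have F: "F face_of \<Delta>" "F \<noteq> {}" using mF(2) by (auto simp: codim_faces_def)
      have op: "constant_coefficient_operator (q - m) (orthogonal_comp (direction_space F)) (face_operator q \<Delta> F)"
        using face_operator_normal[OF D mF(2,1)] by (simp add: normal_diff_operator_iff)
      show ?thesis
      proof (rule face_integral_star_sum[OF F(2)])
        show "compact F" using face_of_polytope_polytope[OF P F(1)] polytope_imp_compact by blast
        show "continuous_on UNIV (face_operator q \<Delta> F (g p))" for p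
          by (rule cco_continuous[OF op sg])
        fix x assume "x \<in> F"
        then have x: "x \<in> U" using face_of_imp_subset[OF F(1)] U(2) by blast
        have "face_operator q \<Delta> F f x = face_operator q \<Delta> F (\<lambda>y. \<Sum>p\<in>V. g p y) x"
          by (rule cco_local[OF op U(1) fg sf x])
        also have "\<dots> = (\<Sum>p\<in>V. face_operator q \<Delta> F (g p) x)"
          by (rule cco_linear[OF op fV sg])
        finally show "face_operator q \<Delta> F f x = (\<Sum>p\<in>V. face_operator q \<Delta> F (g p) x)" .
      qed
    qed
    then have "(\<Sum>m = 1..q. \<Sum>F\<in>codim_faces m \<Delta>. face_integral_star F (face_operator q \<Delta> F f))
        = (\<Sum>m = 1..q. \<Sum>F\<in>codim_faces m \<Delta>. \<Sum>p\<in>V. face_integral_star F (face_operator q \<Delta> F (g p)))"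
      by (intro sum.cong refl) auto
    also have "\<dots> = (\<Sum>p\<in>V. \<Sum>m = 1..q. \<Sum>F\<in>codim_faces m \<Delta>. face_integral_star F (face_operator q \<Delta> F (g p)))"
      by (simp add: sum.swap[of _ V])
    finally show ?thesis using False by simp
  qed
  have "asymptotic_expansion (\<lambda>N. \<Sum>p\<in>V. riemann_sum (g p) \<Delta> N) (\<lambda>q. \<Sum>p\<in>V. ?a (g p) q)"
    by (intro asymptotic_expansion_sum piece)
  then show ?thesis
    unfolding coeffs using asymptotic_expansion_cong[OF sums, where a = "?a f"] by simp
qed

theorem theorem2p1:
  shows "(\<forall>(u :: 'n::finite \<Rightarrow> real ^ 'n) (c :: 'n \<Rightarrow> int) (v :: 'n \<Rightarrow> real ^ 'n)
            (f :: real ^ 'n \<Rightarrow> real).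
            regular_integer_wedge u \<longrightarrow> dual_basis u v \<longrightarrow> smooth_compact_support f \<longrightarrow>
            asymptotic_expansion (riemann_sum f (wedge u c))
              (\<lambda>q. \<Sum>\<alpha> \<in> {\<alpha> :: 'n \<Rightarrow> nat. (\<Sum>i\<in>UNIV. \<alpha> i) = q}.
                 wedge_const v \<alpha> *
                 face_integral (wedge_face u c \<alpha>)
                   (differential f (multi_tuple v (\<lambda>i. \<alpha> i - supp_index \<alpha> i)))))
       \<and>
         (CARD('n) \<in> {1, 2, 3} \<longrightarrow>
          (\<exists>R :: nat \<Rightarrow> (real ^ 'n) set \<Rightarrow> (real ^ 'n) set \<Rightarrow>
                 (real ^ 'n \<Rightarrow> real) \<Rightarrow> real ^ 'n \<Rightarrow> real.
            (\<forall>\<Delta> q m F. integral_delzant \<Delta> \<and> 1 \<le> m \<and> m \<le> q \<and> F \<in> codim_faces m \<Delta> \<longrightarrow>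
               normal_diff_operator (q - m) F (R q \<Delta> F))
          \<and> (\<forall>\<Delta> \<Delta>' q m F F'. integral_delzant \<Delta> \<and> integral_delzant \<Delta>' \<and> 1 \<le> m \<and> m \<le> q \<and>
               F \<in> codim_faces m \<Delta> \<and> F' \<in> codim_faces m \<Delta>' \<and>
               facet_pairs \<Delta> F = facet_pairs \<Delta>' F' \<longrightarrow> R q \<Delta> F = R q \<Delta>' F')
          \<and> (\<forall>\<Delta> f. integral_delzant \<Delta> \<and> smooth_compact_support f \<longrightarrow>
               asymptotic_expansion (riemann_sum f \<Delta>)
                 (\<lambda>q. if q = 0 then (LINT x:\<Delta>|lborel. f x)
                      else (\<Sum>m = 1..q. \<Sum>F\<in>codim_faces m \<Delta>. face_integral_star F (R q \<Delta> F f))))))"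
proof (intro conjI impI allI exI[of _ face_operator])
  fix u v :: "'n \<Rightarrow> real ^ 'n" and c :: "'n \<Rightarrow> int" and f :: "real ^ 'n \<Rightarrow> real"
  assume "regular_integer_wedge u" "dual_basis u v" "smooth_compact_support f"
  then show "asymptotic_expansion (riemann_sum f (wedge u c))
      (\<lambda>q. \<Sum>\<alpha> \<in> {\<alpha> :: 'n \<Rightarrow> nat. (\<Sum>i\<in>UNIV. \<alpha> i) = q}. wedge_const v \<alpha> *
        face_integral (wedge_face u c \<alpha>) (differential f (multi_tuple v (\<lambda>i. \<alpha> i - supp_index \<alpha> i))))"
    by (rule wedge_asymptotics)
next
  fix \<Delta> :: "(real ^ 'n) set" and q m F
  assume "integral_delzant \<Delta> \<and> 1 \<le> m \<and> m \<le> q \<and> F \<in> codim_faces m \<Delta>"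
  then show "normal_diff_operator (q - m) F (face_operator q \<Delta> F)" by (blast intro: face_operator_normal)
next
  fix \<Delta> \<Delta>' :: "(real ^ 'n) set" and q m F F'
  assume "integral_delzant \<Delta> \<and> integral_delzant \<Delta>' \<and> 1 \<le> m \<and> m \<le> q \<and>
      F \<in> codim_faces m \<Delta> \<and> F' \<in> codim_faces m \<Delta>' \<and> facet_pairs \<Delta> F = facet_pairs \<Delta>' F'"
  then show "face_operator q \<Delta> F = face_operator q \<Delta>' F'" by (simp add: face_operator_def)
next
  fix \<Delta> :: "(real ^ 'n) set" and f :: "real ^ 'n \<Rightarrow> real"
  assume "integral_delzant \<Delta> \<and> smooth_compact_support f"
  then show "asymptotic_expansion (riemann_sum f \<Delta>)
      (\<lambda>q. if q = 0 then (LINT x:\<Delta>|lborel. f x)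
           else (\<Sum>m = 1..q. \<Sum>F\<in>codim_faces m \<Delta>. face_integral_star F (face_operator q \<Delta> F f)))"
    by (blast intro: delzant_asymptotics)
qed

end
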